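(* Let $E$ be a (DF)-space such that each convergent sequence in $E$ converges locally. If for each convergent series $\sum(u_k)$ in $E$ $$S\bigl(\textstyle\sum(u_k)\bigr)=\sum_{k=1}^\infty u_k+\Gamma^{\bot}_{\mathrm{loc}}\bigl(\textstyle\sum(u_k)\bigr),$$ then $E$ is nuclear.
   Context: All locally convex spaces are real and Hausdorff. $cs(E)$ is the set of continuous seminorms on $E$, and $\mathcal B(E)$ is the collection of all absolutely convex, closed and bounded subsets of $E$. A fundamental system of $\mathcal B(E)$ is an increasing sequence $(B_n)$ in $\mathcal B(E)$ such that each $B\in\mathcal B(E)$ is contained in some $B_n$. $E$ is a (DF)-space if $\mathcal B(E)$ has a fundamental system $(B_n)$ and each intersection of a sequence of closed, absolutely convex zero neighbourhoods is again a zero neighbourhood provided it absorbs all bounded sets. For $p\in cs(E)$ let $E_p=E/\ker p$ with the norm induced by $p$; $E$ is nuclear if for each $p\in cs(E)$ there is $q\in cs(E)$, $q\ge p$, such that the canonical map $E_q\to E_p$ is nuclear. For an absolutely convex bounded set $B\subset E$, $E_B$ denotes $\operatorname{span}B$ normed by the Minkowski gauge functional $m_B$ of $B$. A sequence in $E$ converges locally if it is contained and converges in some $E_B$, $B\in\mathcal B(E)$. For a convergent series $\sum(u_k)$ in $E$ the domain of sums $S(\sum(u_k))$ is the set of all $x\in E$ for which there is a permutation $\pi$ of $\mathbb N$ with $x=\sum_{k=1}^\infty u_{\pi(k)}$ (convergence in $E$). If each convergent sequence in $E$ converges locally, then a convergent series $\sum(u_k)$ converges in $E_{B_0}$ for some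 $B_0\in\mathcal B(E)$. For absolutely convex bounded $B\supset B_0$ put $$\Gamma^{\bot}_{B}\bigl(\textstyle\sum(u_k)\bigr):=\{x\in E_{B}: x'(x)=0\text{ for all }x'\in(E_{B})'\text{ with }\sum_k|x'(u_k)|<\infty\},$$ $$\Gamma^{\bot}_{\mathrm{loc}}\bigl(\textstyle\sum(u_k)\bigr):=\bigcup_{B}\Gamma^{\bot}_{B}\bigl(\textstyle\sum(u_k)\bigr),$$ the union being taken over all absolutely convex bounded sets $B\supset B_0$ (equivalently, over a fundamental system $(B_n)$ of $\mathcal B(E)$ with $B_1=B_0$). This set is a subspace of $E$ and is independent of the choice of $B_0$. *)

theory Defs
  imports "HOL-Analysis.Analysis"
begin

section \<open>Locally convex Hausdorff spaces\<close>

text \<open>The last condition on \<open>V\<close> is \<open>convex V\<close>, unfolded because \<open>convex\<close> is not an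
  operation of the class \<^class>\<open>real_vector\<close>.\<close>

class locally_convex_space = real_vector + topological_ab_group_add + t2_space +
  assumes tendsto_scaleR_nhds:
      "((\<lambda>z. fst z *\<^sub>R snd z) \<longlongrightarrow> c *\<^sub>R x) (nhds c \<times>\<^sub>F nhds x)"
    and convex_nhd_base:
      "open U \<Longrightarrow> 0 \<in> U \<Longrightarrow>
         \<exists>V. open V \<and> 0 \<in> V \<and> V \<subseteq> U \<and>
           (\<forall>x\<in>V. \<forall>y\<in>V. \<forall>s\<ge>0. \<forall>t\<ge>0. s + t = 1 \<longrightarrow> s *\<^sub>R x + t *\<^sub>R y \<in> V)"

lemma convex_zero_nhd:
  fixes U :: "'a::locally_convex_space set"
  assumes "open U" "0 \<in> U"
  shows "\<exists>V. open V \<and> 0 \<in> V \<and> V \<subseteq> U \<and> convex V"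
  using convex_nhd_base[OF assms] by (simp add: convex_def)

text \<open>Normed spaces satisfy the axioms of the class.\<close>

instance real_normed_vector \<subseteq> locally_convex_space
proof
  fix c :: real and x :: 'a
  show "((\<lambda>z. fst z *\<^sub>R snd z) \<longlongrightarrow> c *\<^sub>R x) (nhds c \<times>\<^sub>F nhds x)"
    by (intro tendsto_scaleR filterlim_fst filterlim_snd)
next
  fix U :: "'a set"
  assume "open U" "0 \<in> U"
  then obtain e where "e > 0" "ball 0 e \<subseteq> U"
    using open_contains_ball by blast
  moreover have "convex (ball (0::'a) e)" by simp
  ultimately show "\<exists>V. open V \<and> 0 \<in> V \<and> V \<subseteq> U \<and>
      (\<forall>x\<in>V. \<forall>y\<in>V. \<forall>s\<ge>0. \<forall>t\<ge>0. s + t = 1 \<longrightarrow> s *\<^sub>R x + t *\<^sub>R y \<in> V)"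
    by (intro exI[of _ "ball 0 e"]) (auto simp: convex_def)
qed

definition zero_nhd :: "'a::{topological_space,zero} set \<Rightarrow> bool" where
  "zero_nhd U \<longleftrightarrow> 0 \<in> interior U"

definition absorbs :: "'a::real_vector set \<Rightarrow> 'a set \<Rightarrow> bool" where
  "absorbs A B \<longleftrightarrow> (\<exists>r>0. \<forall>t. r \<le> \<bar>t\<bar> \<longrightarrow> B \<subseteq> (\<lambda>x. t *\<^sub>R x) ` A)"

text \<open>The constant \<open>bounded\<close> of the library refers to a metric, so boundedness in the sense of
  topological vector spaces needs a separate notion.\<close>

definition tvs_bounded :: "'a::locally_convex_space set \<Rightarrow> bool" where
  "tvs_bounded B \<longleftrightarrow> (\<forall>U. zero_nhd U \<longrightarrow> absorbs U B)"

text \<open>Absolutely convex sets are taken to be nonempty, hence they contain \<open>0\<close>.\<close>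

definition absconvex :: "'a::real_vector set \<Rightarrow> bool" where
  "absconvex A \<longleftrightarrow> A \<noteq> {} \<and>
     (\<forall>x\<in>A. \<forall>y\<in>A. \<forall>a b. \<bar>a\<bar> + \<bar>b\<bar> \<le> 1 \<longrightarrow> a *\<^sub>R x + b *\<^sub>R y \<in> A)"

definition bdd_discs :: "'a::locally_convex_space set set" where
  "bdd_discs = {B. absconvex B \<and> closed B \<and> tvs_bounded B}"

definition is_fundamental_system :: "(nat \<Rightarrow> 'a::locally_convex_space set) \<Rightarrow> bool" where
  "is_fundamental_system B \<longleftrightarrow>
     incseq B \<and> (\<forall>n. B n \<in> bdd_discs) \<and> (\<forall>D\<in>bdd_discs. \<exists>n. D \<subseteq> B n)"

definition DF_space :: "'a::locally_convex_space itself \<Rightarrow> bool" where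
  "DF_space _ \<longleftrightarrow>
     (\<exists>B :: nat \<Rightarrow> 'a set. is_fundamental_system B) \<and>
     (\<forall>U :: nat \<Rightarrow> 'a set.
        (\<forall>n. closed (U n) \<and> absconvex (U n) \<and> zero_nhd (U n)) \<longrightarrow>
        (\<forall>B. tvs_bounded B \<longrightarrow> absorbs (\<Inter>n. U n) B) \<longrightarrow>
        zero_nhd (\<Inter>n. U n))"


section \<open>Normed spaces on explicit carriers\<close>

text \<open>The spaces \<open>E\<^sub>p\<close> and \<open>E\<^sub>B\<close> depend on a seminorm \<open>p\<close> or a set \<open>B\<close> and so cannot
  be instances of the class \<^class>\<open>real_normed_vector\<close>; their carriers, operations and norms are
  given by a record instead.\<close>

record 'a nspace =
  ns_carrier :: "'a set"
  ns_zero :: 'a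
  ns_add :: "'a \<Rightarrow> 'a \<Rightarrow> 'a"
  ns_scale :: "real \<Rightarrow> 'a \<Rightarrow> 'a"
  ns_norm :: "'a \<Rightarrow> real"

locale normed_space_on =
  fixes X :: "'a nspace"
  assumes zero_closed: "ns_zero X \<in> ns_carrier X"
    and add_closed: "x \<in> ns_carrier X \<Longrightarrow> y \<in> ns_carrier X \<Longrightarrow> ns_add X x y \<in> ns_carrier X"
    and scale_closed: "x \<in> ns_carrier X \<Longrightarrow> ns_scale X c x \<in> ns_carrier X"
    and add_assoc: "x \<in> ns_carrier X \<Longrightarrow> y \<in> ns_carrier X \<Longrightarrow> z \<in> ns_carrier X \<Longrightarrow>
          ns_add X (ns_add X x y) z = ns_add X x (ns_add X y z)"
    and add_commute: "x \<in> ns_carrier X \<Longrightarrow> y \<in> ns_carrier X \<Longrightarrow> ns_add X x y = ns_add X y x"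
    and add_zero: "x \<in> ns_carrier X \<Longrightarrow> ns_add X (ns_zero X) x = x"
    and add_inverse: "x \<in> ns_carrier X \<Longrightarrow> ns_add X x (ns_scale X (-1) x) = ns_zero X"
    and scale_add_right: "x \<in> ns_carrier X \<Longrightarrow> y \<in> ns_carrier X \<Longrightarrow>
          ns_scale X c (ns_add X x y) = ns_add X (ns_scale X c x) (ns_scale X c y)"
    and scale_add_left: "x \<in> ns_carrier X \<Longrightarrow>
          ns_scale X (c + d) x = ns_add X (ns_scale X c x) (ns_scale X d x)"
    and scale_scale: "x \<in> ns_carrier X \<Longrightarrow> ns_scale X c (ns_scale X d x) = ns_scale X (c * d) x"
    and scale_one: "x \<in> ns_carrier X \<Longrightarrow> ns_scale X 1 x = x"
    and norm_triangle: "x \<in> ns_carrier X \<Longrightarrow> y \<in> ns_carrier X \<Longrightarrow>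
          ns_norm X (ns_add X x y) \<le> ns_norm X x + ns_norm X y"
    and norm_scale: "x \<in> ns_carrier X \<Longrightarrow> ns_norm X (ns_scale X c x) = \<bar>c\<bar> * ns_norm X x"
    and norm_definite: "x \<in> ns_carrier X \<Longrightarrow> ns_norm X x = 0 \<longleftrightarrow> x = ns_zero X"

definition ns_tendsto :: "'a nspace \<Rightarrow> (nat \<Rightarrow> 'a) \<Rightarrow> 'a \<Rightarrow> bool" where
  "ns_tendsto X s l \<longleftrightarrow> (\<forall>n. s n \<in> ns_carrier X) \<and> l \<in> ns_carrier X \<and>
     (\<lambda>n. ns_norm X (ns_add X (s n) (ns_scale X (-1) l))) \<longlonglongrightarrow> 0"

primrec ns_psum :: "'a nspace \<Rightarrow> (nat \<Rightarrow> 'a) \<Rightarrow> nat \<Rightarrow> 'a" where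
  "ns_psum X u 0 = ns_zero X"
| "ns_psum X u (Suc n) = ns_add X (ns_psum X u n) (u n)"

definition ns_sums :: "'a nspace \<Rightarrow> (nat \<Rightarrow> 'a) \<Rightarrow> 'a \<Rightarrow> bool" where
  "ns_sums X u l \<longleftrightarrow> (\<forall>n. u n \<in> ns_carrier X) \<and> ns_tendsto X (ns_psum X u) l"

text \<open>Functionals are total functions; only their values on the carrier matter.\<close>

definition ns_dual :: "'a nspace \<Rightarrow> ('a \<Rightarrow> real) set" where
  "ns_dual X = {f.
     (\<forall>x\<in>ns_carrier X. \<forall>y\<in>ns_carrier X. f (ns_add X x y) = f x + f y) \<and>
     (\<forall>c. \<forall>x\<in>ns_carrier X. f (ns_scale X c x) = c * f x) \<and>
     (\<exists>K. \<forall>x\<in>ns_carrier X. \<bar>f x\<bar> \<le> K * ns_norm X x)}"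

definition ns_dual_norm :: "'a nspace \<Rightarrow> ('a \<Rightarrow> real) \<Rightarrow> real" where
  "ns_dual_norm X f = (SUP x\<in>{x \<in> ns_carrier X. ns_norm X x \<le> 1}. \<bar>f x\<bar>)"

definition nuclear_map :: "'a nspace \<Rightarrow> 'b nspace \<Rightarrow> ('a \<Rightarrow> 'b) \<Rightarrow> bool" where
  "nuclear_map X Y T \<longleftrightarrow>
     (\<exists>(f :: nat \<Rightarrow> 'a \<Rightarrow> real) (y :: nat \<Rightarrow> 'b).
        (\<forall>n. f n \<in> ns_dual X) \<and> (\<forall>n. y n \<in> ns_carrier Y) \<and>
        summable (\<lambda>n. ns_dual_norm X (f n) * ns_norm Y (y n)) \<and>
        (\<forall>x\<in>ns_carrier X. ns_sums Y (\<lambda>n. ns_scale Y (f n x) (y n)) (T x)))"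


section \<open>Continuous seminorms, the spaces \<open>E\<^sub>p\<close>, nuclearity\<close>

definition is_seminorm :: "('a::real_vector \<Rightarrow> real) \<Rightarrow> bool" where
  "is_seminorm p \<longleftrightarrow>
     (\<forall>x y. p (x + y) \<le> p x + p y) \<and> (\<forall>c x. p (c *\<^sub>R x) = \<bar>c\<bar> * p x)"

definition cs :: "('a::locally_convex_space \<Rightarrow> real) set" where
  "cs = {p. is_seminorm p \<and> continuous_on UNIV p}"

definition seminorm_ker :: "('a \<Rightarrow> real) \<Rightarrow> 'a set" where
  "seminorm_ker p = {x. p x = 0}"

definition ker_coset :: "('a::real_vector \<Rightarrow> real) \<Rightarrow> 'a \<Rightarrow> 'a set" where
  "ker_coset p x = (\<lambda>k. x + k) ` seminorm_ker p"

text \<open>\<open>E\<^sub>p = E / ker p\<close>, with cosets as elements. The summand from \<open>ker p\<close> in the scalar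
  multiplication is needed for \<open>c = 0\<close>. The norm of a coset is the constant value of \<open>p\<close> on it.\<close>

definition E_sub_p :: "('a::real_vector \<Rightarrow> real) \<Rightarrow> 'a set nspace" where
  "E_sub_p p = \<lparr>
     ns_carrier = range (ker_coset p),
     ns_zero = seminorm_ker p,
     ns_add = (\<lambda>A B. {a + b | a b. a \<in> A \<and> b \<in> B}),
     ns_scale = (\<lambda>c A. {c *\<^sub>R a + k | a k. a \<in> A \<and> k \<in> seminorm_ker p}),
     ns_norm = (\<lambda>A. the_elem (p ` A))\<rparr>"

text \<open>For \<open>q \<ge> p\<close> this maps \<open>x + ker q\<close> to \<open>x + ker p\<close>.\<close>

definition canonical_map :: "('a::real_vector \<Rightarrow> real) \<Rightarrow> 'a set \<Rightarrow> 'a set" where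
  "canonical_map p A = (\<Union>x\<in>A. ker_coset p x)"

definition nuclear_space :: "'a::locally_convex_space itself \<Rightarrow> bool" where
  "nuclear_space _ \<longleftrightarrow>
     (\<forall>p\<in>(cs :: ('a \<Rightarrow> real) set). \<exists>q\<in>cs. (\<forall>x. p x \<le> q x) \<and>
        nuclear_map (E_sub_p q) (E_sub_p p) (canonical_map p))"


section \<open>The spaces \<open>E\<^sub>B\<close>, local convergence, domains of sums\<close>

definition minkowski_gauge :: "'a::real_vector set \<Rightarrow> 'a \<Rightarrow> real" where
  "minkowski_gauge B x = Inf {t. t > 0 \<and> x \<in> (\<lambda>y. t *\<^sub>R y) ` B}"

definition E_sub_B :: "'a::real_vector set \<Rightarrow> 'a nspace" where
  "E_sub_B B = \<lparr>
     ns_carrier = span B, ns_zero = 0, ns_add = (+), ns_scale = scaleR,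
     ns_norm = minkowski_gauge B\<rparr>"

definition converges_locally :: "(nat \<Rightarrow> 'a::locally_convex_space) \<Rightarrow> bool" where
  "converges_locally s \<longleftrightarrow> (\<exists>B\<in>bdd_discs. \<exists>l. ns_tendsto (E_sub_B B) s l)"

definition domain_of_sums :: "(nat \<Rightarrow> 'a::locally_convex_space) \<Rightarrow> 'a set" where
  "domain_of_sums u = {x. \<exists>\<pi>. bij \<pi> \<and> (\<lambda>k. u (\<pi> k)) sums x}"

definition Gamma_perp :: "'a::locally_convex_space set \<Rightarrow> (nat \<Rightarrow> 'a) \<Rightarrow> 'a set" where
  "Gamma_perp B u = {x \<in> ns_carrier (E_sub_B B).
     \<forall>f\<in>ns_dual (E_sub_B B). summable (\<lambda>k. \<bar>f (u k)\<bar>) \<longrightarrow> f x = 0}"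

definition Gamma_loc_from :: "'a::locally_convex_space set \<Rightarrow> (nat \<Rightarrow> 'a) \<Rightarrow> 'a set" where
  "Gamma_loc_from B0 u = (\<Union>B\<in>{B. absconvex B \<and> tvs_bounded B \<and> B0 \<subseteq> B}. Gamma_perp B u)"

text \<open>The choice of \<open>B\<^sub>0\<close> is immaterial, see \<open>Gamma_loc_eq\<close> below. It only exists if the series
  converges in some \<open>E\<^sub>B\<close>.\<close>

definition Gamma_loc :: "(nat \<Rightarrow> 'a::locally_convex_space) \<Rightarrow> 'a set" where
  "Gamma_loc u =
     Gamma_loc_from (SOME B0. B0 \<in> bdd_discs \<and> (\<exists>l. ns_sums (E_sub_B B0) u l)) u"


section \<open>Well-definedness\<close>

lemma ns_psum_E_sub_B: "ns_psum (E_sub_B B) u n = (\<Sum>k<n. u k)"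
  by (induction n) (simp_all add: E_sub_B_def)

lemma absconvex_zero: "absconvex B \<Longrightarrow> 0 \<in> B"
proof -
  assume B: "absconvex B"
  then obtain x where "x \<in> B" unfolding absconvex_def by blast
  with B have "0 *\<^sub>R x + 0 *\<^sub>R x \<in> B"
    unfolding absconvex_def by (metis abs_zero add_0 zero_le_one)
  then show ?thesis by simp
qed

lemma absconvex_comb:
  "absconvex B \<Longrightarrow> x \<in> B \<Longrightarrow> y \<in> B \<Longrightarrow> \<bar>a\<bar> + \<bar>b\<bar> \<le> 1 \<Longrightarrow> a *\<^sub>R x + b *\<^sub>R y \<in> B"
  unfolding absconvex_def by blast

lemma absconvex_scale: "absconvex B \<Longrightarrow> x \<in> B \<Longrightarrow> \<bar>a\<bar> \<le> 1 \<Longrightarrow> a *\<^sub>R x \<in> B"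
  using absconvex_comb[of B x x a 0] by simp

lemma absconvex_dilate_add:
  assumes B: "absconvex B" and s: "s > 0" and t: "t > 0"
    and x: "x \<in> (\<lambda>y. s *\<^sub>R y) ` B" and y: "y \<in> (\<lambda>y. t *\<^sub>R y) ` B"
  shows "x + y \<in> (\<lambda>y. (s + t) *\<^sub>R y) ` B"
proof -
  obtain b c where bc: "b \<in> B" "c \<in> B" "x = s *\<^sub>R b" "y = t *\<^sub>R c"
    using x y by blast
  have "(s / (s + t)) *\<^sub>R b + (t / (s + t)) *\<^sub>R c \<in> B"
    using s t by (intro absconvex_comb[OF B bc(1,2)]) (simp add: field_simps)
  moreover have "x + y = (s + t) *\<^sub>R ((s / (s + t)) *\<^sub>R b + (t / (s + t)) *\<^sub>R c)"
    using s t bc by (simp add: scaleR_add_right)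
  ultimately show ?thesis by blast
qed

lemma span_absconvex:
  assumes B: "absconvex B" and x: "x \<in> span B"
  shows "\<exists>t>0. x \<in> (\<lambda>y. t *\<^sub>R y) ` B"
  using x
proof (induction rule: span_induct_alt)
  case base
  show ?case using absconvex_zero[OF B] by (intro exI[of _ 1]) auto
next
  case (step c x y)
  then obtain t where t: "t > 0" "y \<in> (\<lambda>y. t *\<^sub>R y) ` B" by blast
  have "(c / (\<bar>c\<bar> + 1)) *\<^sub>R x \<in> B"
    using step by (intro absconvex_scale[OF B]) (auto simp: field_simps)
  moreover have "c *\<^sub>R x = (\<bar>c\<bar> + 1) *\<^sub>R ((c / (\<bar>c\<bar> + 1)) *\<^sub>R x)"
    by (simp add: add_nonneg_eq_0_iff)
  ultimately have "c *\<^sub>R x \<in> (\<lambda>y. (\<bar>c\<bar> + 1) *\<^sub>R y) ` B" by blast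
  from absconvex_dilate_add[OF B _ t(1) this t(2)] t(1) show ?case
    by (intro exI[of _ "\<bar>c\<bar> + 1 + t"]) auto
qed

lemma gauge_bdd_below: "bdd_below {t::real. t > 0 \<and> P t}"
  by (intro bdd_belowI[of _ 0]) auto

lemma gauge_le: "t > 0 \<Longrightarrow> x \<in> (\<lambda>y. t *\<^sub>R y) ` B \<Longrightarrow> minkowski_gauge B x \<le> t"
  unfolding minkowski_gauge_def by (intro cInf_lower gauge_bdd_below) auto

lemma gauge_lessD:
  assumes "absconvex B" "x \<in> span B" "minkowski_gauge B x < r"
  shows "\<exists>t>0. t < r \<and> x \<in> (\<lambda>y. t *\<^sub>R y) ` B"
proof -
  have "{t. t > 0 \<and> x \<in> (\<lambda>y. t *\<^sub>R y) ` B} \<noteq> {}"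
    using span_absconvex[OF assms(1,2)] by blast
  from cInf_lessD[OF this assms(3)[unfolded minkowski_gauge_def]] show ?thesis by blast
qed

lemma gauge_nonneg:
  assumes "absconvex B" "x \<in> span B"
  shows "0 \<le> minkowski_gauge B x"
  using gauge_lessD[OF assms, of 0] by force

lemma gauge_add:
  assumes B: "absconvex B" and x: "x \<in> span B" and y: "y \<in> span B"
  shows "minkowski_gauge B (x + y) \<le> minkowski_gauge B x + minkowski_gauge B y"
proof (rule field_le_epsilon)
  fix e :: real assume e: "e > 0"
  obtain s where s: "s > 0" "s < minkowski_gauge B x + e / 2" "x \<in> (\<lambda>y. s *\<^sub>R y) ` B"
    using gauge_lessD[OF B x, of "minkowski_gauge B x + e / 2"] e by auto
  obtain t where t: "t > 0" "t < minkowski_gauge B y + e / 2" "y \<in> (\<lambda>y. t *\<^sub>R y) ` B"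
    using gauge_lessD[OF B y, of "minkowski_gauge B y + e / 2"] e by auto
  have "minkowski_gauge B (x + y) \<le> s + t"
    using s t by (intro gauge_le absconvex_dilate_add[OF B]) auto
  then show "minkowski_gauge B (x + y) \<le> minkowski_gauge B x + minkowski_gauge B y + e"
    using s t by linarith
qed

lemma gauge_scale_le:
  assumes B: "absconvex B" and x: "x \<in> span B"
  shows "minkowski_gauge B (c *\<^sub>R x) \<le> \<bar>c\<bar> * minkowski_gauge B x"
proof -
  have *: "minkowski_gauge B (c *\<^sub>R x) \<le> \<bar>c\<bar> * minkowski_gauge B x + e" if e: "e > 0" for e
  proof -
    define d where "d = e / (\<bar>c\<bar> + 1)"
    have d: "d > 0" using e by (simp add: d_def)
    obtain t where t: "t > 0" "t < minkowski_gauge B x + d" "x \<in> (\<lambda>y. t *\<^sub>R y) ` B"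
      using gauge_lessD[OF B x, of "minkowski_gauge B x + d"] d by auto
    then obtain b where b: "b \<in> B" "x = t *\<^sub>R b" by blast
    show ?thesis
    proof (cases "c = 0")
      case True
      have "minkowski_gauge B (c *\<^sub>R x) \<le> e"
        using True e absconvex_zero[OF B] by (intro gauge_le) (auto intro: image_eqI[of _ _ 0])
      then show ?thesis using True by simp
    next
      case False
      have "sgn c *\<^sub>R b \<in> B" using b by (intro absconvex_scale[OF B]) (auto simp: sgn_if)
      moreover have "c *\<^sub>R x = (\<bar>c\<bar> * t) *\<^sub>R (sgn c *\<^sub>R b)"
        using b by (simp add: abs_mult_sgn mult_ac sgn_if abs_if)
      ultimately have "c *\<^sub>R x \<in> (\<lambda>y. (\<bar>c\<bar> * t) *\<^sub>R y) ` B" by blast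
      then have "minkowski_gauge B (c *\<^sub>R x) \<le> \<bar>c\<bar> * t"
        using False t by (intro gauge_le) auto
      also have "\<dots> \<le> \<bar>c\<bar> * (minkowski_gauge B x + d)"
        using t by (intro mult_left_mono) auto
      also have "\<dots> \<le> \<bar>c\<bar> * minkowski_gauge B x + e"
        using e by (auto simp: d_def field_simps)
      finally show ?thesis .
    qed
  qed
  show ?thesis by (rule field_le_epsilon) (rule *)
qed

lemma gauge_scale:
  assumes B: "absconvex B" and x: "x \<in> span B"
  shows "minkowski_gauge B (c *\<^sub>R x) = \<bar>c\<bar> * minkowski_gauge B x"
proof (cases "c = 0")
  case True
  then show ?thesis
    using gauge_scale_le[OF B x, of 0] gauge_nonneg[OF B, of 0] span_zero by auto
next
  case False
  have "minkowski_gauge B ((1 / c) *\<^sub>R (c *\<^sub>R x)) \<le> \<bar>1 / c\<bar> * minkowski_gauge B (c *\<^sub>R x)"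
    using x by (intro gauge_scale_le[OF B]) (simp add: span_scale)
  then have "\<bar>c\<bar> * minkowski_gauge B x \<le> minkowski_gauge B (c *\<^sub>R x)"
    using False by (simp add: field_simps)
  with gauge_scale_le[OF B x, of c] show ?thesis by simp
qed

lemma gauge_definite:
  fixes B :: "'a::locally_convex_space set"
  assumes B: "absconvex B" and bd: "tvs_bounded B" and x: "x \<in> span B"
    and g: "minkowski_gauge B x = 0"
  shows "x = 0"
proof (rule ccontr)
  assume "x \<noteq> 0"
  then obtain U where U: "open U" "0 \<in> U" "x \<notin> U"
    using t1_space by metis
  then have "zero_nhd U" by (simp add: zero_nhd_def interior_open)
  then obtain r where r: "r > 0" "\<And>t. r \<le> \<bar>t\<bar> \<Longrightarrow> B \<subseteq> (\<lambda>x. t *\<^sub>R x) ` U"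
    using bd unfolding tvs_bounded_def absorbs_def by blast
  obtain s where s: "s > 0" "s < 1 / r" "x \<in> (\<lambda>y. s *\<^sub>R y) ` B"
    using gauge_lessD[OF B x, of "1 / r"] g r(1) by auto
  then obtain b where b: "b \<in> B" "x = s *\<^sub>R b" by blast
  have "r \<le> \<bar>1 / s\<bar>" using s r(1) by (simp add: field_simps)
  from r(2)[OF this] b obtain u where "u \<in> U" "b = (1 / s) *\<^sub>R u" by blast
  then have "x \<in> U" using b s by simp
  with U show False by blast
qed

lemma normed_space_E_sub_B:
  fixes B :: "'a::locally_convex_space set"
  assumes "absconvex B" "tvs_bounded B"
  shows "normed_space_on (E_sub_B B)"
proof -
  have "minkowski_gauge B x = 0 \<longleftrightarrow> x = 0" if "x \<in> span B" for x
    using gauge_definite[OF assms that] gauge_scale[OF assms(1) that, of 0] by auto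
  then show ?thesis
    by unfold_locales
      (simp_all add: E_sub_B_def span_add span_scale span_zero scaleR_add_right scaleR_add_left
        gauge_scale[OF assms(1)] gauge_add[OF assms(1)] ac_simps)
qed

lemma seminorm_zero: "is_seminorm p \<Longrightarrow> p 0 = 0"
  unfolding is_seminorm_def by (metis abs_zero mult_zero_left scale_zero_left)

lemma seminorm_minus: "is_seminorm p \<Longrightarrow> p (- x) = p x"
  unfolding is_seminorm_def by (metis abs_minus_cancel abs_one mult_1 scaleR_minus1_left)

lemma seminorm_nonneg: "is_seminorm p \<Longrightarrow> 0 \<le> p x"
proof -
  assume p: "is_seminorm p"
  have "p (x + - x) \<le> p x + p (- x)" using p unfolding is_seminorm_def by blast
  then show ?thesis using seminorm_zero[OF p] seminorm_minus[OF p] by simp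
qed

lemma subspace_seminorm_ker:
  assumes p: "is_seminorm p"
  shows "subspace (seminorm_ker p)"
proof (rule subspaceI)
  fix x y assume "x \<in> seminorm_ker p" "y \<in> seminorm_ker p"
  then have "p x = 0" "p y = 0" by (auto simp: seminorm_ker_def)
  moreover have "p (x + y) \<le> p x + p y" using p unfolding is_seminorm_def by blast
  ultimately show "x + y \<in> seminorm_ker p"
    using seminorm_nonneg[OF p, of "x + y"] by (simp add: seminorm_ker_def)
qed (use p seminorm_zero[OF p] in \<open>auto simp: seminorm_ker_def is_seminorm_def\<close>)

lemma ker_coset_iff: "y \<in> ker_coset p x \<longleftrightarrow> p (y - x) = 0"
proof -
  have "y \<in> ker_coset p x" if "p (y - x) = 0"
    using that by (auto simp: ker_coset_def seminorm_ker_def intro!: image_eqI[of _ _ "y - x"])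
  then show ?thesis by (auto simp: ker_coset_def seminorm_ker_def)
qed

lemma ker_coset_eq_iff:
  assumes p: "is_seminorm p"
  shows "ker_coset p x = ker_coset p y \<longleftrightarrow> p (x - y) = 0"
proof
  assume "ker_coset p x = ker_coset p y"
  moreover have "x \<in> ker_coset p x" by (simp add: ker_coset_iff seminorm_zero[OF p])
  ultimately show "p (x - y) = 0" by (simp add: ker_coset_iff)
next
  assume xy: "p (x - y) = 0"
  have K: "subspace (seminorm_ker p)" by (rule subspace_seminorm_ker[OF p])
  have "p (z - x) = 0 \<longleftrightarrow> p (z - y) = 0" for z
    using subspace_add[OF K, of "z - x" "x - y"] subspace_diff[OF K, of "z - y" "x - y"] xy
    by (auto simp: seminorm_ker_def)
  then show "ker_coset p x = ker_coset p y" by (auto simp: ker_coset_iff)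
qed

lemma E_sub_p_add:
  assumes p: "is_seminorm p"
  shows "ns_add (E_sub_p p) (ker_coset p x) (ker_coset p y) = ker_coset p (x + y)"
proof -
  have K: "subspace (seminorm_ker p)" by (rule subspace_seminorm_ker[OF p])
  have "\<exists>a b. z = a + b \<and> p (a - x) = 0 \<and> p (b - y) = 0" if "p (z - (x + y)) = 0" for z
    by (rule exI[of _ x], rule exI[of _ "z - x"])
      (use that in \<open>simp add: seminorm_zero[OF p] algebra_simps\<close>)
  moreover have "p (a + b - (x + y)) = 0" if "p (a - x) = 0" "p (b - y) = 0" for a b
    using subspace_add[OF K, of "a - x" "b - y"] that by (simp add: seminorm_ker_def algebra_simps)
  ultimately show ?thesis by (auto simp: E_sub_p_def ker_coset_iff)
qed

lemma E_sub_p_scale: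
  assumes p: "is_seminorm p"
  shows "ns_scale (E_sub_p p) c (ker_coset p x) = ker_coset p (c *\<^sub>R x)"
proof -
  have K: "subspace (seminorm_ker p)" by (rule subspace_seminorm_ker[OF p])
  have "\<exists>a k. z = c *\<^sub>R a + k \<and> p (a - x) = 0 \<and> p k = 0" if "p (z - c *\<^sub>R x) = 0" for z
    by (rule exI[of _ x], rule exI[of _ "z - c *\<^sub>R x"])
      (use that in \<open>simp add: seminorm_zero[OF p]\<close>)
  moreover have "p (c *\<^sub>R a + k - c *\<^sub>R x) = 0" if "p (a - x) = 0" "p k = 0" for a k
    using subspace_add[OF K, of "c *\<^sub>R (a - x)" k] subspace_scale[OF K, of "a - x" c] that
    by (simp add: seminorm_ker_def algebra_simps)
  ultimately show ?thesis by (auto simp: E_sub_p_def ker_coset_iff seminorm_ker_def)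
qed

lemma E_sub_p_norm:
  assumes p: "is_seminorm p"
  shows "ns_norm (E_sub_p p) (ker_coset p x) = p x"
proof -
  have "p y = p x" if "y \<in> ker_coset p x" for y
  proof -
    from that have "p (y - x) = 0" by (simp add: ker_coset_iff)
    moreover
    have "p (x + (y - x)) \<le> p x + p (y - x)" "p (y + - (y - x)) \<le> p y + p (- (y - x))"
      using p unfolding is_seminorm_def by blast+
    ultimately show ?thesis using seminorm_minus[OF p, of "y - x"] by simp
  qed
  moreover have "x \<in> ker_coset p x" by (simp add: ker_coset_iff seminorm_zero[OF p])
  ultimately have "p ` ker_coset p x = {p x}" by blast
  then show ?thesis by (simp add: E_sub_p_def)
qed

lemma E_sub_p_zero: "ns_zero (E_sub_p p) = ker_coset p 0"
  by (simp add: E_sub_p_def ker_coset_def)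

lemma E_sub_p_carrier: "ns_carrier (E_sub_p p) = range (ker_coset p)"
  by (simp add: E_sub_p_def)

lemma normed_space_E_sub_p:
  assumes p: "is_seminorm p"
  shows "normed_space_on (E_sub_p p)"
proof -
  note [simp] = E_sub_p_add[OF p] E_sub_p_scale[OF p] E_sub_p_norm[OF p] E_sub_p_zero
    E_sub_p_carrier
  have "p (x + y) \<le> p x + p y" "p (c *\<^sub>R x) = \<bar>c\<bar> * p x" for c x y
    using p unfolding is_seminorm_def by blast+
  moreover have zero: "ker_coset p x = ker_coset p 0 \<longleftrightarrow> p x = 0" for x
    using ker_coset_eq_iff[OF p, of x 0] by simp
  ultimately show ?thesis
    by unfold_locales
      (auto simp: scaleR_add_right scaleR_add_left ac_simps zero del: equalityI)
qed

lemma canonical_map_coset: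
  assumes p: "is_seminorm p" and q: "is_seminorm q" and pq: "\<And>x. p x \<le> q x"
  shows "canonical_map p (ker_coset q x) = ker_coset p x"
proof -
  have "ker_coset p y = ker_coset p x" if "y \<in> ker_coset q x" for y
    using that pq[of "y - x"] seminorm_nonneg[OF p, of "y - x"]
    by (simp add: ker_coset_iff ker_coset_eq_iff[OF p])
  moreover have "x \<in> ker_coset q x" by (simp add: ker_coset_iff seminorm_zero[OF q])
  ultimately show ?thesis unfolding canonical_map_def by blast
qed

lemma tvs_bounded_sum:
  fixes A B :: "'a::locally_convex_space set"
  assumes A: "tvs_bounded A" and B: "tvs_bounded B"
  shows "tvs_bounded {a + b | a b. a \<in> A \<and> b \<in> B}"
  unfolding tvs_bounded_def
proof (intro allI impI)
  fix U :: "'a set" assume U: "zero_nhd U"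
  have "((\<lambda>z::'a \<times> 'a. fst z + snd z) \<longlongrightarrow> 0 + 0) (nhds 0 \<times>\<^sub>F nhds 0)"
    by (rule tendsto_add_Pair[unfolded case_prod_unfold])
  then have "\<forall>\<^sub>F z in nhds (0::'a) \<times>\<^sub>F nhds 0. fst z + snd z \<in> interior U"
    using U unfolding tendsto_def zero_nhd_def by simp
  then obtain P Q where P: "eventually P (nhds (0::'a))" and Q: "eventually Q (nhds (0::'a))"
    and PQ: "\<And>x y. P x \<Longrightarrow> Q y \<Longrightarrow> x + y \<in> interior U"
    unfolding eventually_prod_filter by auto
  obtain V where V: "open V" "0 \<in> V" "\<And>x. x \<in> V \<Longrightarrow> P x"
    using P unfolding eventually_nhds by blast
  obtain W where W: "open W" "0 \<in> W" "\<And>x. x \<in> W \<Longrightarrow> Q x"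
    using Q unfolding eventually_nhds by blast
  have "zero_nhd V" "zero_nhd W" using V W by (simp_all add: zero_nhd_def interior_open)
  then obtain r s where r: "r > 0" "\<And>t. r \<le> \<bar>t\<bar> \<Longrightarrow> A \<subseteq> (\<lambda>x. t *\<^sub>R x) ` V"
    and s: "s > 0" "\<And>t. s \<le> \<bar>t\<bar> \<Longrightarrow> B \<subseteq> (\<lambda>x. t *\<^sub>R x) ` W"
    using A B unfolding tvs_bounded_def absorbs_def by blast
  have "{a + b | a b. a \<in> A \<and> b \<in> B} \<subseteq> (\<lambda>x. t *\<^sub>R x) ` U" if t: "max r s \<le> \<bar>t\<bar>" for t
  proof safe
    fix a b assume "a \<in> A" "b \<in> B"
    with r(2)[of t] s(2)[of t] t have "a \<in> (\<lambda>x. t *\<^sub>R x) ` V" "b \<in> (\<lambda>x. t *\<^sub>R x) ` W" by auto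
    then obtain v w where vw: "v \<in> V" "w \<in> W" "a = t *\<^sub>R v" "b = t *\<^sub>R w" by blast
    then have "v + w \<in> U" using PQ V(3) W(3) interior_subset by blast
    moreover have "a + b = t *\<^sub>R (v + w)" using vw by (simp add: scaleR_add_right)
    ultimately show "a + b \<in> (\<lambda>x. t *\<^sub>R x) ` U" by blast
  qed
  then show "absorbs U {a + b | a b. a \<in> A \<and> b \<in> B}"
    unfolding absorbs_def using r(1) by (intro exI[of _ "max r s"]) auto
qed

lemma absconvex_sum:
  assumes A: "absconvex A" and B: "absconvex B"
  shows "absconvex {a + b | a b. a \<in> A \<and> b \<in> B}"
  unfolding absconvex_def
proof (intro conjI ballI allI impI)
  show "{a + b | a b. a \<in> A \<and> b \<in> B} \<noteq> {}"
    using absconvex_zero[OF A] absconvex_zero[OF B] by blast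
  fix x y and c d :: real
  assume "x \<in> {a + b | a b. a \<in> A \<and> b \<in> B}" "y \<in> {a + b | a b. a \<in> A \<and> b \<in> B}"
    and cd: "\<bar>c\<bar> + \<bar>d\<bar> \<le> 1"
  then obtain a b a' b' where *: "a \<in> A" "b \<in> B" "a' \<in> A" "b' \<in> B" "x = a + b" "y = a' + b'"
    by blast
  have "c *\<^sub>R x + d *\<^sub>R y = (c *\<^sub>R a + d *\<^sub>R a') + (c *\<^sub>R b + d *\<^sub>R b')"
    using * by (simp add: algebra_simps)
  moreover have "c *\<^sub>R a + d *\<^sub>R a' \<in> A" "c *\<^sub>R b + d *\<^sub>R b' \<in> B"
    using * cd absconvex_comb[OF A] absconvex_comb[OF B] by auto
  ultimately show "c *\<^sub>R x + d *\<^sub>R y \<in> {a + b | a b. a \<in> A \<and> b \<in> B}" by blast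
qed

lemma Gamma_perp_mono:
  assumes B: "absconvex B" and sub: "B \<subseteq> D"
  shows "Gamma_perp B u \<subseteq> Gamma_perp D u"
proof -
  have sp: "span B \<subseteq> span D" using sub by (rule span_mono)
  have gle: "minkowski_gauge D x \<le> minkowski_gauge B x" if "x \<in> span B" for x
    unfolding minkowski_gauge_def
  proof (rule cInf_superset_mono)
    show "{t. t > 0 \<and> x \<in> (\<lambda>y. t *\<^sub>R y) ` B} \<noteq> {}"
      using span_absconvex[OF B that] by blast
  qed (use sub in \<open>auto intro: gauge_bdd_below\<close>)
  have "f \<in> ns_dual (E_sub_B B)" if f: "f \<in> ns_dual (E_sub_B D)" for f
  proof -
    obtain K where K: "\<And>x. x \<in> span D \<Longrightarrow> \<bar>f x\<bar> \<le> K * minkowski_gauge D x"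
      using f unfolding ns_dual_def E_sub_B_def by fastforce
    have "\<bar>f x\<bar> \<le> \<bar>K\<bar> * minkowski_gauge B x" if x: "x \<in> span B" for x
    proof -
      have xD: "x \<in> span D" using x sp by blast
      have nonneg: "0 \<le> minkowski_gauge D x"
      proof -
        have "{t. t > 0 \<and> x \<in> (\<lambda>y. t *\<^sub>R y) ` D} \<noteq> {}"
          using span_absconvex[OF B x] sub by blast
        then show ?thesis unfolding minkowski_gauge_def by (intro cInf_greatest) auto
      qed
      have "\<bar>f x\<bar> \<le> \<bar>K\<bar> * minkowski_gauge D x"
        using K[OF xD] mult_right_mono[OF abs_ge_self[of K] nonneg] by linarith
      also have "\<dots> \<le> \<bar>K\<bar> * minkowski_gauge B x"
        using gle[OF x] by (intro mult_left_mono) auto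
      finally show ?thesis .
    qed
    then show ?thesis using f sp by (auto simp: ns_dual_def E_sub_B_def subset_iff)
  qed
  then show ?thesis using sp by (auto simp: Gamma_perp_def E_sub_B_def)
qed

lemma Gamma_loc_from_subset:
  assumes "C \<in> bdd_discs"
  shows "Gamma_loc_from B0 u \<subseteq> Gamma_loc_from C u"
proof
  fix x assume "x \<in> Gamma_loc_from B0 u"
  then obtain B where B: "absconvex B" "tvs_bounded B" "x \<in> Gamma_perp B u"
    by (auto simp: Gamma_loc_from_def)
  have C: "absconvex C" "tvs_bounded C" using assms by (auto simp: bdd_discs_def)
  let ?D = "{b + c | b c. b \<in> B \<and> c \<in> C}"
  have "B \<subseteq> ?D" "C \<subseteq> ?D"
    using absconvex_zero[OF B(1)] absconvex_zero[OF C(1)] by force+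
  then show "x \<in> Gamma_loc_from C u"
    using Gamma_perp_mono[OF B(1), of ?D u] B absconvex_sum[OF B(1) C(1)]
      tvs_bounded_sum[OF B(2) C(2)]
    unfolding Gamma_loc_from_def by blast
qed

lemma Gamma_loc_eq:
  assumes "B0 \<in> bdd_discs" and "ns_sums (E_sub_B B0) u l"
  shows "Gamma_loc u = Gamma_loc_from B0 u"
proof -
  let ?P = "\<lambda>B. B \<in> bdd_discs \<and> (\<exists>l. ns_sums (E_sub_B B) u l)"
  have "?P (SOME B. ?P B)" by (rule someI[of ?P B0]) (use assms in blast)
  then show ?thesis
    unfolding Gamma_loc_def using assms Gamma_loc_from_subset by (metis subset_antisym)
qed

lemma Gamma_loc_admissible:
  fixes u :: "nat \<Rightarrow> 'a::locally_convex_space"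
  assumes loc: "\<And>s :: nat \<Rightarrow> 'a. convergent s \<Longrightarrow> converges_locally s" and u: "summable u"
  shows "\<exists>B0\<in>bdd_discs. \<exists>l. ns_sums (E_sub_B B0) u l"
proof -
  have "convergent (\<lambda>n. \<Sum>k<n. u k)" using u by (simp add: summable_iff_convergent)
  from loc[OF this] obtain B l where B: "B \<in> bdd_discs"
    and l: "ns_tendsto (E_sub_B B) (\<lambda>n. \<Sum>k<n. u k) l"
    unfolding converges_locally_def by blast
  have S: "(\<Sum>k<n. u k) \<in> span B" for n using l by (simp add: ns_tendsto_def E_sub_B_def)
  have "u n \<in> span B" for n using span_diff[OF S[of "Suc n"] S[of n]] by simp
  then have "ns_sums (E_sub_B B) u l"
    using l by (simp add: ns_sums_def ns_psum_E_sub_B ns_tendsto_def) (simp add: E_sub_B_def)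
  with B show ?thesis by blast
qed

end

theory Submission
  imports Defs "Jordan_Normal_Form.Determinant" "HOL-Real_Asymp.Real_Asymp"
begin

text \<open>
  Fix a continuous seminorm \<open>p\<close> and a disc \<open>B\<close>. Suppose that for every larger disc \<open>C\<close> there are
  points \<open>b\<^sub>1, \<dots>, b\<^sub>m\<close> of \<open>B\<close>, in every prescribed finite-codimensional subspace, and a Euclidean
  contraction \<open>A\<close> of coefficient vectors, dominated by the gauge of \<open>C\<close> on \<open>\<Sum>\<^sub>j c\<^sub>j b\<^sub>j\<close>, with
  \<open>det A\<close> large. A lattice point count then yields a point \<open>\<Sum>\<^sub>j y\<^sub>j b\<^sub>j\<close> which stays far from all
  integer combinations of the \<open>b\<^sub>j\<close> even after scaling. Concatenating such blocks along a
  fundamental system of discs gives a convergent series with sum \<open>0\<close> and a point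
  \<open>x\<close> of its \<open>\<Gamma>\<^sup>\<bottom>\<close> to which no rearrangement of the series converges. Hence
  every \<open>B\<close> lies in a disc \<open>C\<close> on which all these determinants are small.

  By an argument in the manner of Dvoretzky and Rogers, the points \<open>b\<^sub>j\<close> then arise from points of
  \<open>C\<close> by a matrix of small determinant. Iterating this along a chain of discs multiplies the gains,
  so that \<open>det (\<phi>\<^sub>i(b\<^sub>j))\<close> is small for functionals \<open>\<phi>\<^sub>i\<close> bounded by \<open>p\<close>, and the Kolmogorov
  numbers of \<open>B\<close> with respect to \<open>p\<close> decay like \<open>m\<^sup>-\<^sup>3\<close>. The (DF) property, used as a countable gluing principle,
  turns this into rapid approximation of \<open>p\<close> by finite-dimensional subspaces against a single
  continuous seminorm \<open>q\<close>, and Auerbach bases of these subspaces represent \<open>E\<^sub>q \<rightarrow> E\<^sub>p\<close> as a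
  nuclear map.
\<close>

section \<open>Determinants and orthogonal matrices\<close>

text \<open>Terms of the series come in pairs v, -v, so a partial sum of a rearrangement sees a
  block only through coefficients -1, 0, 1. A block has \<open>N\<close> copies of (x + \<epsilon>
  \<Sum> y_j b_j) / N and \<open>P\<close> copies of each \<epsilon> b_j. Real coefficients in
  [-1, 1] recover x, so functionals absolutely summable on the series vanish at x. Coefficients -1,
  0, 1 only give t x + \<epsilon> \<Sum> (t y_j + n_j) b_j with integers n_j, where the second term
  is detectably large unless t is small. A Euclidean ball of radius R has volume about (c R / sqrt
  m)^m, so a suitable y exists once det A is larger by an exponential factor; hence the
  normalization (L / sqrt m)^m. Each disc of the chain gains a factor sqrt m per point, up to a
  constant. Eight discs gain m^4, the crude bound at the end costs m, and m^(-3) is left. This is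
  what the last step consumes: for subspaces of dimension about 2^k the distance is 8^(-k), the norm
  of a projection costs 2^k, the number of rank-one terms another 2^k, and 2^(-k) remains, up to a
  polynomial in k.\<close>

definition dt :: "nat \<Rightarrow> (nat \<Rightarrow> nat \<Rightarrow> real) \<Rightarrow> real" where
  "dt m A = Determinant.det (Matrix.mat m m (\<lambda>(i, j). A i j))"

text \<open>Matrices are functions of two natural numbers of which only the entries with both
  indices below \<open>m\<close> count, so identities under \<open>dt\<close> are checked in that
  range only.\<close>

lemma dt_cong: "(\<And>i j. i < m \<Longrightarrow> j < m \<Longrightarrow> A i j = B i j) \<Longrightarrow> dt m A = dt m B"
  unfolding dt_def by (intro arg_cong[where f = Determinant.det] eq_matI) auto

lemma dt_mult: "dt m (\<lambda>i j. \<Sum>k<m. A i k * B k j) = dt m A * dt m B"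
proof -
  have "Matrix.mat m m (\<lambda>(i, j). \<Sum>k<m. A i k * B k j) =
      Matrix.mat m m (\<lambda>(i, j). A i j) * Matrix.mat m m (\<lambda>(i, j). B i j)"
    by (rule eq_matI) (auto simp: scalar_prod_def atLeast0LessThan)
  then show ?thesis
    unfolding dt_def by (simp add: det_mult[of _ m])
qed

lemma dt_upper_triangular:
  assumes "\<And>i j. i < m \<Longrightarrow> j < i \<Longrightarrow> A i j = 0"
  shows "dt m A = (\<Prod>i<m. A i i)"
proof -
  have "upper_triangular (Matrix.mat m m (\<lambda>(i, j). A i j))"
    using assms by (auto simp: upper_triangular_def)
  then show ?thesis
    unfolding dt_def using det_upper_triangular[of "Matrix.mat m m (\<lambda>(i, j). A i j)" m]
    by (simp add: prod_list_diag_prod atLeast0LessThan)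
qed

lemma dt_id: "dt m (\<lambda>i j. if i = j then 1 else 0) = 1"
  by (subst dt_upper_triangular) auto

lemma dt_scale_rows: "dt m (\<lambda>i j. d i * A i j) = (\<Prod>i<m. d i) * dt m A"
proof -
  have "dt m (\<lambda>i j. d i * A i j) =
      dt m (\<lambda>i j. \<Sum>k<m. (if i = k then d i else 0) * A k j)"
  proof (rule dt_cong)
    fix i j assume "i < m"
    then have "(\<Sum>k<m. (if i = k then d i else 0) * A k j) = (\<Sum>k\<in>{i}. d i * A i j)"
      by (intro sum.mono_neutral_cong_right) auto
    then show "d i * A i j = (\<Sum>k<m. (if i = k then d i else 0) * A k j)" by simp
  qed
  also have "\<dots> = dt m (\<lambda>i k. if i = k then d i else 0) * dt m A" by (rule dt_mult)
  also have "dt m (\<lambda>i k. if i = k then d i else 0) = (\<Prod>i<m. d i)"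
    by (subst dt_upper_triangular) auto
  finally show ?thesis .
qed

text \<open>Leibniz expansion with m! <= m^m. This loses m per row where Hadamard's inequality would
  lose sqrt m; the chain of discs used later is long enough to absorb the loss.\<close>

lemma abs_dt_le:
  assumes "\<And>i j. i < m \<Longrightarrow> j < m \<Longrightarrow> \<bar>A i j\<bar> \<le> K"
  shows "\<bar>dt m A\<bar> \<le> (real m * K) ^ m"
proof (cases "m = 0")
  case True then show ?thesis by (simp add: dt_def)
next
  case False
  let ?M = "Matrix.mat m m (\<lambda>(i, j). A i j)"
  let ?P = "{p. p permutes {0..<m}}"
  have K: "0 \<le> K" using assms[of 0 0] False by force
  have "dt m A = (\<Sum>p\<in>?P. signof p * (\<Prod>i = 0..<m. ?M $$ (i, p i)))"
    unfolding dt_def by (rule det_def'[of _ m]) simp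
  then have "\<bar>dt m A\<bar> \<le> (\<Sum>p\<in>?P. \<bar>signof p * (\<Prod>i = 0..<m. ?M $$ (i, p i))\<bar>)"
    by simp
  also have "\<dots> \<le> (\<Sum>p\<in>?P. K ^ m)"
  proof (rule sum_mono)
    fix p assume p: "p \<in> ?P"
    have "\<bar>\<Prod>i = 0..<m. ?M $$ (i, p i)\<bar> \<le> (\<Prod>i = 0..<m. K)"
      unfolding abs_prod
    proof (rule prod_mono)
      fix i assume "i \<in> {0..<m}"
      moreover from this have "p i < m" using p permutes_in_image[of p "{0..<m}" i] by auto
      ultimately show "0 \<le> \<bar>?M $$ (i, p i)\<bar> \<and> \<bar>?M $$ (i, p i)\<bar> \<le> K" using assms by simp
    qed
    moreover have "\<bar>signof p :: real\<bar> = 1" by (simp add: sign_def)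
    ultimately show "\<bar>signof p * (\<Prod>i = 0..<m. ?M $$ (i, p i))\<bar> \<le> K ^ m"
      by (simp add: abs_mult)
  qed
  also have "\<dots> = fact m * K ^ m" by (simp add: card_permutations[OF refl])
  also have "\<dots> \<le> real m ^ m * K ^ m"
  proof -
    have "(fact m :: real) \<le> of_nat (m ^ m)" by (rule fact_le_power)
    then have "(fact m :: real) \<le> real m ^ m" by simp
    then show ?thesis using K by (intro mult_right_mono) auto
  qed
  finally show ?thesis by (simp add: power_mult_distrib)
qed

text \<open>Cramer's rule. It exhibits the coordinate functionals of a system with nearly maximal
  determinant as quotients of determinants, which is how they get bounded.\<close>

lemma dt_replace_col:
  assumes k: "k < m"
  shows "dt m (\<lambda>i j. if j = k then \<Sum>l<m. A i l * c l else A i j) = c k * dt m A"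
proof -
  let ?M = "Matrix.mat m m (\<lambda>(i, j). A i j)"
  have "replace_col ?M (?M *\<^sub>v Matrix.vec m c) k =
      Matrix.mat m m (\<lambda>(i, j). if j = k then \<Sum>l<m. A i l * c l else A i j)"
    unfolding replace_col_def by (rule eq_matI) (auto simp: scalar_prod_def atLeast0LessThan)
  then show ?thesis
    unfolding dt_def using cramer_lemma_mat[of ?M m "Matrix.vec m c" k] k by simp
qed

text \<open>Laplace expansion along the last column. It serves to enlarge a nonsingular system by a
  vector that the old functionals annihilate.\<close>

lemma dt_bordered:
  assumes "\<And>i. i < m \<Longrightarrow> A i m = 0"
  shows "dt (Suc m) A = A m m * dt m A"
proof -
  let ?M = "Matrix.mat (Suc m) (Suc m) (\<lambda>(i, j). A i j)"
  have "dt (Suc m) A = (\<Sum>i<Suc m. ?M $$ (i, m) * cofactor ?M i m)"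
    unfolding dt_def by (rule laplace_expansion_column[of _ "Suc m"]) auto
  also have "\<dots> = A m m * cofactor ?M m m"
    using assms by simp
  also have "cofactor ?M m m = Determinant.det (mat_delete ?M m m)"
    by (simp add: cofactor_def)
  also have "mat_delete ?M m m = Matrix.mat m m (\<lambda>(i, j). A i j)"
    unfolding mat_delete_def by (rule eq_matI) auto
  finally show ?thesis by (simp add: dt_def)
qed

section \<open>Isometries, reflections and triangularization\<close>

definition mv :: "nat \<Rightarrow> (nat \<Rightarrow> nat \<Rightarrow> real) \<Rightarrow> (nat \<Rightarrow> real) \<Rightarrow> nat \<Rightarrow> real" where
  "mv m A c i = (\<Sum>j<m. A i j * c j)"

definition mm :: "nat \<Rightarrow> (nat \<Rightarrow> nat \<Rightarrow> real) \<Rightarrow> (nat \<Rightarrow> nat \<Rightarrow> real) \<Rightarrow> nat \<Rightarrow> nat \<Rightarrow> real" where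
  "mm m A B i j = (\<Sum>k<m. A i k * B k j)"

text \<open>Orthogonality is recorded without transposes, through the two facts used later: lengths
  are preserved, and determinants change at most by a sign.\<close>

definition orth :: "nat \<Rightarrow> (nat \<Rightarrow> nat \<Rightarrow> real) \<Rightarrow> bool" where
  "orth m Q \<longleftrightarrow> (\<forall>c. (\<Sum>i<m. (mv m Q c i)\<^sup>2) = (\<Sum>i<m. (c i)\<^sup>2)) \<and> \<bar>dt m Q\<bar> = 1"

text \<open>The unit ball of \<open>s\<close> lies in the ellipsoid on which \<open>A\<close> has
  Euclidean length at most 1. A large determinant of \<open>A\<close> means a small ellipsoid, so
  maximizing it is Loewner's ellipsoid problem.\<close>

definition contr :: "nat \<Rightarrow> (nat \<Rightarrow> nat \<Rightarrow> real) \<Rightarrow> ((nat \<Rightarrow> real) \<Rightarrow> real) \<Rightarrow> bool" where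
  "contr m A s \<longleftrightarrow> (\<forall>c. (\<Sum>i<m. (mv m A c i)\<^sup>2) \<le> (s c)\<^sup>2)"

lemma mv_mm: "mv m (mm m A B) c i = mv m A (mv m B c) i"
proof -
  have "mv m (mm m A B) c i = (\<Sum>j<m. \<Sum>k<m. A i k * B k j * c j)"
    by (simp add: mv_def mm_def sum_distrib_right)
  also have "\<dots> = (\<Sum>k<m. \<Sum>j<m. A i k * B k j * c j)" by (rule sum.swap)
  also have "\<dots> = mv m A (mv m B c) i"
    by (simp add: mv_def sum_distrib_left mult.assoc)
  finally show ?thesis .
qed

lemma dt_mm: "dt m (mm m A B) = dt m A * dt m B"
  unfolding mm_def[abs_def] by (rule dt_mult)

lemma mv_cong: "(\<And>j. j < m \<Longrightarrow> c j = d j) \<Longrightarrow> mv m A c i = mv m A d i"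
  by (simp add: mv_def)

lemma mv_scale: "mv m A (\<lambda>j. r * c j) i = r * mv m A c i"
  by (simp add: mv_def sum_distrib_left ac_simps)

lemma mv_unit: "j < m \<Longrightarrow> mv m A (\<lambda>i. if i = j then 1 else 0) i = A i j"
  by (simp add: mv_def if_distrib[of "\<lambda>x. _ * x"] cong: if_cong)

lemma orth_id: "orth m (\<lambda>i j. if i = j then 1 else 0)"
proof -
  have "mv m (\<lambda>i j. if i = j then 1 else 0) c i = c i" if "i < m" for c i
    using that by (simp add: mv_def if_distrib[of "\<lambda>x. x * _"] cong: if_cong)
  then show ?thesis by (simp add: orth_def dt_id)
qed

lemma orth_mm: "orth m P \<Longrightarrow> orth m Q \<Longrightarrow> orth m (mm m P Q)"
  by (simp add: orth_def mv_mm dt_mm abs_mult)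

text \<open>The reflection along u, which is z - \<rho> e_k with the coordinates below k erased;
  \<rho> is the length of the tail of z from k on. It moves this tail onto the k-th axis because
  |u|^2 = 2 <u, z>, and it fixes vectors supported below k because u has no coordinates
  there.\<close>

lemma householder:
  fixes z :: "nat \<Rightarrow> real"
  assumes k: "k < m"
  shows "\<exists>H. orth m H \<and> (\<forall>c. (\<forall>j<m. k \<le> j \<longrightarrow> c j = 0) \<longrightarrow> (\<forall>i<m. mv m H c i = c i)) \<and>
    (\<forall>i<m. k < i \<longrightarrow> mv m H z i = 0) \<and> (mv m H z k)\<^sup>2 = (\<Sum>i\<in>{k..<m}. (z i)\<^sup>2)"
proof -
  define \<rho> where "\<rho> = sqrt (\<Sum>i\<in>{k..<m}. (z i)\<^sup>2)"
  have \<rho>: "\<rho>\<^sup>2 = (\<Sum>i\<in>{k..<m}. (z i)\<^sup>2)" unfolding \<rho>_def by (simp add: sum_nonneg)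
  define u where "u i = (if i < k then 0 else if i = k then z k - \<rho> else z i)" for i
  have split: "{..<m} = {..<k} \<union> ({k} \<union> {Suc k..<m})" "{k..<m} = {k} \<union> {Suc k..<m}"
    using k by auto
  have S: "(\<Sum>i\<in>{k..<m}. (z i)\<^sup>2) = (z k)\<^sup>2 + (\<Sum>i\<in>{Suc k..<m}. (z i)\<^sup>2)"
    unfolding split(2) by (subst sum.union_disjoint) auto
  define n where "n = (\<Sum>i<m. (u i)\<^sup>2)"
  have n: "n = (z k - \<rho>)\<^sup>2 + (\<Sum>i\<in>{Suc k..<m}. (z i)\<^sup>2)"
    unfolding n_def split(1) by (subst sum.union_disjoint, (auto)[3])+ (simp add: u_def)
  have uz: "(\<Sum>i<m. u i * z i) = (z k - \<rho>) * z k + (\<Sum>i\<in>{Suc k..<m}. (z i)\<^sup>2)"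
    unfolding split(1) by (subst sum.union_disjoint, (auto)[3])+ (simp add: u_def power2_eq_square)
  have n2: "n = 2 * (\<Sum>i<m. u i * z i)"
    using \<rho> S unfolding n uz by (simp add: power2_eq_square algebra_simps)
  \<comment> \<open>If the tail of z already equals \<rho> e_k, then u = 0 and n = 0; division by 0
    gives 0, which makes \<open>H\<close> the identity, as it should be in this case.\<close>
  define H where "H i j = (if i = j then 1 else 0) - 2 / n * u i * u j" for i j
  have mvH: "mv m H c i = c i - 2 / n * u i * (\<Sum>j<m. u j * c j)" if "i < m" for c i
  proof -
    have "mv m H c i = (\<Sum>j<m. (if i = j then c j else 0) - 2 / n * u i * (u j * c j))"
      unfolding mv_def H_def by (intro sum.cong) (auto simp: algebra_simps)
    then show ?thesis using that by (simp add: sum_subtractf sum_distrib_left)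
  qed
  have norm: "(\<Sum>i<m. (mv m H c i)\<^sup>2) = (\<Sum>i<m. (c i)\<^sup>2)" for c
  proof -
    define s where "s = (\<Sum>j<m. u j * c j)"
    have mvc: "mv m H c i = c i - 2 / n * u i * s" if "i < m" for i
      unfolding s_def by (rule mvH[OF that])
    have "(\<Sum>i<m. (mv m H c i)\<^sup>2) = (\<Sum>i<m. (c i)\<^sup>2 - 4 / n * s * (u i * c i) + 4 / n\<^sup>2 * s\<^sup>2 * (u i)\<^sup>2)"
      by (intro sum.cong refl) (simp add: mvc power2_eq_square algebra_simps)
    also have "\<dots> = (\<Sum>i<m. (c i)\<^sup>2) - 4 / n * s * s + 4 / n\<^sup>2 * s\<^sup>2 * n"
      by (simp add: sum.distrib sum_subtractf sum_distrib_left s_def n_def)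
    also have "\<dots> = (\<Sum>i<m. (c i)\<^sup>2)"
      by (cases "n = 0") (simp_all add: power2_eq_square)
    finally show ?thesis .
  qed
  have "dt m H * dt m H = 1"
  proof -
    have "dt m (mm m H H) = dt m (\<lambda>i j. if i = j then 1 else 0)"
    proof (rule dt_cong)
      fix i j assume ij: "i < m" "j < m"
      let ?e = "\<lambda>i. if i = j then 1 else (0 :: real)"
      have ue: "(\<Sum>l<m. u l * ?e l) = u j" using ij by (simp add: if_distrib[of "\<lambda>x. _ * x"] cong: if_cong)
      have "mm m H H i j = mv m (mm m H H) ?e i" using ij by (simp add: mv_unit)
      also have "\<dots> = mv m H (mv m H ?e) i" by (rule mv_mm)
      also have "\<dots> = mv m H (\<lambda>l. ?e l - 2 / n * u l * u j) i"
        by (rule mv_cong) (simp add: mvH ue)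
      also have "\<dots> = ?e i - 2 / n * u i * u j - 2 / n * u i * (\<Sum>l<m. u l * (?e l - 2 / n * u l * u j))"
        using ij by (simp add: mvH)
      also have "(\<Sum>l<m. u l * (?e l - 2 / n * u l * u j)) = u j - 2 / n * n * u j"
      proof -
        have "(\<Sum>l<m. u l * (?e l - 2 / n * u l * u j)) = (\<Sum>l<m. u l * ?e l - 2 / n * u j * (u l)\<^sup>2)"
          by (intro sum.cong refl) (simp add: power2_eq_square algebra_simps)
        then show ?thesis by (simp only: sum_subtractf ue sum_distrib_left[symmetric] n_def[symmetric])
            (simp add: ac_simps)
      qed
      finally show "mm m H H i j = (if i = j then 1 else 0)"
        by (cases "n = 0") (simp_all add: algebra_simps)
    qed
    then show ?thesis by (simp add: dt_mm dt_id)
  qed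
  then have "\<bar>dt m H\<bar> = 1" by (metis abs_mult_self_eq abs_mult abs_one power2_eq_1_iff power2_eq_square abs_minus)
  with norm have "orth m H" by (simp add: orth_def)
  moreover have "mv m H c i = c i" if "\<forall>j<m. k \<le> j \<longrightarrow> c j = 0" "i < m" for c i
  proof -
    have "u j * c j = 0" if "j < m" for j
      using that \<open>\<forall>j<m. k \<le> j \<longrightarrow> c j = 0\<close> by (cases "j < k") (auto simp: u_def)
    then have "(\<Sum>j<m. u j * c j) = 0" by (intro sum.neutral) auto
    then show ?thesis using mvH[OF \<open>i < m\<close>, of c] by simp
  qed
  moreover have Hz: "mv m H z i = z i - u i" if "i < m" for i
  proof (cases "n = 0")
    case True
    have "(u i)\<^sup>2 \<le> n" unfolding n_def by (rule member_le_sum) (use that in auto)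
    then show ?thesis using True mvH[OF that, of z] by simp
  next
    case False
    then show ?thesis using n2 mvH[OF that, of z] by (simp add: field_simps)
  qed
  moreover have "mv m H z i = 0" if "i < m" "k < i" for i
    using Hz[OF that(1)] that by (simp add: u_def)
  moreover have "(mv m H z k)\<^sup>2 = (\<Sum>i\<in>{k..<m}. (z i)\<^sup>2)"
    using Hz[OF k] \<rho> by (simp add: u_def)
  ultimately show ?thesis by blast
qed

text \<open>A QR scheme in which the k-th vector is chosen only after the rotation for its
  predecessors is known: \<open>step\<close> supplies a vector with a large tail from coordinate k
  on, and a reflection concentrates this tail in coordinate k. The earlier columns vanish from
  coordinate k on, so the reflection fixes them. Prescribed unit vectors give the ordinary QR
  decomposition, chosen ones the Dvoretzky-Rogers system.\<close>

lemma adaptive_triangularization: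
  assumes step: "\<And>Q k. orth m Q \<Longrightarrow> k < m \<Longrightarrow>
     \<exists>c. P k c \<and> r k \<le> (\<Sum>i\<in>{k..<m}. (mv m Q (mv m A c) i)\<^sup>2)"
  shows "\<exists>Q c. orth m Q \<and> (\<forall>k<m. P k (c k) \<and> (\<forall>i<m. k < i \<longrightarrow> mv m Q (mv m A (c k)) i = 0) \<and>
     r k \<le> (mv m Q (mv m A (c k)) k)\<^sup>2)"
proof -
  have "\<exists>Q c. orth m Q \<and> (\<forall>k<n. P k (c k) \<and> (\<forall>i<m. k < i \<longrightarrow> mv m Q (mv m A (c k)) i = 0) \<and>
     r k \<le> (mv m Q (mv m A (c k)) k)\<^sup>2)" if "n \<le> m" for n
    using that
  proof (induction n)
    case 0
    then show ?case using orth_id by blast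
  next
    case (Suc n)
    then obtain Q c where Q: "orth m Q" and c: "\<And>k. k < n \<Longrightarrow> P k (c k)"
      "\<And>k i. k < n \<Longrightarrow> i < m \<Longrightarrow> k < i \<Longrightarrow> mv m Q (mv m A (c k)) i = 0"
      "\<And>k. k < n \<Longrightarrow> r k \<le> (mv m Q (mv m A (c k)) k)\<^sup>2"
      by auto
    have n: "n < m" using Suc.prems by simp
    obtain d where d: "P n d" "r n \<le> (\<Sum>i\<in>{n..<m}. (mv m Q (mv m A d) i)\<^sup>2)"
      using step[OF Q n] by blast
    obtain H where H: "orth m H"
      "\<And>c i. (\<forall>j<m. n \<le> j \<longrightarrow> c j = 0) \<Longrightarrow> i < m \<Longrightarrow> mv m H c i = c i"
      "\<And>i. i < m \<Longrightarrow> n < i \<Longrightarrow> mv m H (mv m Q (mv m A d)) i = 0"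
      "(mv m H (mv m Q (mv m A d)) n)\<^sup>2 = (\<Sum>i\<in>{n..<m}. (mv m Q (mv m A d) i)\<^sup>2)"
      using householder[OF n, of "mv m Q (mv m A d)"] by metis
    have old: "mv m H (mv m Q (mv m A (c k))) i = mv m Q (mv m A (c k)) i" if "k < n" "i < m" for k i
      by (rule H(2)) (use c(2) that in auto)
    have "P k ((c(n := d)) k) \<and> (\<forall>i<m. k < i \<longrightarrow> mv m (mm m H Q) (mv m A ((c(n := d)) k)) i = 0) \<and>
        r k \<le> (mv m (mm m H Q) (mv m A ((c(n := d)) k)) k)\<^sup>2" if k: "k < Suc n" for k
    proof (cases "k = n")
      case True
      then show ?thesis using d H by (simp add: mv_mm)
    next
      case False
      then have "k < n" using k by simp
      then show ?thesis using c old n False by (simp add: mv_mm)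
    qed
    then show ?case using orth_mm[OF H(1) Q] by blast
  qed
  from this[of m] show ?thesis by blast
qed

lemma QR_decomposition:
  "\<exists>Q. orth m Q \<and> (\<forall>i<m. \<forall>j<i. mm m Q A i j = 0)"
proof -
  have "\<exists>Q c. orth m Q \<and> (\<forall>k<m. c k = (\<lambda>i. if i = k then 1 else 0) \<and>
     (\<forall>i<m. k < i \<longrightarrow> mv m Q (mv m A (c k)) i = 0) \<and> 0 \<le> (mv m Q (mv m A (c k)) k)\<^sup>2)"
    by (rule adaptive_triangularization) (auto intro: sum_nonneg)
  then obtain Q c where "orth m Q" and c: "\<And>k. k < m \<Longrightarrow> c k = (\<lambda>i. if i = k then 1 else 0)"
     "\<And>k i. k < m \<Longrightarrow> i < m \<Longrightarrow> k < i \<Longrightarrow> mv m Q (mv m A (c k)) i = 0" by blast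
  moreover have "mm m Q A i j = 0" if "i < m" "j < i" for i j
  proof -
    have "mm m Q A i j = mv m (mm m Q A) (\<lambda>i. if i = j then 1 else 0) i"
      using that by (simp add: mv_unit)
    also have "\<dots> = mv m Q (mv m A (c j)) i" using that c(1)[of j] by (simp add: mv_mm)
    also have "\<dots> = 0" using c(2)[of j i] that by simp
    finally show ?thesis .
  qed
  ultimately show ?thesis by blast
qed

text \<open>By induction from (1 + 1/m)^m <= e <= 3. It bounds the product of the quotients (m - k)
  / m, which is m! / m^m, from below by 3^(-m).\<close>

lemma power_self_le_fact: "real m ^ m \<le> 3 ^ m * fact m"
proof (induction m)
  case 0 then show ?case by simp
next
  case (Suc m)
  have "real (Suc m) ^ m \<le> 3 * real m ^ m"
  proof (cases "m = 0")
    case False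
    have "(1 + 1 / real m) ^ m \<le> exp (1 / real m) ^ m"
      by (intro power_mono exp_ge_add_one_self) auto
    also have "\<dots> = exp 1" using False by (simp flip: exp_of_nat_mult)
    also have "\<dots> \<le> 3" by (rule exp_le)
    finally have "(1 + 1 / real m) ^ m * real m ^ m \<le> 3 * real m ^ m"
      by (rule mult_right_mono) simp
    moreover have "(1 + 1 / real m) ^ m * real m ^ m = real (Suc m) ^ m"
      using False by (simp flip: power_mult_distrib add: field_simps)
    ultimately show ?thesis by simp
  qed simp
  then have "real (Suc m) * real (Suc m) ^ m \<le> real (Suc m) * (3 * real m ^ m)"
    by (rule mult_left_mono) simp
  also have "\<dots> \<le> real (Suc m) * (3 * (3 ^ m * fact m))"
    using Suc.IH by (intro mult_left_mono) auto
  finally show ?case by (simp add: algebra_simps)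
qed

section \<open>A determinant form of the Dvoretzky-Rogers lemma\<close>

lemma dt_triangular_columns:
  assumes "\<And>k i. k < m \<Longrightarrow> i < m \<Longrightarrow> k < i \<Longrightarrow> mv m Q (mv m A (c k)) i = 0"
  shows "dt m Q * (dt m A * dt m (\<lambda>j k. c k j)) = (\<Prod>k<m. mv m Q (mv m A (c k)) k)"
proof -
  have e: "mm m Q (mm m A (\<lambda>j k. c k j)) i k = mv m Q (mv m A (c k)) i" if "i < m" "k < m" for i k
    using that by (simp add: mm_def mv_def)
  have "dt m Q * (dt m A * dt m (\<lambda>j k. c k j)) = dt m (\<lambda>i k. mv m Q (mv m A (c k)) i)"
    unfolding dt_mm[symmetric] by (rule dt_cong) (rule e)
  also have "\<dots> = (\<Prod>k<m. mv m Q (mv m A (c k)) k)"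
    using assms by (intro dt_upper_triangular) auto
  finally show ?thesis .
qed

text \<open>A nearly maximal determinant leaves no room for short tails. If all images of the unit
  ball of \<open>s\<close> had tails of squared length below (m - k) / (15 m), then stretching the m
  - k tail coordinates by sqrt a and shrinking the first k by sqrt b would give another contraction,
  with at least twice the determinant. Maximality up to a factor 2 spares the existence of a
  maximum.\<close>

lemma dvoretzky_rogers_step:
  fixes s :: "(nat \<Rightarrow> real) \<Rightarrow> real"
  assumes hom: "\<And>r c. s (\<lambda>i. r * c i) = \<bar>r\<bar> * s c" and nonneg: "\<And>c. 0 \<le> s c"
    and A: "contr m A s" "dt m A \<noteq> 0"
    and max: "\<And>A'. contr m A' s \<Longrightarrow> \<bar>dt m A'\<bar> < 2 * \<bar>dt m A\<bar>"
    and Q: "orth m Q" and k: "k < m"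
  shows "\<exists>c. s c \<le> 1 \<and> real (m - k) / (15 * m) \<le> (\<Sum>i\<in>{k..<m}. (mv m Q (mv m A c) i)\<^sup>2)"
proof (rule ccontr)
  assume neg: "\<not> ?thesis"
  define r where "r = real (m - k)"
  have r: "r \<ge> 1" "r \<le> m" using k by (auto simp: r_def)
  \<comment> \<open>By Bernoulli's inequality a^r >= 8 for r = m - k, and b^k >= 1/2, so the squared
    determinant grows by a factor of at least 4. The constant 15 is twice 7 + 1/2: the stretched
    tail then fits into the loss 1 - b = 1 / (2 m).\<close>
  define a where "a = 1 + 7 / r"
  define b where "b = 1 - 1 / (2 * real m)"
  have m: "real m \<ge> 1" using k by simp
  have ab: "a > 0" "b > 0" "a \<ge> b" using r m by (auto simp: a_def b_def field_simps)
  define d where "d i = (if i < k then sqrt b else sqrt a)" for i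
  define A' where "A' i j = d i * mm m Q A i j" for i j
  have mvA': "mv m A' c i = d i * mv m Q (mv m A c) i" for c i
    unfolding mv_mm[symmetric] by (simp add: A'_def[abs_def] mv_def sum_distrib_left ac_simps)
  have split: "{..<m} = {..<k} \<union> {k..<m}" using k by auto
  have "contr m A' s"
    unfolding contr_def
  proof
    fix c
    define h where "h c = (\<Sum>i<k. (mv m Q (mv m A c) i)\<^sup>2)" for c
    define t where "t c = (\<Sum>i\<in>{k..<m}. (mv m Q (mv m A c) i)\<^sup>2)" for c
    have "h c + t c = (\<Sum>i<m. (mv m Q (mv m A c) i)\<^sup>2)" for c
      unfolding h_def t_def split by (subst sum.union_disjoint) auto
    then have ht: "h c + t c \<le> (s c)\<^sup>2" for c
      using Q A(1) by (simp add: orth_def contr_def)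
    have th0: "0 \<le> h c" "0 \<le> t c" by (auto simp: h_def t_def intro: sum_nonneg)
    have scale: "mv m Q (mv m A (\<lambda>i. w * c i)) i = w * mv m Q (mv m A c) i" for w c i
      by (simp add: mv_scale[abs_def])
    \<comment> \<open>The negated claim concerns vectors with s c <= 1 only. Homogeneity extends it
      to all c; where \<open>s\<close> vanishes, contractivity makes the tail 0.\<close>
    have t: "t c \<le> r / (15 * m) * (s c)\<^sup>2"
    proof (cases "s c = 0")
      case True
      then show ?thesis using ht[of c] th0 by auto
    next
      case False
      then have s: "s c > 0" using nonneg[of c] by simp
      have "s (\<lambda>i. inverse (s c) * c i) \<le> 1" using s by (simp only: hom) simp
      then have "t (\<lambda>i. inverse (s c) * c i) \<le> r / (15 * m)"
        using neg unfolding r_def t_def by force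
      moreover have "t (\<lambda>i. inverse (s c) * c i) = (inverse (s c))\<^sup>2 * t c"
        by (simp add: t_def scale power_mult_distrib sum_distrib_left)
      ultimately have "(inverse (s c))\<^sup>2 * t c * (s c)\<^sup>2 \<le> r / (15 * m) * (s c)\<^sup>2"
        by (intro mult_right_mono) auto
      moreover have "(inverse (s c))\<^sup>2 * t c * (s c)\<^sup>2 = t c"
        using s by (simp add: field_simps)
      ultimately show ?thesis by simp
    qed
    have "(\<Sum>i<m. (mv m A' c i)\<^sup>2) = b * h c + a * t c"
      unfolding split h_def t_def using ab
      by (subst sum.union_disjoint) (auto simp: mvA' d_def power_mult_distrib sum_distrib_left)
    also have "\<dots> = b * (h c + t c) + (a - b) * t c" by (simp add: algebra_simps)
    also have "\<dots> \<le> b * (s c)\<^sup>2 + (a - b) * (r / (15 * m) * (s c)\<^sup>2)"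
      using ht[of c] t ab by (intro add_mono mult_left_mono) auto
    also have "\<dots> = (b + (a - b) * (r / (15 * m))) * (s c)\<^sup>2" by (simp add: algebra_simps)
    also have "\<dots> \<le> 1 * (s c)\<^sup>2"
    proof (rule mult_right_mono)
      have "(a - b) * (r / (15 * m)) = (7 + r / (2 * m)) / (15 * m)"
        using r m by (simp add: a_def b_def field_simps)
      also have "\<dots> \<le> (7 + 1 / 2) / (15 * m)"
        using r m by (intro divide_right_mono add_left_mono) (auto simp: field_simps)
      also have "\<dots> = 1 / (2 * real m)" using m by (simp add: field_simps)
      finally show "b + (a - b) * (r / (15 * m)) \<le> 1" by (simp add: b_def)
    qed simp
    finally show "(\<Sum>i<m. (mv m A' c i)\<^sup>2) \<le> (s c)\<^sup>2" by simp
  qed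
  moreover have "\<bar>dt m A'\<bar> = (\<Prod>i<m. d i) * \<bar>dt m A\<bar>"
  proof -
    have "dt m A' = (\<Prod>i<m. d i) * (dt m Q * dt m A)"
      unfolding A'_def[abs_def] by (simp add: dt_scale_rows dt_mm)
    moreover have "0 \<le> (\<Prod>i<m. d i)" using ab by (intro prod_nonneg) (auto simp: d_def)
    ultimately show ?thesis using Q by (simp add: orth_def abs_mult)
  qed
  ultimately have "(\<Prod>i<m. d i) < 2" using max[of A'] A(2) by simp
  moreover have "2\<^sup>2 \<le> (\<Prod>i<m. d i)\<^sup>2"
  proof -
    have "(\<Prod>i<m. d i)\<^sup>2 = (\<Prod>i<m. (d i)\<^sup>2)" by (simp add: prod_power_distrib)
    also have "\<dots> = b ^ k * a ^ (m - k)"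
      unfolding split using ab by (subst prod.union_disjoint) (auto simp: d_def)
    also have "\<dots> \<ge> (1 / 2) * 8"
    proof (rule mult_mono)
      have "1 + real m * (- 1 / (2 * real m)) \<le> (1 + (- 1 / (2 * real m))) ^ m"
        by (rule Bernoulli_inequality) (use m in \<open>simp add: field_simps\<close>)
      then have "1 / 2 \<le> b ^ m" using m by (simp add: b_def field_simps)
      also have "\<dots> \<le> b ^ k" using ab k m by (intro power_decreasing) (auto simp: b_def)
      finally show "1 / 2 \<le> b ^ k" .
      have "1 + real (m - k) * (7 / r) \<le> (1 + 7 / r) ^ (m - k)"
        by (rule Bernoulli_inequality) (use r in \<open>simp add: field_simps\<close>)
      then show "8 \<le> a ^ (m - k)" using r by (simp add: a_def r_def[symmetric])
    qed (use ab in auto)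
    finally show ?thesis by simp
  qed
  moreover have "0 \<le> (\<Prod>i<m. d i)" using ab by (intro prod_nonneg) (auto simp: d_def)
  ultimately show False
    using power_strict_mono[of "\<Prod>i<m. d i" 2 2] by simp
qed

text \<open>For a nearly maximal \<open>A\<close>, the triangular matrix Q A X has squared diagonal
  entries at least (m - k) / (15 m), with product m! / (15 m)^m >= 45^(-m). Hence |det A| |det X| >=
  7^(-m), and \<delta> bounds |det A|. The matrix \<open>A0\<close> makes the supremum of the
  determinants positive.\<close>

lemma dvoretzky_rogers:
  fixes s :: "(nat \<Rightarrow> real) \<Rightarrow> real"
  assumes hom: "\<And>r c. s (\<lambda>i. r * c i) = \<bar>r\<bar> * s c" and nonneg: "\<And>c. 0 \<le> s c"
    and A0: "contr m A0 s" "dt m A0 \<noteq> 0"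
    and bound: "\<And>A. contr m A s \<Longrightarrow> \<bar>dt m A\<bar> \<le> \<delta>"
  shows "\<exists>X. (\<forall>k<m. s (\<lambda>j. X j k) \<le> 1) \<and> (1 / 7) ^ m \<le> \<bar>dt m X\<bar> * \<delta>"
proof -
  let ?D = "{\<bar>dt m A\<bar> | A. contr m A s}"
  have bdd: "bdd_above ?D" using bound by (intro bdd_aboveI[of _ \<delta>]) auto
  have le: "\<bar>dt m A\<bar> \<le> Sup ?D" if "contr m A s" for A
    by (rule cSup_upper[OF _ bdd]) (use that in auto)
  have pos: "Sup ?D > 0" using le[OF A0(1)] A0(2) by simp
  then have "Sup ?D / 2 < Sup ?D" by simp
  then obtain A where A: "contr m A s" "Sup ?D / 2 < \<bar>dt m A\<bar>"
    using less_cSup_iff[OF _ bdd, of "Sup ?D / 2"] A0(1) by blast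
  have max: "\<bar>dt m A'\<bar> < 2 * \<bar>dt m A\<bar>" if "contr m A' s" for A'
    using le[OF that] A(2) by simp
  have dA: "dt m A \<noteq> 0" using A(2) pos by auto
  have "\<exists>Q c. orth m Q \<and> (\<forall>k<m. s (c k) \<le> 1 \<and>
      (\<forall>i<m. k < i \<longrightarrow> mv m Q (mv m A (c k)) i = 0) \<and>
      real (m - k) / (15 * m) \<le> (mv m Q (mv m A (c k)) k)\<^sup>2)"
    by (rule adaptive_triangularization[where P = "\<lambda>_ c. s c \<le> 1"])
      (rule dvoretzky_rogers_step[OF hom nonneg A(1) dA max])
  then obtain Q c where Q: "orth m Q" and c: "\<And>k. k < m \<Longrightarrow> s (c k) \<le> 1"
    "\<And>k i. k < m \<Longrightarrow> i < m \<Longrightarrow> k < i \<Longrightarrow> mv m Q (mv m A (c k)) i = 0"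
    "\<And>k. k < m \<Longrightarrow> real (m - k) / (15 * m) \<le> (mv m Q (mv m A (c k)) k)\<^sup>2"
    by blast
  let ?X = "\<lambda>j k. c k j"
  have "((1 / 7) ^ m)\<^sup>2 \<le> (\<bar>dt m ?X\<bar> * \<bar>dt m A\<bar>)\<^sup>2"
  proof (cases "m = 0")
    case False
    \<comment> \<open>45 is rounded up to 49 = 7^2 in order to have a rational square root.\<close>
    have "(1 / 49 :: real) ^ m \<le> (1 / 45) ^ m" by (intro power_mono) auto
    also have "\<dots> = real m ^ m / (3 ^ m * (15 * real m) ^ m)"
    proof -
      have "3 ^ m * (15 * real m) ^ m = 45 ^ m * real m ^ m"
        unfolding power_mult_distrib[symmetric] by simp
      then show ?thesis using False by (simp add: power_divide)
    qed
    also have "\<dots> \<le> fact m / (15 * real m) ^ m"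
    proof -
      have "real m ^ m / 3 ^ m \<le> fact m"
        using power_self_le_fact[of m] by (simp add: divide_le_eq mult.commute)
      then have "real m ^ m / 3 ^ m / (15 * real m) ^ m \<le> fact m / (15 * real m) ^ m"
        by (rule divide_right_mono) simp
      then show ?thesis by (simp only: divide_divide_eq_left)
    qed
    also have "\<dots> = (\<Prod>k<m. real (m - k) / (15 * m))"
    proof -
      have "(fact m :: real) = (\<Prod>k<m. real (m - k))"
        by (simp add: fact_prod_rev atLeast0LessThan)
      then show ?thesis by (simp add: prod_dividef)
    qed
    also have "\<dots> \<le> (\<Prod>k<m. (mv m Q (mv m A (c k)) k)\<^sup>2)"
      using c(3) by (intro prod_mono) auto
    also have "\<dots> = (dt m Q * (dt m A * dt m ?X))\<^sup>2"
      using dt_triangular_columns[of m Q A c, OF c(2)] by (simp add: prod_power_distrib)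
    also have "\<dots> = (\<bar>dt m ?X\<bar> * \<bar>dt m A\<bar>)\<^sup>2"
    proof -
      have "(dt m Q)\<^sup>2 = 1" using Q by (metis orth_def power2_abs one_power2)
      then show ?thesis by (simp add: power_mult_distrib)
    qed
    finally have "(1 / 49) ^ m \<le> (\<bar>dt m ?X\<bar> * \<bar>dt m A\<bar>)\<^sup>2" .
    moreover have "((1 / 7 :: real) ^ m)\<^sup>2 = (1 / 49) ^ m"
      unfolding power2_eq_square power_mult_distrib[symmetric] by simp
    ultimately show ?thesis by simp
  qed (simp add: dt_def)
  then have "(1 / 7) ^ m \<le> \<bar>dt m ?X\<bar> * \<bar>dt m A\<bar>"
    by (rule power2_le_imp_le) simp
  also have "\<dots> \<le> \<bar>dt m ?X\<bar> * \<delta>"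
    using bound[OF A(1)] by (intro mult_left_mono) auto
  finally show ?thesis using c(1) by (intro exI[of _ ?X]) auto
qed

section \<open>Points far from a lattice\<close>

lemma card_ints_Ico:
  fixes u l :: real
  assumes "0 \<le> l"
  shows "finite {n::int. u \<le> n \<and> n < u + l}" "real (card {n::int. u \<le> n \<and> n < u + l}) \<le> l + 1"
proof -
  have e: "{n::int. u \<le> n \<and> n < u + l} = {\<lceil>u\<rceil>..<\<lceil>u + l\<rceil>}"
    by (auto simp: ceiling_le_iff less_ceiling_iff)
  show "finite {n::int. u \<le> n \<and> n < u + l}" unfolding e by simp
  have "real_of_int (\<lceil>u + l\<rceil> - \<lceil>u\<rceil>) \<le> l + 1" by linarith
  then show "real (card {n::int. u \<le> n \<and> n < u + l}) \<le> l + 1"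
    unfolding e using assms by (simp add: ceiling_mono)
qed

lemma card_scaled_Ico:
  fixes u l \<tau> :: real and M :: nat
  assumes "0 \<le> l" "0 < \<tau>"
  shows "real (card {a. a < M \<and> u \<le> \<tau> * real a \<and> \<tau> * real a < u + l}) \<le> l / \<tau> + 1"
proof -
  let ?S = "{a. a < M \<and> u \<le> \<tau> * real a \<and> \<tau> * real a < u + l}"
  let ?T = "{n::int. u / \<tau> \<le> n \<and> n < u / \<tau> + l / \<tau>}"
  have "int ` ?S \<subseteq> ?T"
    using assms by (auto simp: field_simps)
  then have "card (int ` ?S) \<le> card ?T"
    using assms by (intro card_mono card_ints_Ico) auto
  moreover have "card (int ` ?S) = card ?S" by (rule card_image) simp
  moreover have "real (card ?T) \<le> l / \<tau> + 1" using assms by (intro card_ints_Ico) auto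
  ultimately show ?thesis by linarith
qed

text \<open>Up to the constant 8 this is the count expected from equidistribution: M grid points of
  mesh \<eta> in [0, P), scaled by t and shifted by integers, in a window of length l. For l >= 1
  each grid point meets at most l + 2 integers. For l < 1 at most 4 t P integers are involved, and
  each meets at most l / (t \<eta>) + 1 grid points.\<close>

lemma card_grid_minus_ints:
  fixes t l \<eta> u :: real and M P :: nat
  assumes t: "1 / P \<le> t" "t \<le> 1" and P: "P \<ge> 1" and M: "M \<ge> 1"
    and \<eta>: "\<eta> = P / M" and l: "\<eta> \<le> l"
  shows "real (card {\<sigma> \<in> {..<M} \<times> {- int P..int P}.
      u \<le> t * (real (fst \<sigma>) * \<eta>) - real_of_int (snd \<sigma>) \<and>
      t * (real (fst \<sigma>) * \<eta>) - real_of_int (snd \<sigma>) < u + l}) \<le> 8 * l * M"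
    (is "real (card ?S) \<le> _")
proof -
  have \<eta>0: "\<eta> > 0" using P M by (simp add: \<eta>)
  have "0 < 1 / real P" using P by simp
  then have t0: "t > 0" using t(1) by linarith
  have tP: "1 \<le> t * P" using t P by (simp add: field_simps)
  have fin: "finite ?S" by (rule finite_subset[of _ "{..<M} \<times> {- int P..int P}"]) auto
  show ?thesis
  proof (cases "l \<ge> 1")
    case True
    define I where "I a = {n::int. (t * (real a * \<eta>) - u - l) \<le> n \<and> n < (t * (real a * \<eta>) - u - l) + (l + 1)}" for a
    have I: "finite (I a)" "real (card (I a)) \<le> l + 2" for a
      using card_ints_Ico[of "l + 1" "t * (real a * \<eta>) - u - l"] True by (auto simp: I_def)
    have "?S \<subseteq> Sigma {..<M} I" by (auto simp: I_def)
    then have "card ?S \<le> card (Sigma {..<M} I)" using I by (intro card_mono) auto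
    also have "\<dots> = (\<Sum>a<M. card (I a))" using I by simp
    finally have "real (card ?S) \<le> (\<Sum>a<M. real (card (I a)))" by (simp flip: of_nat_sum)
    also have "\<dots> \<le> (\<Sum>a<M. l + 2)" using I by (intro sum_mono) auto
    also have "\<dots> = (l + 2) * M" by simp
    also have "\<dots> \<le> 8 * l * M" using True by (intro mult_right_mono) auto
    finally show ?thesis .
  next
    case False
    \<comment> \<open>The integers that can occur, since t a \<eta> ranges over [0, t P]. Their
      number is at most t P + 3 <= 4 t P, as t P >= 1.\<close>
    define J where "J = {n::int. - u - l \<le> n \<and> n < (- u - l) + (t * P + l + 1)}"
    have J: "finite J" "real (card J) \<le> 4 * (t * P)"
      using card_ints_Ico[of "t * P + l + 1" "- u - l"] False l \<eta>0 tP by (auto simp: J_def)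
    define K where "K n = {a. a < M \<and> u + real_of_int n \<le> t * \<eta> * real a \<and> t * \<eta> * real a < u + real_of_int n + l}" for n
    have K: "finite (K n)" "real (card (K n)) \<le> l / (t * \<eta>) + 1" for n
      using card_scaled_Ico[of l "t * \<eta>" M "u + real_of_int n"] l \<eta>0 t0 by (auto simp: K_def)
    have "prod.swap ` ?S \<subseteq> Sigma J K"
    proof
      fix x assume "x \<in> prod.swap ` ?S"
      then obtain a n where x: "x = (n, a)" and a: "a < M" and
        b: "u \<le> t * (real a * \<eta>) - real_of_int n" "t * (real a * \<eta>) - real_of_int n < u + l" by auto
      have "real P * real a \<le> real P * real M" using a by (intro mult_left_mono) auto
      then have "real a * \<eta> \<le> P" using M by (simp add: \<eta> field_simps)
      then have "t * (real a * \<eta>) \<le> t * P" using t0 by simp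
      moreover have "0 \<le> t * (real a * \<eta>)" using t0 \<eta>0 by simp
      ultimately have "n \<in> J" using b by (auto simp: J_def)
      moreover have "a \<in> K n" using a b by (auto simp: K_def ac_simps)
      ultimately show "x \<in> Sigma J K" using x by simp
    qed
    then have "card (prod.swap ` ?S) \<le> card (Sigma J K)" using J K by (intro card_mono) auto
    also have "\<dots> = (\<Sum>n\<in>J. card (K n))" using J K by simp
    finally have "real (card ?S) \<le> (\<Sum>n\<in>J. real (card (K n)))"
      by (simp add: card_image flip: of_nat_sum)
    also have "\<dots> \<le> (\<Sum>n\<in>J. l / (t * \<eta>) + 1)" using K by (intro sum_mono) auto
    also have "\<dots> = real (card J) * (l / (t * \<eta>) + 1)" by simp
    also have "\<dots> \<le> 4 * (t * P) * (l / (t * \<eta>) + 1)"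
      using J l \<eta>0 t0 by (intro mult_right_mono) auto
    also have "\<dots> = 4 * l * M + 4 * (t * P)"
      using t0 P M by (simp add: \<eta> field_simps)
    \<comment> \<open>Here P = \<eta> M <= l M, which requires the window not to be shorter than the
      mesh.\<close>
    also have "\<dots> \<le> 4 * l * M + 4 * (l * M)"
    proof -
      have "t * real P \<le> 1 * real P" using t by (intro mult_right_mono) auto
      also have "\<dots> = \<eta> * M" using M by (simp add: \<eta>)
      also have "\<dots> \<le> l * M" using l by (intro mult_right_mono) auto
      finally show ?thesis by simp
    qed
    finally show ?thesis by simp
  qed
qed


section \<open>Exponential sums over grid points and the counting argument\<close>

lemma sum_half_power_ints: "(\<Sum>k\<in>{- int L..int L}. (1 / 2 :: real) ^ nat \<bar>k\<bar>) = 3 - 2 * (1 / 2) ^ L"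
proof (induction L)
  case (Suc L)
  have "{- int (Suc L)..int (Suc L)} = insert (int (Suc L)) (insert (- int (Suc L)) {- int L..int L})"
    by auto
  then show ?case using Suc by (simp add: nat_add_distrib)
qed simp

lemma exp_abs_le_half_power_floor: "exp (- \<bar>z\<bar>) \<le> 3 * (1 / 2 :: real) ^ nat \<bar>\<lfloor>z\<rfloor>\<bar>"
proof -
  have "real (nat \<bar>\<lfloor>z\<rfloor>\<bar>) \<le> \<bar>z\<bar> + 1" by linarith
  then have "exp (- \<bar>z\<bar>) \<le> exp (1 - real (nat \<bar>\<lfloor>z\<rfloor>\<bar>))" by simp
  also have "\<dots> = exp 1 * exp (- 1) ^ nat \<bar>\<lfloor>z\<rfloor>\<bar>"
    by (simp add: exp_diff exp_minus field_simps flip: exp_of_nat_mult)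
  also have "\<dots> \<le> 3 * (1 / 2) ^ nat \<bar>\<lfloor>z\<rfloor>\<bar>"
  proof (intro mult_mono power_mono)
    have "(2 :: real) \<le> exp 1" using exp_ge_add_one_self[of 1] by simp
    then show "exp (- 1) \<le> (1 / 2 :: real)" by (simp add: exp_minus field_simps)
  qed (auto intro: exp_le)
  finally show ?thesis .
qed

text \<open>Cut the line into cells of length l. Each carries at most c points, the exponential is
  at most 3 * 2^(-|k|) on the k-th cell, and the two-sided geometric series stays below 3. The shift
  \<open>h\<close> does not enter the bound because the count holds for windows in every
  position.\<close>

lemma sum_exp_le_of_interval_counts:
  fixes v :: "'b \<Rightarrow> real"
  assumes S: "finite S" and l: "l > 0"
    and count: "\<And>u. real (card {\<sigma> \<in> S. u \<le> v \<sigma> \<and> v \<sigma> < u + l}) \<le> c"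
  shows "(\<Sum>\<sigma>\<in>S. exp (- \<bar>v \<sigma> / l + h\<bar>)) \<le> 9 * c"
proof -
  define g where "g \<sigma> = \<lfloor>v \<sigma> / l + h\<rfloor>" for \<sigma>
  have c: "0 \<le> c" using count[of 0] by linarith
  have fin: "finite (g ` S)" using S by simp
  obtain L where L: "g ` S \<subseteq> {- int L..int L}"
  proof
    show "g ` S \<subseteq> {- int (nat (Max (abs ` g ` S)))..int (nat (Max (abs ` g ` S)))}"
    proof
      fix k assume "k \<in> g ` S"
      then have "\<bar>k\<bar> \<le> Max (abs ` g ` S)" using S by (intro Max_ge) auto
      then show "k \<in> {- int (nat (Max (abs ` g ` S)))..int (nat (Max (abs ` g ` S)))}" by auto
    qed
  qed
  have "(\<Sum>\<sigma>\<in>S. exp (- \<bar>v \<sigma> / l + h\<bar>)) \<le> (\<Sum>\<sigma>\<in>S. 3 * (1 / 2 :: real) ^ nat \<bar>g \<sigma>\<bar>)"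
    unfolding g_def by (intro sum_mono exp_abs_le_half_power_floor)
  also have "\<dots> = (\<Sum>k\<in>g ` S. \<Sum>\<sigma>\<in>{\<sigma> \<in> S. g \<sigma> = k}. 3 * (1 / 2 :: real) ^ nat \<bar>g \<sigma>\<bar>)"
    by (rule sum.group[symmetric]) (use S in auto)
  also have "\<dots> \<le> (\<Sum>k\<in>g ` S. 3 * (1 / 2 :: real) ^ nat \<bar>k\<bar> * c)"
  proof (rule sum_mono)
    fix k
    have "{\<sigma> \<in> S. g \<sigma> = k} \<subseteq> {\<sigma> \<in> S. (k - h) * l \<le> v \<sigma> \<and> v \<sigma> < (k - h) * l + l}"
    proof
      fix \<sigma> assume "\<sigma> \<in> {\<sigma> \<in> S. g \<sigma> = k}"
      then have \<sigma>: "\<sigma> \<in> S" and k: "k = \<lfloor>v \<sigma> / l + h\<rfloor>" by (auto simp: g_def)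
      have "k - h \<le> v \<sigma> / l" "v \<sigma> / l < k - h + 1" unfolding k by linarith+
      then have "(k - h) * l \<le> v \<sigma>" "v \<sigma> < (k - h + 1) * l"
        using l by (simp_all add: pos_le_divide_eq pos_divide_less_eq)
      then show "\<sigma> \<in> {\<sigma> \<in> S. (k - h) * l \<le> v \<sigma> \<and> v \<sigma> < (k - h) * l + l}"
        using \<sigma> by (simp add: algebra_simps)
    qed
    then have "card {\<sigma> \<in> S. g \<sigma> = k} \<le> card {\<sigma> \<in> S. (k - h) * l \<le> v \<sigma> \<and> v \<sigma> < (k - h) * l + l}"
      using S by (intro card_mono) auto
    then have "real (card {\<sigma> \<in> S. g \<sigma> = k}) \<le> c" using count[of "(k - h) * l"] by linarith
    then show "(\<Sum>\<sigma>\<in>{\<sigma> \<in> S. g \<sigma> = k}. 3 * (1 / 2 :: real) ^ nat \<bar>g \<sigma>\<bar>) \<le> 3 * (1 / 2) ^ nat \<bar>k\<bar> * c"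
      by (simp add: mult.commute mult_left_mono)
  qed
  also have "\<dots> \<le> (\<Sum>k\<in>{- int L..int L}. 3 * (1 / 2 :: real) ^ nat \<bar>k\<bar> * c)"
    using L c by (intro sum_mono2) auto
  also have "\<dots> = 3 * (\<Sum>k\<in>{- int L..int L}. (1 / 2 :: real) ^ nat \<bar>k\<bar>) * c"
    by (simp add: sum_distrib_left sum_distrib_right mult.assoc)
  also have "\<dots> \<le> 9 * c"
    unfolding sum_half_power_ints using c by (intro mult_right_mono) auto
  finally show ?thesis .
qed

lemma sum_exp_le_of_interval_counts':
  fixes v :: "'b \<Rightarrow> real"
  assumes S: "finite S" and b: "b \<noteq> 0"
    and count: "\<And>u. real (card {\<sigma> \<in> S. u \<le> v \<sigma> \<and> v \<sigma> < u + 1 / \<bar>b\<bar>}) \<le> c"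
  shows "(\<Sum>\<sigma>\<in>S. exp (- \<bar>b * v \<sigma> + h\<bar>)) \<le> 9 * c"
proof -
  have "\<bar>b * x + h\<bar> = \<bar>x / (1 / \<bar>b\<bar>) + sgn b * h\<bar>" for x
    using b by (cases "b > 0") (auto simp: sgn_if algebra_simps)
  then show ?thesis
    using sum_exp_le_of_interval_counts[OF S _ count, of "sgn b * h"] b by simp
qed

text \<open>Iterated summation. By triangularity the variable \<sigma> k occurs, among the factors
  with index at least k, only in the k-th one, where the other variables merely shift the argument.
  Summing over it first costs \<open>G k\<close>, uniformly in the shift.\<close>

lemma sum_prod_triangular_le:
  fixes w :: "'b \<Rightarrow> real" and Z :: "nat \<Rightarrow> nat \<Rightarrow> real"
  assumes S: "finite S"
    and G: "\<And>i h. i < m \<Longrightarrow> (\<Sum>\<sigma>\<in>S. exp (- \<bar>Z i i * w \<sigma> + h\<bar>)) \<le> G i"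
    and k: "k \<le> m"
  shows "(\<Sum>\<sigma>\<in>PiE {k..<m} (\<lambda>_. S). \<Prod>i\<in>{k..<m}. exp (- \<bar>\<Sum>j\<in>{i..<m}. Z i j * w (\<sigma> j)\<bar>))
    \<le> (\<Prod>i\<in>{k..<m}. G i)"
  using k
proof (induction k rule: inc_induct)
  case base
  then show ?case by simp
next
  case (step k)
  have G0: "0 \<le> G i" if "i < m" for i
    using G[OF that, of 0] sum_nonneg[of S "\<lambda>\<sigma>. exp (- \<bar>Z i i * w \<sigma> + 0\<bar>)"] by force
  define f where "f k \<sigma> = (\<Prod>i\<in>{k..<m}. exp (- \<bar>\<Sum>j\<in>{i..<m}. Z i j * w (\<sigma> j)\<bar>))" for k \<sigma>
  have I: "{k..<m} = insert k {Suc k..<m}" using step by auto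
  have f: "f k (\<tau>(k := x)) = exp (- \<bar>Z k k * w x + (\<Sum>j\<in>{Suc k..<m}. Z k j * w (\<tau> j))\<bar>) * f (Suc k) \<tau>" for x \<tau>
  proof -
    have "(\<Sum>j\<in>{i..<m}. Z i j * w ((\<tau>(k := x)) j)) = (\<Sum>j\<in>{i..<m}. Z i j * w (\<tau> j))"
      if "i \<in> {Suc k..<m}" for i using that by (intro sum.cong) auto
    then have "f (Suc k) (\<tau>(k := x)) = f (Suc k) \<tau>" unfolding f_def by (intro prod.cong) auto
    moreover have "(\<Sum>j\<in>{k..<m}. Z k j * w ((\<tau>(k := x)) j)) =
        Z k k * w x + (\<Sum>j\<in>{Suc k..<m}. Z k j * w (\<tau> j))"
      unfolding I by (subst sum.insert) (auto intro!: sum.cong)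
    ultimately show ?thesis unfolding f_def by (subst I, subst prod.insert) auto
  qed
  have inj: "inj_on (\<lambda>(y, g). g(k := y)) (S \<times> PiE {Suc k..<m} (\<lambda>_. S))"
    by (rule inj_combinator) simp
  have "(\<Sum>\<sigma>\<in>PiE {k..<m} (\<lambda>_. S). f k \<sigma>) = (\<Sum>(x, \<tau>)\<in>S \<times> PiE {Suc k..<m} (\<lambda>_. S). f k (\<tau>(k := x)))"
    unfolding I PiE_insert_eq by (subst sum.reindex[OF inj]) (simp add: case_prod_unfold)
  also have "\<dots> = (\<Sum>\<tau>\<in>PiE {Suc k..<m} (\<lambda>_. S). \<Sum>x\<in>S. f k (\<tau>(k := x)))"
    by (subst sum.swap) (rule sum.cartesian_product[symmetric])
  also have "\<dots> \<le> (\<Sum>\<tau>\<in>PiE {Suc k..<m} (\<lambda>_. S). G k * f (Suc k) \<tau>)"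
  proof (rule sum_mono)
    fix \<tau>
    have "0 \<le> f (Suc k) \<tau>" unfolding f_def by (intro prod_nonneg) auto
    then show "(\<Sum>x\<in>S. f k (\<tau>(k := x))) \<le> G k * f (Suc k) \<tau>"
      unfolding f sum_distrib_right[symmetric] using G step by (intro mult_right_mono) auto
  qed
  also have "\<dots> = G k * (\<Sum>\<tau>\<in>PiE {Suc k..<m} (\<lambda>_. S). f (Suc k) \<tau>)"
    by (simp add: sum_distrib_left)
  also have "\<dots> \<le> G k * (\<Prod>i\<in>{Suc k..<m}. G i)"
    using step.IH G0 step by (intro mult_left_mono) (auto simp: f_def)
  also have "\<dots> = (\<Prod>i\<in>{k..<m}. G i)" unfolding I by simp
  finally show ?case by (simp add: f_def)
qed


text \<open>A first moment argument. For fixed t, call a point y of a grid with M^m points bad if |A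
  (t y - n)| <= R for some admissible integer vector n. The bad points are counted by an exponential
  bound, and even over the at most N values t = k / N there are fewer than M^m of them. Up to
  exponential factors, \<open>small\<close> compares the volume of a ball of radius R with det
  A.\<close>

lemma rounding_gap:
  fixes A :: "nat \<Rightarrow> nat \<Rightarrow> real" and m N P :: nat and R :: real
  assumes tri: "\<And>i j. i < m \<Longrightarrow> j < i \<Longrightarrow> A i j = 0" and diag: "\<And>i. i < m \<Longrightarrow> A i i \<noteq> 0"
    and R: "R > 0" and P: "P \<ge> 1" and m: "m \<ge> 1"
    and small: "real N * (216 * R / sqrt m) ^ m < (\<Prod>i<m. \<bar>A i i\<bar>)"
  shows "\<exists>y. (\<forall>j. 0 \<le> y j \<and> y j \<le> real P) \<and>
    (\<forall>k\<in>{1..N}. 1 / P \<le> real k / N \<longrightarrow> (\<forall>n :: nat \<Rightarrow> int. (\<forall>j. \<bar>n j\<bar> \<le> int P) \<longrightarrow>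
      R\<^sup>2 < (\<Sum>i<m. (mv m A (\<lambda>j. real k / N * y j - n j) i)\<^sup>2)))"
proof -
  define b where "b i = sqrt m / R * A i i" for i
  have b: "b i \<noteq> 0" if "i < m" for i using diag[OF that] R m by (simp add: b_def)
  \<comment> \<open>\<open>M\<close> is taken so large that the mesh P / M is at most 1 / |b i| for
    every i, the window length in the count.\<close>
  define B where "B = Max (insert 1 ((\<lambda>i. P * \<bar>b i\<bar>) ` {..<m}))"
  have B: "1 \<le> B" "\<And>i. i < m \<Longrightarrow> P * \<bar>b i\<bar> \<le> B"
    unfolding B_def by (auto intro: Max_ge)
  define M where "M = nat \<lceil>B\<rceil>"
  have MB: "B \<le> M" unfolding M_def by linarith
  then have M: "M \<ge> 1" using B by simp
  define \<eta> where "\<eta> = real P / real M"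
  have \<eta>: "\<eta> \<le> 1 / \<bar>b i\<bar>" if "i < m" for i
    using B(2)[OF that] MB M b[OF that] by (simp add: \<eta>_def field_simps)
  have \<eta>0: "0 < \<eta>" using P M by (simp add: \<eta>_def)
  define S where "S = {..<M} \<times> {- int P..int P}"
  have S: "finite S" by (simp add: S_def)
  define w where "w t \<sigma> = t * (real (fst \<sigma>) * \<eta>) - real_of_int (snd \<sigma>)" for t and \<sigma> :: "nat \<times> int"
  define Z where "Z i j = sqrt m / R * A i j" for i j
  define G where "G i = 72 * real M / \<bar>b i\<bar>" for i
  have G: "(\<Sum>\<sigma>\<in>S. exp (- \<bar>Z i i * w t \<sigma> + h\<bar>)) \<le> G i" if i: "i < m" and t: "1 / P \<le> t" "t \<le> 1" for i h t
  proof -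
    have "(\<Sum>\<sigma>\<in>S. exp (- \<bar>b i * w t \<sigma> + h\<bar>)) \<le> 9 * (8 * (1 / \<bar>b i\<bar>) * M)"
      unfolding w_def S_def
    proof (rule sum_exp_le_of_interval_counts'[where v = "\<lambda>\<sigma>. t * (real (fst \<sigma>) * \<eta>) - real_of_int (snd \<sigma>)"])
      show "real (card {\<sigma> \<in> {..<M} \<times> {- int P..int P}. u \<le> t * (real (fst \<sigma>) * \<eta>) - real_of_int (snd \<sigma>) \<and>
          t * (real (fst \<sigma>) * \<eta>) - real_of_int (snd \<sigma>) < u + 1 / \<bar>b i\<bar>}) \<le> 8 * (1 / \<bar>b i\<bar>) * M" for u
        by (rule card_grid_minus_ints[OF t P M \<eta>_def \<eta>[OF i]])
    qed (use b[OF i] in auto)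
    then show ?thesis by (simp add: G_def b_def Z_def ac_simps)
  qed
  define Y where "Y = PiE {..<m} (\<lambda>_. {..<M})"
  have Y: "finite Y" "card Y = M ^ m" by (simp_all add: Y_def finite_PiE card_PiE)
  define q where "q t \<sigma> = (\<Sum>i<m. (mv m A (\<lambda>j. w t (\<sigma> j)) i)\<^sup>2)" for t and \<sigma> :: "nat \<Rightarrow> nat \<times> int"
  \<comment> \<open>The grid parts of those pairs (y, n) that come too close; forgetting n can only
    lower the number.\<close>
  define Bad where "Bad t = (\<lambda>\<sigma>. \<lambda>j\<in>{..<m}. fst (\<sigma> j)) ` {\<sigma> \<in> PiE {..<m} (\<lambda>_. S). q t \<sigma> \<le> R\<^sup>2}" for t
  have cardBad: "real (card (Bad t)) \<le> 3 ^ m * (\<Prod>i<m. G i)" if t: "1 / P \<le> t" "t \<le> 1" for t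
  proof -
    let ?Q = "{\<sigma> \<in> PiE {..<m} (\<lambda>_. S). q t \<sigma> \<le> R\<^sup>2}"
    let ?z = "\<lambda>\<sigma> i. \<Sum>j\<in>{i..<m}. Z i j * w t (\<sigma> j)"
    have finP: "finite (PiE {..<m} (\<lambda>_. S))" using S by (intro finite_PiE) auto
    have zq: "(\<Sum>i<m. (?z \<sigma> i)\<^sup>2) = m / R\<^sup>2 * q t \<sigma>" for \<sigma>
    proof -
      have "?z \<sigma> i = sqrt m / R * mv m A (\<lambda>j. w t (\<sigma> j)) i" if "i < m" for i
      proof -
        have "mv m A (\<lambda>j. w t (\<sigma> j)) i = (\<Sum>j\<in>{i..<m}. A i j * w t (\<sigma> j))"
          unfolding mv_def using tri[OF that] that by (intro sum.mono_neutral_right) auto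
        then show ?thesis by (simp add: Z_def sum_distrib_left mult.assoc)
      qed
      then have "(\<Sum>i<m. (?z \<sigma> i)\<^sup>2) = (\<Sum>i<m. (sqrt m / R * mv m A (\<lambda>j. w t (\<sigma> j)) i)\<^sup>2)"
        by (intro sum.cong) auto
      also have "\<dots> = m / R\<^sup>2 * q t \<sigma>"
        by (simp add: q_def sum_distrib_left power_mult_distrib power_divide)
      finally show ?thesis .
    qed
    \<comment> \<open>Markov's inequality in exponential form: |z| <= (1 + z^2) / 2 yields \<Sum>
      |z_i| <= m as soon as q <= R^2, so e^m times the product of the exp (-|z_i|) is at least 1.
      Replacing e by 3 contributes the 3 in 216 = 3 * 72, and 72 = 9 * 8 comes from the exponential
      sum and the grid count.\<close>
    have one: "1 \<le> 3 ^ m * (\<Prod>i<m. exp (- \<bar>?z \<sigma> i\<bar>))" if "q t \<sigma> \<le> R\<^sup>2" for \<sigma>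
    proof -
      have "\<bar>x\<bar> \<le> (1 + x\<^sup>2) / 2" for x :: real
        using zero_le_power2[of "\<bar>x\<bar> - 1"] unfolding power2_diff by simp
      then have "(\<Sum>i<m. \<bar>?z \<sigma> i\<bar>) \<le> (\<Sum>i<m. (1 + (?z \<sigma> i)\<^sup>2) / 2)"
        by (intro sum_mono) blast
      also have "\<dots> = (m + (\<Sum>i<m. (?z \<sigma> i)\<^sup>2)) / 2"
        by (simp add: sum.distrib flip: sum_divide_distrib)
      also have "\<dots> \<le> m"
      proof -
        have "m / R\<^sup>2 * q t \<sigma> \<le> m / R\<^sup>2 * R\<^sup>2" using that by (intro mult_left_mono) auto
        then show ?thesis unfolding zq using R by simp
      qed
      finally have "1 \<le> exp (real m - (\<Sum>i<m. \<bar>?z \<sigma> i\<bar>))" by simp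
      also have "\<dots> = exp 1 ^ m * (\<Prod>i<m. exp (- \<bar>?z \<sigma> i\<bar>))"
        by (simp add: exp_diff exp_minus exp_sum divide_inverse prod_inversef[unfolded comp_def] flip: exp_of_nat_mult)
      also have "\<dots> \<le> 3 ^ m * (\<Prod>i<m. exp (- \<bar>?z \<sigma> i\<bar>))"
        by (intro mult_right_mono power_mono exp_le prod_nonneg) auto
      finally show ?thesis .
    qed
    have "real (card (Bad t)) \<le> real (card ?Q)"
      unfolding Bad_def using finP by (intro of_nat_mono card_image_le) auto
    also have "\<dots> = (\<Sum>\<sigma>\<in>?Q. 1)" by simp
    also have "\<dots> \<le> (\<Sum>\<sigma>\<in>?Q. 3 ^ m * (\<Prod>i<m. exp (- \<bar>?z \<sigma> i\<bar>)))"
      by (intro sum_mono one) blast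
    also have "\<dots> \<le> (\<Sum>\<sigma>\<in>PiE {..<m} (\<lambda>_. S). 3 ^ m * (\<Prod>i<m. exp (- \<bar>?z \<sigma> i\<bar>)))"
      by (rule sum_mono2[OF finP]) (blast, intro mult_nonneg_nonneg prod_nonneg ballI, simp_all)
    also have "\<dots> = 3 ^ m * (\<Sum>\<sigma>\<in>PiE {0..<m} (\<lambda>_. S). \<Prod>i\<in>{0..<m}. exp (- \<bar>?z \<sigma> i\<bar>))"
      by (simp add: sum_distrib_left atLeast0LessThan)
    also have "\<dots> \<le> 3 ^ m * (\<Prod>i\<in>{0..<m}. G i)"
      using sum_prod_triangular_le[where Z = Z and w = "w t" and G = G, OF S G[OF _ t], of m 0]
      by (intro mult_left_mono) auto
    finally show ?thesis by (simp add: atLeast0LessThan)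
  qed
  define T where "T = {k \<in> {1..N}. 1 / P \<le> real k / N}"
  have "card (\<Union>k\<in>T. Bad (real k / N)) \<le> (\<Sum>k\<in>T. card (Bad (real k / N)))"
    by (rule card_UN_le) (simp add: T_def)
  then have "real (card (\<Union>k\<in>T. Bad (real k / N))) \<le> (\<Sum>k\<in>T. real (card (Bad (real k / N))))"
    by (simp flip: of_nat_sum)
  also have "\<dots> \<le> (\<Sum>k\<in>T. 3 ^ m * (\<Prod>i<m. G i))"
    by (intro sum_mono cardBad) (auto simp: T_def divide_le_eq)
  also have "\<dots> \<le> real N * (3 ^ m * (\<Prod>i<m. G i))"
  proof -
    have "card T \<le> card {1..N}" unfolding T_def by (intro card_mono) auto
    moreover have "0 \<le> (\<Prod>i<m. G i)" by (intro prod_nonneg) (auto simp: G_def)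
    ultimately show ?thesis by (simp add: mult_right_mono)
  qed
  also have "\<dots> < real (M ^ m)"
  proof -
    have "(\<Prod>i<m. G i) = (72 * real M * R / sqrt m) ^ m / (\<Prod>i<m. \<bar>A i i\<bar>)"
    proof -
      have "G i = (72 * real M * R / sqrt m) / \<bar>A i i\<bar>" for i
        using R by (simp add: G_def b_def abs_mult)
      then have "(\<Prod>i<m. G i) = (\<Prod>i<m. (72 * real M * R / sqrt m) / \<bar>A i i\<bar>)" by simp
      then show ?thesis by (simp only: prod_dividef prod_constant card_lessThan power_divide)
    qed
    moreover have pos: "(\<Prod>i<m. \<bar>A i i\<bar>) > 0" using diag by (intro prod_pos) auto
    moreover have "real N * (3 ^ m * (72 * real M * R / sqrt m) ^ m) = real N * (216 * R / sqrt m) ^ m * M ^ m"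
    proof -
      have e: "3 * (72 * real M * R / sqrt m) = (216 * R / sqrt m) * real M" by simp
      have "3 ^ m * (72 * real M * R / sqrt m) ^ m = (216 * R / sqrt m) ^ m * real M ^ m"
        by (simp only: power_mult_distrib[symmetric] e)
      then show ?thesis by (simp only: mult.assoc of_nat_power)
    qed
    moreover have "real N * (216 * R / sqrt m) ^ m * M ^ m < (\<Prod>i<m. \<bar>A i i\<bar>) * M ^ m"
      using small M by (intro mult_strict_right_mono) auto
    ultimately have "real N * (3 ^ m * (72 * real M * R / sqrt m) ^ m) < real M ^ m * (\<Prod>i<m. \<bar>A i i\<bar>)"
      by (simp only: mult.commute of_nat_power)
    then have "real N * (3 ^ m * (72 * real M * R / sqrt m) ^ m) / (\<Prod>i<m. \<bar>A i i\<bar>) < real M ^ m"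
      by (simp only: pos_divide_less_eq[OF pos])
    then show ?thesis
      unfolding \<open>(\<Prod>i<m. G i) = (72 * real M * R / sqrt m) ^ m / (\<Prod>i<m. \<bar>A i i\<bar>)\<close> by simp
  qed
  finally have less: "card (\<Union>k\<in>T. Bad (real k / N)) < card Y" using Y by simp
  have "\<not> Y \<subseteq> (\<Union>k\<in>T. Bad (real k / N))"
  proof
    assume "Y \<subseteq> (\<Union>k\<in>T. Bad (real k / N))"
    moreover have "finite (\<Union>k\<in>T. Bad (real k / N))"
    proof -
      have "finite (PiE {..<m} (\<lambda>_. S))" using S by (intro finite_PiE) auto
      then have "finite (Bad t)" for t unfolding Bad_def by (intro finite_imageI) auto
      then show ?thesis by (auto simp: T_def)
    qed
    ultimately have "card Y \<le> card (\<Union>k\<in>T. Bad (real k / N))" by (intro card_mono)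
    then show False using less by simp
  qed
  then obtain y0 where y0: "y0 \<in> Y" "\<And>k. k \<in> T \<Longrightarrow> y0 \<notin> Bad (real k / N)" by blast
  \<comment> \<open>The value 0 beyond the first m coordinates makes the bounds hold for all
    j.\<close>
  define y where "y j = (if j < m then real (y0 j) * \<eta> else 0)" for j
  have "0 \<le> y j \<and> y j \<le> real P" for j
  proof (cases "j < m")
    case True
    then have "y0 j < M" using y0(1) by (auto simp: Y_def PiE_def Pi_def)
    then have "real (y0 j) * \<eta> \<le> real M * \<eta>" using \<eta>0 by (intro mult_right_mono) auto
    then show ?thesis using True \<eta>0 M by (simp add: y_def \<eta>_def)
  qed (simp add: y_def)
  moreover have "R\<^sup>2 < (\<Sum>i<m. (mv m A (\<lambda>j. real k / N * y j - n j) i)\<^sup>2)"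
    if k: "k \<in> {1..N}" "1 / P \<le> real k / N" and n: "\<forall>j. \<bar>n j\<bar> \<le> int P" for k and n :: "nat \<Rightarrow> int"
  proof (rule ccontr)
    assume neg: "\<not> ?thesis"
    define \<sigma> where "\<sigma> = (\<lambda>j\<in>{..<m}. (y0 j, n j))"
    have "\<sigma> \<in> PiE {..<m} (\<lambda>_. S)"
    proof (rule PiE_I)
      fix j assume "j \<in> {..<m}"
      then have "y0 j < M" using y0(1) by (auto simp: Y_def PiE_def Pi_def)
      then show "\<sigma> j \<in> S" using \<open>j \<in> {..<m}\<close> n[rule_format, of j] by (auto simp: \<sigma>_def S_def)
    qed (simp add: \<sigma>_def)
    moreover have "q (real k / N) \<sigma> = (\<Sum>i<m. (mv m A (\<lambda>j. real k / N * y j - n j) i)\<^sup>2)"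
      unfolding q_def by (intro sum.cong refl arg_cong[where f = "\<lambda>x. x\<^sup>2"] mv_cong)
        (simp add: \<sigma>_def w_def y_def)
    moreover have "y0 = (\<lambda>j\<in>{..<m}. fst (\<sigma> j))"
      using y0(1) by (auto simp: \<sigma>_def Y_def PiE_def extensional_def fun_eq_iff)
    ultimately have "y0 \<in> Bad (real k / N)"
      unfolding Bad_def using neg by (intro image_eqI[of _ _ \<sigma>]) auto
    then show False using y0(2)[of k] k by (simp add: T_def)
  qed
  ultimately show ?thesis by blast
qed

section \<open>Seminorms\<close>

lemma seminorm_add: "is_seminorm p \<Longrightarrow> p (x + y) \<le> p x + p y"
  and seminorm_scale: "is_seminorm p \<Longrightarrow> p (c *\<^sub>R x) = \<bar>c\<bar> * p x"
  by (auto simp: is_seminorm_def)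

lemma seminorm_diff: "is_seminorm p \<Longrightarrow> p (x - y) \<le> p x + p y"
  using seminorm_add[of p x "- y"] seminorm_minus[of p y] by simp

lemma seminorm_commute: "is_seminorm p \<Longrightarrow> p (x - y) = p (y - x)"
  using seminorm_minus[of p "x - y"] by simp

lemma seminorm_sum:
  assumes p: "is_seminorm p" and "finite I"
  shows "p (\<Sum>i\<in>I. f i) \<le> (\<Sum>i\<in>I. p (f i))"
  using assms(2)
proof (induction I rule: finite_induct)
  case (insert i I)
  then show ?case using seminorm_add[of p "f i" "\<Sum>i\<in>I. f i"] p by simp
qed (simp add: seminorm_zero[OF p])

section \<open>The Hahn-Banach theorem\<close>

text \<open>One-dimensional extension for a functional given by its graph. The admissible values at
  \<open>x0\<close> lie between all numbers s - p (y - x0) and all numbers p (z + x0) - t; the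
  supremum of the former is taken.\<close>

lemma hahn_banach_step:
  fixes p :: "'a::real_vector \<Rightarrow> real" and H :: "('a \<times> real) set"
  assumes p: "is_seminorm p" and H: "subspace H" and le: "\<And>x r. (x, r) \<in> H \<Longrightarrow> r \<le> p x"
  shows "\<exists>c. \<forall>x r. (x, r) \<in> span (insert (x0, c) H) \<longrightarrow> r \<le> p x"
proof -
  let ?D = "{s - p (y - x0) | y s. (y, s) \<in> H}"
  have key: "s - p (y - x0) \<le> p (z + x0) - t" if "(y, s) \<in> H" "(z, t) \<in> H" for y s z t
  proof -
    have "(y + z, s + t) \<in> H" using subspace_add[OF H that] by simp
    then have "s + t \<le> p ((y - x0) + (z + x0))" using le by fastforce
    also have "\<dots> \<le> p (y - x0) + p (z + x0)" by (rule seminorm_add[OF p])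
    finally show ?thesis by simp
  qed
  have H0: "(0, 0) \<in> H" using subspace_0[OF H] by (simp add: zero_prod_def)
  have bdd: "bdd_above ?D" using key[OF _ H0] by (intro bdd_aboveI[of _ "p x0"]) auto
  define c where "c = Sup ?D"
  have lower: "s - p (y - x0) \<le> c" if "(y, s) \<in> H" for y s
    unfolding c_def by (rule cSup_upper[OF _ bdd]) (use that in blast)
  have upper: "c \<le> p (z + x0) - t" if "(z, t) \<in> H" for z t
    unfolding c_def by (rule cSup_least) (use H0 key that in auto)
  have "r \<le> p x" if "(x, r) \<in> span (insert (x0, c) H)" for x r
  proof -
    obtain a where "(x, r) - a *\<^sub>R (x0, c) \<in> span H" using \<open>(x, r) \<in> _\<close> by (auto simp: span_insert)
    moreover have "span H = H" using H by (simp add: span_eq_iff)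
    ultimately have h: "(x - a *\<^sub>R x0, r - a * c) \<in> H" by simp
    have scaled: "(b *\<^sub>R (x - a *\<^sub>R x0), b * (r - a * c)) \<in> H" for b
      using subspace_scale[OF H h, of b] by simp
    consider "a = 0" | "a > 0" | "a < 0" by linarith
    then show ?thesis
    proof cases
      case 1
      then show ?thesis using h le by force
    next
      case 2
      have "inverse a *\<^sub>R (x - a *\<^sub>R x0) + x0 = inverse a *\<^sub>R x" using 2 by (simp add: algebra_simps)
      then have "c \<le> inverse a * p x - inverse a * (r - a * c)"
        using upper[OF scaled[of "inverse a"]] 2 by (simp add: seminorm_scale[OF p])
      then have "a * c \<le> a * (inverse a * p x - inverse a * (r - a * c))" using 2 by (intro mult_left_mono) auto
      then show ?thesis using 2 by (simp add: field_simps)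
    next
      case 3
      have "inverse (- a) *\<^sub>R (x - a *\<^sub>R x0) - x0 = inverse (- a) *\<^sub>R x" using 3 by (simp add: algebra_simps)
      then have "inverse (- a) * (r - a * c) - inverse (- a) * p x \<le> c"
        using lower[OF scaled[of "inverse (- a)"]] 3 by (simp only: seminorm_scale[OF p]) simp
      then have "(- a) * (inverse (- a) * (r - a * c) - inverse (- a) * p x) \<le> (- a) * c" using 3 by (intro mult_left_mono) auto
      then show ?thesis using 3 by (simp add: field_simps)
    qed
  qed
  then show ?thesis by blast
qed

text \<open>Graphs turn extension into inclusion, as suits Zorn's lemma. Domination by p makes a
  graph single-valued: if it contains (0, r), then both r and -r are at most p 0 = 0.\<close>

lemma hahn_banach_graph:
  fixes p :: "'a::real_vector \<Rightarrow> real" and G :: "('a \<times> real) set"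
  assumes p: "is_seminorm p" and G: "subspace G" and le: "\<And>x r. (x, r) \<in> G \<Longrightarrow> r \<le> p x"
  shows "\<exists>f. linear f \<and> (\<forall>x. \<bar>f x\<bar> \<le> p x) \<and> (\<forall>x r. (x, r) \<in> G \<longrightarrow> f x = r)"
proof -
  define \<A> where "\<A> = {H. subspace H \<and> G \<subseteq> H \<and> (\<forall>x r. (x, r) \<in> H \<longrightarrow> r \<le> p x)}"
  have "\<exists>M\<in>\<A>. \<forall>X\<in>\<A>. M \<subseteq> X \<longrightarrow> X = M"
  proof (rule subset_Zorn_nonempty)
    show "\<A> \<noteq> {}" using G le by (auto simp: \<A>_def)
    fix C assume C: "C \<noteq> {}" "subset.chain \<A> C"
    then have sub: "\<And>H. H \<in> C \<Longrightarrow> subspace H" "\<And>H. H \<in> C \<Longrightarrow> G \<subseteq> H"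
      "\<And>H x r. H \<in> C \<Longrightarrow> (x, r) \<in> H \<Longrightarrow> r \<le> p x"
      by (auto simp: \<A>_def subset.chain_def)
    have "subspace (\<Union>C)"
    proof (rule subspaceI)
      show "0 \<in> \<Union>C" using C(1) sub(1) subspace_0 by blast
      fix x y assume "x \<in> \<Union>C" "y \<in> \<Union>C"
      then obtain H K where HK: "H \<in> C" "x \<in> H" "K \<in> C" "y \<in> K" by blast
      then have "H \<subseteq> K \<or> K \<subseteq> H" using C(2) by (auto simp: subset.chain_def)
      then show "x + y \<in> \<Union>C" using HK sub(1) subspace_add by blast
    next
      fix c x assume "x \<in> \<Union>C"
      then show "c *\<^sub>R x \<in> \<Union>C" using sub(1) subspace_scale by blast
    qed
    moreover have "G \<subseteq> \<Union>C" using C(1) sub(2) by blast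
    ultimately show "\<Union>C \<in> \<A>" using sub(3) by (auto simp: \<A>_def)
  qed
  then obtain H where H: "subspace H" "G \<subseteq> H" "\<And>x r. (x, r) \<in> H \<Longrightarrow> r \<le> p x"
    and max: "\<And>X. X \<in> \<A> \<Longrightarrow> H \<subseteq> X \<Longrightarrow> X = H" by (auto simp: \<A>_def)
  have single: "r = r'" if "(x, r) \<in> H" "(x, r') \<in> H" for x r r'
    using H(3)[of 0 "r - r'"] H(3)[of 0 "r' - r"] subspace_diff[OF H(1) that]
      subspace_diff[OF H(1) that(2,1)] by (simp add: seminorm_zero[OF p])
  have total: "\<exists>r. (x, r) \<in> H" for x
  proof -
    obtain c where c: "\<And>y r. (y, r) \<in> span (insert (x, c) H) \<Longrightarrow> r \<le> p y"
      using hahn_banach_step[OF p H(1,3)] by blast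
    have "span (insert (x, c) H) \<in> \<A>"
      unfolding \<A>_def using H(2) c span_superset[of "insert (x, c) H"] by auto
    then have "span (insert (x, c) H) = H"
      by (rule max) (use span_superset[of "insert (x, c) H"] in auto)
    then show ?thesis using span_base[of "(x, c)" "insert (x, c) H"] by auto
  qed
  define f where "f x = (THE r. (x, r) \<in> H)" for x
  have fI: "f x = r" if "(x, r) \<in> H" for x r
    unfolding f_def using that single by blast
  have fH: "(x, f x) \<in> H" for x using total[of x] fI by auto
  have "linear f"
  proof (rule linearI)
    show "f (x + y) = f x + f y" for x y
      using subspace_add[OF H(1) fH[of x] fH[of y]] by (simp add: fI)
    show "f (c *\<^sub>R x) = c *\<^sub>R f x" for c x
      using subspace_scale[OF H(1) fH[of x], of c] by (simp add: fI)
  qed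
  moreover have "\<bar>f x\<bar> \<le> p x" for x
    using H(3)[OF fH[of x]] H(3)[OF fH[of "- x"]] linear_neg[OF \<open>linear f\<close>, of x] seminorm_minus[OF p, of x]
    by simp
  moreover have "f x = r" if "(x, r) \<in> G" for x r using that H(2) fI by blast
  ultimately show ?thesis by blast
qed

text \<open>The inequality on coefficient vectors makes the prescribed values consistent even for
  dependent \<open>b j\<close>: at a vanishing combination it bounds \<Sum> \<gamma> j c j and its
  negative by 0. The prescription is therefore a dominated graph, to which Hahn-Banach
  applies.\<close>

lemma functional_with_values:
  fixes p :: "'a::real_vector \<Rightarrow> real" and m :: nat
  assumes p: "is_seminorm p" and le: "\<And>c. (\<Sum>j<m. \<gamma> j * c j) \<le> p (\<Sum>j<m. c j *\<^sub>R b j)"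
  shows "\<exists>f. linear f \<and> (\<forall>x. \<bar>f x\<bar> \<le> p x) \<and> (\<forall>j<m. f (b j) = \<gamma> j)"
proof -
  let ?G = "{(\<Sum>j<m. c j *\<^sub>R b j, \<Sum>j<m. \<gamma> j * c j) | c :: nat \<Rightarrow> real. True}"
  have "subspace ?G"
  proof (rule subspaceI)
    show "0 \<in> ?G" by (auto simp: zero_prod_def intro!: exI[of _ "\<lambda>_. 0"])
    fix x y assume "x \<in> ?G" "y \<in> ?G"
    then obtain c d where "x = (\<Sum>j<m. c j *\<^sub>R b j, \<Sum>j<m. \<gamma> j * c j)"
      "y = (\<Sum>j<m. d j *\<^sub>R b j, \<Sum>j<m. \<gamma> j * d j)" by auto
    then show "x + y \<in> ?G"
      by (auto intro!: exI[of _ "\<lambda>j. c j + d j"] simp: scaleR_add_left sum.distrib distrib_left)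
  next
    fix r x assume "x \<in> ?G"
    then obtain c where "x = (\<Sum>j<m. c j *\<^sub>R b j, \<Sum>j<m. \<gamma> j * c j)" by auto
    then show "r *\<^sub>R x \<in> ?G"
      by (auto intro!: exI[of _ "\<lambda>j. r * c j"] simp: scaleR_sum_right sum_distrib_left ac_simps)
  qed
  then obtain f where f: "linear f" "\<forall>x. \<bar>f x\<bar> \<le> p x" "\<And>x r. (x, r) \<in> ?G \<Longrightarrow> f x = r"
    using hahn_banach_graph[OF p, of ?G] le by blast
  have "f (b j) = \<gamma> j" if "j < m" for j
  proof (rule f(3))
    have "(\<Sum>i<m. (if i = j then 1 else 0) *\<^sub>R b i) = b j" "(\<Sum>i<m. \<gamma> i * (if i = j then 1 else 0)) = \<gamma> j"
      using that by (auto simp: if_distrib[of "\<lambda>x. x *\<^sub>R _"] if_distrib[of "\<lambda>x. _ * x"] cong: if_cong)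
    then show "(b j, \<gamma> j) \<in> ?G" 
      unfolding mem_Collect_eq by (intro exI[of _ "\<lambda>i. if i = j then 1 else 0"]) simp
  qed
  then show ?thesis using f(1,2) by blast
qed

section \<open>Distance to a subspace\<close>

text \<open>The quotient seminorm of p modulo span Z, as a function on the whole space. Subspaces
  are given by generating sets so that \<open>card Z\<close> bounds the dimension in statements
  about Kolmogorov numbers.\<close>

definition sdist :: "('a::real_vector \<Rightarrow> real) \<Rightarrow> 'a set \<Rightarrow> 'a \<Rightarrow> real" where
  "sdist p Z x = (INF z\<in>span Z. p (x - z))"

lemma sdist_le:
  assumes "is_seminorm p" "z \<in> span Z"
  shows "sdist p Z x \<le> p (x - z)"
  unfolding sdist_def
  by (rule cINF_lower[OF _ assms(2)]) (auto intro!: bdd_belowI[of _ 0] seminorm_nonneg[OF assms(1)])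

lemma sdist_greatest:
  assumes "\<And>z. z \<in> span Z \<Longrightarrow> c \<le> p (x - z)"
  shows "c \<le> sdist p Z x"
  unfolding sdist_def by (rule cINF_greatest) (use assms span_zero in auto)

lemma sdist_lessD: "sdist p Z x < e \<Longrightarrow> \<exists>z\<in>span Z. p (x - z) < e"
  using sdist_greatest[of Z e p x] by force

lemma sdist_le_seminorm: "is_seminorm p \<Longrightarrow> sdist p Z x \<le> p x"
  using sdist_le[of p 0 Z x] by (simp add: span_zero)

lemma sdist_nonneg: "is_seminorm p \<Longrightarrow> 0 \<le> sdist p Z x"
  by (rule sdist_greatest) (rule seminorm_nonneg)

lemma sdist_span: "is_seminorm p \<Longrightarrow> z \<in> span Z \<Longrightarrow> sdist p Z z = 0"
  using sdist_le[of p z Z z] sdist_nonneg[of p Z z] by (simp add: seminorm_zero)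

lemma sdist_mono:
  assumes p: "is_seminorm p" and ZY: "Z \<subseteq> Y"
  shows "sdist p Y x \<le> sdist p Z x"
  by (rule sdist_greatest) (use sdist_le[OF p] span_mono[OF ZY] in blast)

lemma is_seminorm_sdist:
  assumes p: "is_seminorm p"
  shows "is_seminorm (sdist p Z)"
proof -
  have add: "sdist p Z (x + y) \<le> sdist p Z x + sdist p Z y" for x y
  proof (rule field_le_epsilon)
    fix e :: real assume "e > 0"
    then obtain z w where z: "z \<in> span Z" "p (x - z) < sdist p Z x + e / 2"
      and w: "w \<in> span Z" "p (y - w) < sdist p Z y + e / 2"
      using sdist_lessD[of p Z x "sdist p Z x + e / 2"] sdist_lessD[of p Z y "sdist p Z y + e / 2"] by auto
    have "sdist p Z (x + y) \<le> p (x + y - (z + w))"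
      by (rule sdist_le[OF p span_add[OF z(1) w(1)]])
    also have "x + y - (z + w) = (x - z) + (y - w)" by simp
    also have "p \<dots> \<le> p (x - z) + p (y - w)" by (rule seminorm_add[OF p])
    finally show "sdist p Z (x + y) \<le> sdist p Z x + sdist p Z y + e" using z w by simp
  qed
  have le: "sdist p Z (c *\<^sub>R x) \<le> \<bar>c\<bar> * sdist p Z x" if "c \<noteq> 0" for c x
  proof -
    have "inverse \<bar>c\<bar> * sdist p Z (c *\<^sub>R x) \<le> sdist p Z x"
    proof (rule sdist_greatest)
      fix z assume "z \<in> span Z"
      then have "sdist p Z (c *\<^sub>R x) \<le> p (c *\<^sub>R x - c *\<^sub>R z)" by (intro sdist_le[OF p] span_scale)
      also have "\<dots> = \<bar>c\<bar> * p (x - z)" using seminorm_scale[OF p, of c "x - z"] by (simp add: scaleR_diff_right)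
      finally show "inverse \<bar>c\<bar> * sdist p Z (c *\<^sub>R x) \<le> p (x - z)" using that by (simp add: field_simps)
    qed
    then show ?thesis using that by (simp add: field_simps)
  qed
  have "sdist p Z (c *\<^sub>R x) = \<bar>c\<bar> * sdist p Z x" for c x
  proof (cases "c = 0")
    case True
    then show ?thesis using sdist_span[OF p span_zero] by simp
  next
    case False
    have "sdist p Z (inverse c *\<^sub>R (c *\<^sub>R x)) \<le> \<bar>inverse c\<bar> * sdist p Z (c *\<^sub>R x)"
      by (rule le) (use False in simp)
    then have "\<bar>c\<bar> * sdist p Z x \<le> sdist p Z (c *\<^sub>R x)" using False by (simp add: field_simps)
    then show ?thesis using le[OF False, of x] by simp
  qed
  with add show ?thesis by (simp add: is_seminorm_def)
qed

text \<open>Hahn-Banach for the quotient seminorm. Domination by \<open>sdist p Z\<close> is kept in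
  the conclusion because it contains both that the functional vanishes on span Z and that it stays
  below p.\<close>

lemma functional_attaining_sdist:
  assumes p: "is_seminorm p"
  shows "\<exists>f. linear f \<and> (\<forall>y. \<bar>f y\<bar> \<le> sdist p Z y) \<and> f x = sdist p Z x"
proof -
  have "\<exists>f. linear f \<and> (\<forall>y. \<bar>f y\<bar> \<le> sdist p Z y) \<and> (\<forall>j<1 :: nat. f x = sdist p Z x)"
  proof (rule functional_with_values[OF is_seminorm_sdist[OF p], where b = "\<lambda>_::nat. x" and m = 1])
    fix c :: "nat \<Rightarrow> real"
    have "sdist p Z x * c 0 \<le> \<bar>c 0\<bar> * sdist p Z x"
      using mult_right_mono[OF abs_ge_self[of "c 0"] sdist_nonneg[OF p, of Z x]] by (simp add: mult.commute)
    then show "(\<Sum>j<1. sdist p Z x * c j) \<le> sdist p Z (\<Sum>j<1. c j *\<^sub>R x)"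
      by (simp add: seminorm_scale[OF is_seminorm_sdist[OF p]])
  qed
  then show ?thesis by auto
qed

text \<open>Mazur's lemma from the construction of basic sequences: vectors annihilated by finitely
  many functionals stand at a positive angle to span W. A new generator w calls for a new functional
  only if its distance to span W is positive; a functional that vanishes on span W and not at w then
  reads off the coefficient of w in v + g.\<close>

lemma mazur_finite_codimension:
  assumes p: "is_seminorm p" and W: "finite W"
  shows "\<exists>\<Omega> \<kappa>. finite \<Omega> \<and> (\<forall>\<omega>\<in>\<Omega>. linear \<omega> \<and> (\<forall>x. \<bar>\<omega> x\<bar> \<le> p x)) \<and> \<kappa> > 0 \<and>
    (\<forall>v g. v \<in> span W \<longrightarrow> (\<forall>\<omega>\<in>\<Omega>. \<omega> g = 0) \<longrightarrow> p g \<le> \<kappa> * p (v + g))"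
  using W
proof (induction W rule: finite_induct)
  case empty
  show ?case by (rule exI[of _ "{}"], rule exI[of _ 1]) auto
next
  case (insert w W)
  then obtain \<Omega> \<kappa> where \<Omega>: "finite \<Omega>" "\<forall>\<omega>\<in>\<Omega>. linear \<omega> \<and> (\<forall>x. \<bar>\<omega> x\<bar> \<le> p x)" and \<kappa>: "\<kappa> > 0"
    "\<And>v g. v \<in> span W \<Longrightarrow> (\<forall>\<omega>\<in>\<Omega>. \<omega> g = 0) \<Longrightarrow> p g \<le> \<kappa> * p (v + g)" by blast
  have dec: "\<exists>s v'. v = v' + s *\<^sub>R w \<and> v' \<in> span W" if "v \<in> span (insert w W)" for v
    using that by (auto simp: span_insert) (metis diff_add_cancel)
  show ?case
  proof (cases "sdist p W w = 0")
    \<comment> \<open>Distance 0 does not put w into span W. The multiple of w is replaced by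
      multiples of approximants from span W, at the cost of an arbitrarily small error.\<close>
    case True
    have "p g \<le> \<kappa> * p (v + g)" if v: "v \<in> span (insert w W)" and g: "\<forall>\<omega>\<in>\<Omega>. \<omega> g = 0" for v g
    proof -
      obtain s v' where v': "v = v' + s *\<^sub>R w" "v' \<in> span W" using dec[OF v] by blast
      show ?thesis
      proof (rule field_le_epsilon)
        fix e :: real assume e: "e > 0"
        define d where "d = e / (\<kappa> * (\<bar>s\<bar> + 1))"
        have d: "d > 0" using e \<kappa>(1) by (simp add: d_def)
        obtain z where z: "z \<in> span W" "p (w - z) < d" using sdist_lessD[of p W w d] True d by auto
        have "p g \<le> \<kappa> * p ((v' + s *\<^sub>R z) + g)"
          using v'(2) z(1) g by (intro \<kappa>(2) span_add span_scale) auto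
        also have "(v' + s *\<^sub>R z) + g = (v + g) - s *\<^sub>R (w - z)" using v' by (simp add: algebra_simps)
        also have "p \<dots> \<le> p (v + g) + \<bar>s\<bar> * p (w - z)"
          using seminorm_diff[OF p, of "v + g" "s *\<^sub>R (w - z)"] by (simp add: seminorm_scale[OF p])
        also have "\<dots> \<le> p (v + g) + (\<bar>s\<bar> + 1) * d"
          using z(2) d seminorm_nonneg[OF p, of "w - z"] by (intro add_left_mono mult_mono) auto
        also have "(\<bar>s\<bar> + 1) * d = e / \<kappa>" by (simp add: d_def add_nonneg_eq_0_iff)
        finally show "p g \<le> \<kappa> * p (v + g) + e" using \<kappa>(1) by (simp add: algebra_simps)
      qed
    qed
    then show ?thesis using \<Omega> \<kappa>(1) by blast
  next
    case False
    define n where "n = sdist p W w"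
    have n: "n > 0" using False sdist_nonneg[OF p, of W w] by (simp add: n_def)
    obtain f where f: "linear f" "\<And>y. \<bar>f y\<bar> \<le> sdist p W y" "f w = n"
      using functional_attaining_sdist[OF p, of W w] by (auto simp: n_def)
    have fp: "\<bar>f y\<bar> \<le> p y" for y using f(2)[of y] sdist_le_seminorm[OF p, of W y] by simp
    have fW: "f v = 0" if "v \<in> span W" for v using f(2)[of v] sdist_span[OF p that] by simp
    \<comment> \<open>The coefficient s of w satisfies |s| <= p (v + g) / n, so removing s w costs
      at most the factor 1 + p w / n.\<close>
    define \<kappa>' where "\<kappa>' = \<kappa> * (1 + p w / n)"
    have "p g \<le> \<kappa>' * p (v + g)" if v: "v \<in> span (insert w W)" and g: "\<forall>\<omega>\<in>insert f \<Omega>. \<omega> g = 0" for v g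
    proof -
      obtain s v' where v': "v = v' + s *\<^sub>R w" "v' \<in> span W" using dec[OF v] by blast
      have "f (v + g) = s * n" using g v' fW by (simp add: linear_add[OF f(1)] linear_scale[OF f(1)] f(3))
      then have s: "\<bar>s\<bar> \<le> p (v + g) / n" using fp[of "v + g"] n by (simp add: abs_mult field_simps)
      have "p g \<le> \<kappa> * p (v' + g)" using v' g by (intro \<kappa>(2)) auto
      also have "v' + g = (v + g) - s *\<^sub>R w" using v' by simp
      also have "p \<dots> \<le> p (v + g) + \<bar>s\<bar> * p w"
        using seminorm_diff[OF p, of "v + g" "s *\<^sub>R w"] by (simp add: seminorm_scale[OF p])
      also have "\<dots> \<le> p (v + g) + p (v + g) / n * p w"
        using s seminorm_nonneg[OF p] by (intro add_left_mono mult_right_mono) auto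
      finally show ?thesis using \<kappa>(1) by (simp add: \<kappa>'_def algebra_simps)
    qed
    moreover have "\<kappa>' > 0" using \<kappa>(1) n seminorm_nonneg[OF p, of w]
      by (auto simp: \<kappa>'_def intro!: mult_pos_pos add_pos_nonneg)
    moreover have "\<forall>\<omega>\<in>insert f \<Omega>. linear \<omega> \<and> (\<forall>x. \<bar>\<omega> x\<bar> \<le> p x)" using \<Omega> f(1) fp by auto
    ultimately show ?thesis using \<Omega>(1) by (intro exI[of _ "insert f \<Omega>"] exI[of _ \<kappa>']) blast
  qed
qed

section \<open>Continuous seminorms\<close>

lemma seminorm_in_cs:
  fixes p :: "'a::locally_convex_space \<Rightarrow> real"
  assumes p: "is_seminorm p" and U: "zero_nhd U" "\<And>x. x \<in> U \<Longrightarrow> p x \<le> 1"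
  shows "p \<in> cs"
proof -
  have "(p \<longlongrightarrow> p x) (at x)" for x
  proof (rule tendstoI)
    fix e :: real assume e: "e > 0"
    define d where "d = 2 / e"
    have d: "d > 0" using e by (simp add: d_def)
    have "((\<lambda>y. y - x) \<longlongrightarrow> x - x) (at x)" by (intro tendsto_intros)
    then have "filterlim (\<lambda>y. (d, y - x)) (nhds d \<times>\<^sub>F nhds 0) (at x)"
      by (intro filterlim_Pair) auto
    from filterlim_compose[OF tendsto_scaleR_nhds[of d 0] this]
    have "((\<lambda>y. d *\<^sub>R (y - x)) \<longlongrightarrow> 0) (at x)" by simp
    then have "eventually (\<lambda>y. d *\<^sub>R (y - x) \<in> interior U) (at x)"
      using U(1) unfolding zero_nhd_def by (rule topological_tendstoD[OF _ open_interior])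
    then show "eventually (\<lambda>y. dist (p y) (p x) < e) (at x)"
    proof (rule eventually_mono)
      fix y assume "d *\<^sub>R (y - x) \<in> interior U"
      then have "p (d *\<^sub>R (y - x)) \<le> 1" using U(2) interior_subset by blast
      then have "d * p (y - x) \<le> 1" using d by (simp add: seminorm_scale[OF p])
      then have "p (y - x) \<le> e / 2" using e by (simp add: d_def field_simps)
      moreover have "p y \<le> p (y - x) + p x" "p x \<le> p (x - y) + p y"
        using seminorm_add[OF p, of "y - x" x] seminorm_add[OF p, of "x - y" y] by auto
      ultimately show "dist (p y) (p x) < e"
        using e seminorm_commute[OF p, of x y] by (simp add: dist_real_def abs_if)
    qed
  qed
  then show ?thesis using p by (simp add: cs_def continuous_on_def)
qed

lemma csD: "p \<in> cs \<Longrightarrow> is_seminorm p" "p \<in> cs \<Longrightarrow> continuous_on UNIV p"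
  by (auto simp: cs_def)

lemma cs_ball:
  fixes p :: "'a::locally_convex_space \<Rightarrow> real"
  assumes p: "p \<in> cs" and e: "e > 0"
  shows "open {x. p x < e}" "zero_nhd {x. p x < e}"
proof -
  show o: "open {x. p x < e}"
    by (rule open_Collect_less[OF csD(2)[OF p] continuous_on_const])
  then show "zero_nhd {x. p x < e}"
    using e by (simp add: zero_nhd_def interior_open seminorm_zero[OF csD(1)[OF p]])
qed

lemma zero_nhd_absorbing:
  fixes U :: "'a::locally_convex_space set"
  assumes "zero_nhd U"
  shows "\<exists>t>0. x \<in> (\<lambda>y. t *\<^sub>R y) ` U"
proof -
  have "filterlim (\<lambda>c. (c, x)) (nhds 0 \<times>\<^sub>F nhds x) (at (0::real))"
    by (intro filterlim_Pair) (auto intro: tendsto_ident_at)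
  from filterlim_compose[OF tendsto_scaleR_nhds[of 0 x] this]
  have "((\<lambda>c. c *\<^sub>R x) \<longlongrightarrow> 0) (at (0::real))" by simp
  then have "eventually (\<lambda>c. c *\<^sub>R x \<in> interior U) (at (0::real))"
    using assms unfolding zero_nhd_def by (rule topological_tendstoD[OF _ open_interior])
  then obtain d where d: "d > 0" "\<And>c. c \<noteq> 0 \<Longrightarrow> dist c 0 < d \<Longrightarrow> c *\<^sub>R x \<in> interior U"
    unfolding eventually_at by auto
  have "(d / 2) *\<^sub>R x \<in> U" using d(2)[of "d / 2"] d(1) interior_subset by auto
  then have "x \<in> (\<lambda>y. (2 / d) *\<^sub>R y) ` U" using d(1) by (intro image_eqI[of _ _ "(d / 2) *\<^sub>R x"]) auto
  then show ?thesis using d(1) by (intro exI[of _ "2 / d"]) auto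
qed

lemma is_seminorm_gauge:
  assumes B: "absconvex B" and span: "span B = UNIV"
  shows "is_seminorm (minkowski_gauge B)"
  using gauge_add[OF B] gauge_scale[OF B] span by (simp add: is_seminorm_def)

lemma absconvex_mono:
  assumes B: "absconvex B" and t: "0 < t" "t \<le> s" and x: "x \<in> (\<lambda>y. t *\<^sub>R y) ` B"
  shows "x \<in> (\<lambda>y. s *\<^sub>R y) ` B"
proof -
  obtain b where b: "b \<in> B" "x = t *\<^sub>R b" using x by blast
  have "(t / s) *\<^sub>R b \<in> B" using t b by (intro absconvex_scale[OF B]) auto
  then show ?thesis using b t by (intro image_eqI[of _ _ "(t / s) *\<^sub>R b"]) auto
qed

text \<open>The gauge of the symmetrized convex neighbourhood V \<inter> -V. This set is absolutely
  convex because a x + b y is a convex combination of sgn a x, sgn b y and 0.\<close>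

lemma cs_base:
  fixes U :: "'a::locally_convex_space set"
  assumes "zero_nhd U"
  shows "\<exists>p\<in>cs. {x. p x < 1} \<subseteq> U"
proof -
  obtain V where V: "open V" "0 \<in> V" "V \<subseteq> interior U" "convex V"
    using convex_zero_nhd[of "interior U"] assms by (auto simp: zero_nhd_def)
  define D where "D = V \<inter> uminus -` V"
  have "open (uminus -` V)"
    by (rule open_vimage[OF V(1)]) (intro continuous_intros)
  then have "open D" using V(1) by (auto simp: D_def)
  moreover have "0 \<in> D" using V(2) by (simp add: D_def)
  ultimately have nhd: "zero_nhd D" by (simp add: zero_nhd_def interior_open)
  have seg: "a *\<^sub>R x + b *\<^sub>R y \<in> V" if "x \<in> D" "y \<in> D" "\<bar>a\<bar> + \<bar>b\<bar> \<le> 1" for x y a b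
  proof -
    have "sgn a *\<^sub>R x \<in> V" "sgn b *\<^sub>R y \<in> V" using that V(2) by (auto simp: D_def sgn_if)
    then have "\<bar>a\<bar> *\<^sub>R (sgn a *\<^sub>R x) + (\<bar>b\<bar> *\<^sub>R (sgn b *\<^sub>R y) + (1 - \<bar>a\<bar> - \<bar>b\<bar>) *\<^sub>R 0) \<in> V"
    \<comment> \<open>The three-point combination is composed of two two-point ones, the inner one
      normalized by 1 - |a|; hence the separate case.\<close>
    proof (cases "\<bar>a\<bar> = 1")
      case True
      then show ?thesis using that(3) \<open>sgn a *\<^sub>R x \<in> V\<close> by simp
    next
      case False
      then have a: "\<bar>a\<bar> < 1" using that(3) by simp
      define w where "w = (\<bar>b\<bar> / (1 - \<bar>a\<bar>)) *\<^sub>R (sgn b *\<^sub>R y) + ((1 - \<bar>a\<bar> - \<bar>b\<bar>) / (1 - \<bar>a\<bar>)) *\<^sub>R 0"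
      have "w \<in> V"
        unfolding w_def using a that(3) V(2) \<open>sgn b *\<^sub>R y \<in> V\<close>
        by (intro convexD[OF V(4)]) (auto simp: zero_le_divide_iff simp flip: add_divide_distrib)
      from convexD[OF V(4) \<open>sgn a *\<^sub>R x \<in> V\<close> this, of "\<bar>a\<bar>" "1 - \<bar>a\<bar>"] a
      have "\<bar>a\<bar> *\<^sub>R (sgn a *\<^sub>R x) + (1 - \<bar>a\<bar>) *\<^sub>R w \<in> V" by simp
      moreover have "(1 - \<bar>a\<bar>) *\<^sub>R w = \<bar>b\<bar> *\<^sub>R (sgn b *\<^sub>R y) + (1 - \<bar>a\<bar> - \<bar>b\<bar>) *\<^sub>R 0"
        using a by (simp add: w_def)
      ultimately show ?thesis by (simp only:)
    qed
    then show ?thesis by (simp add: abs_mult_sgn)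
  qed
  have D: "absconvex D"
    unfolding absconvex_def
  proof (intro conjI ballI allI impI)
    show "D \<noteq> {}" using V(2) by (auto simp: D_def)
    fix x y a b assume xy: "x \<in> D" "y \<in> D" "\<bar>a\<bar> + \<bar>b\<bar> \<le> (1 :: real)"
    have "- (a *\<^sub>R x + b *\<^sub>R y) = (- a) *\<^sub>R x + (- b) *\<^sub>R y" by simp
    then show "a *\<^sub>R x + b *\<^sub>R y \<in> D"
      using seg[OF xy] seg[OF xy(1,2), of "- a" "- b"] xy(3) by (simp add: D_def)
  qed
  have "x \<in> span D" for x
    using zero_nhd_absorbing[OF nhd, of x] by (auto intro: span_scale span_base)
  then have span: "span D = UNIV" by blast
  let ?p = "minkowski_gauge D"
  have "?p \<in> cs"
    by (rule seminorm_in_cs[OF is_seminorm_gauge[OF D span] nhd]) (auto intro!: gauge_le)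
  moreover have "{x. ?p x < 1} \<subseteq> U"
  proof
    fix x assume "x \<in> {x. ?p x < 1}"
    then obtain t where "t > 0" "t < 1" "x \<in> (\<lambda>y. t *\<^sub>R y) ` D"
      using gauge_lessD[OF D, of x 1] span by auto
    then have "x \<in> D" using absconvex_mono[OF D, of t 1 x] by auto
    then show "x \<in> U" using V(3) interior_subset by (auto simp: D_def)
  qed
  ultimately show ?thesis by blast
qed

lemma cs_separates:
  fixes x :: "'a::locally_convex_space"
  assumes "x \<noteq> 0"
  shows "\<exists>p\<in>cs. p x > 0"
proof -
  obtain U where U: "open U" "0 \<in> U" "x \<notin> U"
    using t1_space[of 0 x] assms by auto
  then obtain p where p: "p \<in> cs" "{x. p x < 1} \<subseteq> U"
    using cs_base[of U] by (auto simp: zero_nhd_def interior_open)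
  then have "1 \<le> p x" using U(3) by force
  then show ?thesis using p(1) by (intro bexI[of _ p]) auto
qed

lemma tendsto_of_cs:
  fixes s :: "nat \<Rightarrow> 'a::locally_convex_space"
  assumes "\<And>p. p \<in> cs \<Longrightarrow> (\<lambda>n. p (s n - l)) \<longlonglongrightarrow> 0"
  shows "s \<longlonglongrightarrow> l"
proof -
  have "(\<lambda>n. s n - l) \<longlonglongrightarrow> 0"
  proof (rule topological_tendstoI)
    fix U :: "'a set" assume "open U" "0 \<in> U"
    then obtain p where p: "p \<in> cs" "{x. p x < 1} \<subseteq> U"
      using cs_base[of U] by (auto simp: zero_nhd_def interior_open)
    have "eventually (\<lambda>n. p (s n - l) < 1) sequentially"
      using order_tendstoD(2)[OF assms[OF p(1)], of 1] by simp
    then show "eventually (\<lambda>n. s n - l \<in> U) sequentially"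
      by (rule eventually_mono) (use p(2) in auto)
  qed
  from tendsto_add[OF this tendsto_const[of l]] show ?thesis by simp
qed

section \<open>Bounded sets, gauges of discs and their extensions to the whole space\<close>

lemma cs_bounded_on:
  fixes B :: "'a::locally_convex_space set"
  assumes "tvs_bounded B" "p \<in> cs"
  shows "\<exists>K>0. \<forall>x\<in>B. p x \<le> K"
proof -
  obtain r where r: "r > 0" "\<And>t. r \<le> \<bar>t\<bar> \<Longrightarrow> B \<subseteq> (\<lambda>x. t *\<^sub>R x) ` {x. p x < 1}"
    using assms cs_ball(2)[OF assms(2), of 1] unfolding tvs_bounded_def absorbs_def by auto
  have "p x \<le> r" if "x \<in> B" for x
  proof -
    obtain y where "p y < 1" "x = r *\<^sub>R y" using r(2)[of r] r(1) \<open>x \<in> B\<close> by auto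
    then show ?thesis using r(1) by (simp add: seminorm_scale[OF csD(1)[OF assms(2)]])
  qed
  then show ?thesis using r(1) by blast
qed

lemma seminorm_le_gauge:
  assumes p: "is_seminorm p" and B: "absconvex B" and K: "\<And>x. x \<in> B \<Longrightarrow> p x \<le> K" and x: "x \<in> span B"
  shows "p x \<le> K * minkowski_gauge B x"
proof (rule field_le_epsilon)
  fix e :: real assume e: "e > 0"
  have K0: "0 \<le> K" using K[OF absconvex_zero[OF B]] by (simp add: seminorm_zero[OF p])
  define d where "d = e / (K + 1)"
  have d: "d > 0" using e K0 by (simp add: d_def)
  obtain t where t: "t > 0" "t < minkowski_gauge B x + d" "x \<in> (\<lambda>y. t *\<^sub>R y) ` B"
    using gauge_lessD[OF B x, of "minkowski_gauge B x + d"] d by auto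
  then obtain y where y: "y \<in> B" "x = t *\<^sub>R y" by blast
  have "p x = t * p y" using t y by (simp add: seminorm_scale[OF p])
  also have "\<dots> \<le> t * K" using t K[OF y(1)] by (intro mult_left_mono) auto
  also have "\<dots> \<le> (minkowski_gauge B x + d) * K" using t K0 by (intro mult_right_mono) auto
  also have "\<dots> \<le> K * minkowski_gauge B x + e" using e K0 by (simp add: d_def field_simps)
  finally show "p x \<le> K * minkowski_gauge B x + e" .
qed

lemma tendsto_of_gauge:
  fixes B :: "'a::locally_convex_space set"
  assumes B: "absconvex B" "tvs_bounded B" and s: "\<And>n. s n - l \<in> span B"
    and lim: "(\<lambda>n. minkowski_gauge B (s n - l)) \<longlonglongrightarrow> 0"
  shows "s \<longlonglongrightarrow> l"
proof (rule tendsto_of_cs)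
  fix p :: "'a \<Rightarrow> real" assume p: "p \<in> cs"
  obtain K where K: "\<And>x. x \<in> B \<Longrightarrow> p x \<le> K" using cs_bounded_on[OF B(2) p] by blast
  have "(\<lambda>n. K * minkowski_gauge B (s n - l)) \<longlonglongrightarrow> K * 0" by (intro tendsto_intros lim)
  then show "(\<lambda>n. p (s n - l)) \<longlonglongrightarrow> 0"
    using seminorm_le_gauge[OF csD(1)[OF p] B(1) K s] seminorm_nonneg[OF csD(1)[OF p]]
    by (intro tendsto_sandwich[of "\<lambda>_. 0" "\<lambda>n. p (s n - l)" _ "\<lambda>n. K * minkowski_gauge B (s n - l)"]) auto
qed

text \<open>The intersection of the closed balls {p <= K p} over all continuous seminorms, with K p
  a bound of p on B. It mediates between the (DF) condition, which speaks of arbitrary bounded sets,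
  and fundamental systems, which speak of closed discs.\<close>

lemma bounded_subset_disc:
  fixes B :: "'a::locally_convex_space set"
  assumes B: "tvs_bounded B"
  shows "\<exists>D\<in>bdd_discs. B \<subseteq> D"
proof -
  define K where "K p = (SOME K. K > 0 \<and> (\<forall>x\<in>B. p x \<le> K))" for p :: "'a \<Rightarrow> real"
  have K: "K p > 0" "\<And>x. x \<in> B \<Longrightarrow> p x \<le> K p" if "p \<in> cs" for p
    using someI_ex[of "\<lambda>K. K > 0 \<and> (\<forall>x\<in>B. p x \<le> K)"] cs_bounded_on[OF B that] unfolding K_def by blast+
  define D where "D = {x. \<forall>p\<in>cs. p x \<le> K p}"
  have "absconvex D"
    unfolding absconvex_def
  proof (intro conjI ballI allI impI)
    have "p 0 \<le> K p" if "p \<in> cs" for p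
      using K(1)[OF that] seminorm_zero[OF csD(1)[OF that]] by simp
    then have "0 \<in> D" by (simp add: D_def)
    then show "D \<noteq> {}" by blast
    fix x y a b assume xy: "x \<in> D" "y \<in> D" "\<bar>a\<bar> + \<bar>b\<bar> \<le> (1 :: real)"
    have "p (a *\<^sub>R x + b *\<^sub>R y) \<le> K p" if p: "p \<in> cs" for p
    proof -
      have "p (a *\<^sub>R x + b *\<^sub>R y) \<le> \<bar>a\<bar> * p x + \<bar>b\<bar> * p y"
        using seminorm_add[OF csD(1)[OF p], of "a *\<^sub>R x" "b *\<^sub>R y"] by (simp add: seminorm_scale[OF csD(1)[OF p]])
      also have "\<dots> \<le> \<bar>a\<bar> * K p + \<bar>b\<bar> * K p" using xy p by (intro add_mono mult_left_mono) (auto simp: D_def)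
      also have "\<dots> = (\<bar>a\<bar> + \<bar>b\<bar>) * K p" by (simp add: algebra_simps)
      also have "\<dots> \<le> 1 * K p" using xy(3) K(1)[OF p] by (intro mult_right_mono) auto
      finally show ?thesis by simp
    qed
    then show "a *\<^sub>R x + b *\<^sub>R y \<in> D" by (simp add: D_def)
  qed
  moreover have "closed D"
  proof -
    have "closed {x. p x \<le> K p}" if "p \<in> cs" for p
      by (rule closed_Collect_le[OF csD(2)[OF that] continuous_on_const])
    moreover have "D = (\<Inter>p\<in>cs. {x. p x \<le> K p})" by (auto simp: D_def)
    ultimately show ?thesis by auto
  qed
  moreover have "tvs_bounded D"
    unfolding tvs_bounded_def
  proof (intro allI impI)
    fix U :: "'a set" assume "zero_nhd U"
    then obtain p where p: "p \<in> cs" "{x. p x < 1} \<subseteq> U" using cs_base by blast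
    have "D \<subseteq> (\<lambda>x. t *\<^sub>R x) ` U" if t: "K p + 1 \<le> \<bar>t\<bar>" for t
    proof
      fix x assume "x \<in> D"
      then have "p x \<le> K p" using p(1) by (simp add: D_def)
      then have "p (inverse t *\<^sub>R x) < 1"
        using t K(1)[OF p(1)] by (simp add: seminorm_scale[OF csD(1)[OF p(1)]] field_simps abs_inverse)
      then have "inverse t *\<^sub>R x \<in> U" using p(2) by blast
      then show "x \<in> (\<lambda>x. t *\<^sub>R x) ` U"
        using t K(1)[OF p(1)] by (intro image_eqI[of _ _ "inverse t *\<^sub>R x"]) auto
    qed
    then show "absorbs U D" unfolding absorbs_def using K(1)[OF p(1)] by (intro exI[of _ "K p + 1"]) auto
  qed
  moreover have "B \<subseteq> D" using K(2) by (auto simp: D_def)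
  ultimately show ?thesis by (auto simp: bdd_discs_def)
qed

text \<open>The gauge of B is meaningful on span B only. A seminorm on the whole space makes
  Hahn-Banach, \<open>sdist\<close> and Mazur's lemma applicable to it; its values off span B are
  arbitrary, and no continuity is claimed.\<close>

definition gauge_ext :: "'a::real_vector set \<Rightarrow> 'a \<Rightarrow> real" where
  "gauge_ext B = (SOME s. is_seminorm s \<and> (\<forall>x\<in>span B. s x = minkowski_gauge B x))"

text \<open>The gauge composed with a linear projection of the whole space onto span B, which
  extends the identity on a basis of span B.\<close>

lemma gauge_ext_exists:
  fixes B :: "'a::real_vector set"
  assumes B: "absconvex B"
  shows "\<exists>s. is_seminorm s \<and> (\<forall>x\<in>span B. s x = minkowski_gauge B x)"
proof -
  obtain I where I: "I \<subseteq> B" "independent I" "span I = span B"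
    using basis_exists[of B] by (metis span_eq span_mono span_span subset_antisym)
  obtain g where g: "linear g" "\<forall>x\<in>I. g x = x" "range g = span I"
    using linear_independent_extend_subspace[OF I(2), of "\<lambda>x. x"] by auto
  have id: "g x = x" if "x \<in> span B" for x
  proof -
    have "x \<in> span I" using that I(3) by simp
    then show ?thesis by (rule linear_eq_on[OF g(1) linear_ident]) (use g(2) in auto)
  qed
  have gB: "g x \<in> span B" for x using g(3) I(3) by auto
  have "is_seminorm (\<lambda>x. minkowski_gauge B (g x))"
    unfolding is_seminorm_def
    by (simp add: linear_add[OF g(1)] linear_scale[OF g(1)] gauge_add[OF B gB gB] gauge_scale[OF B gB])
  then show ?thesis using id by (intro exI[of _ "\<lambda>x. minkowski_gauge B (g x)"]) auto
qed

lemma gauge_ext: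
  assumes "absconvex B"
  shows "is_seminorm (gauge_ext B)" "\<And>x. x \<in> span B \<Longrightarrow> gauge_ext B x = minkowski_gauge B x"
  using someI_ex[OF gauge_ext_exists[OF assms]] unfolding gauge_ext_def by auto

lemma gauge_ext_le_1: "absconvex B \<Longrightarrow> x \<in> B \<Longrightarrow> gauge_ext B x \<le> 1"
  by (simp add: gauge_ext span_base gauge_le image_iff)

lemma gauge_ext_antimono:
  assumes B: "absconvex B" "absconvex C" and sub: "B \<subseteq> C" and x: "x \<in> span B"
  shows "gauge_ext C x \<le> gauge_ext B x"
proof -
  have "gauge_ext C x \<le> 1 * minkowski_gauge B x"
    by (rule seminorm_le_gauge[OF gauge_ext(1)[OF B(2)] B(1) _ x]) (use sub gauge_ext_le_1[OF B(2)] in auto)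
  then show ?thesis using gauge_ext(2)[OF B(1) x] by simp
qed

lemma gauge_ext_less_1D:
  assumes B: "absconvex B" and x: "x \<in> span B" "gauge_ext B x < 1"
  shows "x \<in> B"
proof -
  obtain t where "t > 0" "t < 1" "x \<in> (\<lambda>y. t *\<^sub>R y) ` B"
    using gauge_lessD[OF B x(1), of 1] x gauge_ext(2)[OF B x(1)] by auto
  then show ?thesis using absconvex_mono[OF B, of t 1 x] by auto
qed

section \<open>Blocks of the series\<close>

lemma sum_lessThan_add: "(\<Sum>k<a + n. F k) = (\<Sum>k<a. F k) + (\<Sum>l<n. F (a + l))"
  for F :: "nat \<Rightarrow> 'b::comm_monoid_add"
  by (induction n) (simp_all add: add.assoc)

lemma sum_lessThan_blocks:
  "(\<Sum>k<N + m * P. F k) = (\<Sum>k<N. F k) + (\<Sum>j<m. \<Sum>l<P. F (N + j * P + l))"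
  for F :: "nat \<Rightarrow> 'b::comm_monoid_add"
proof (induction m)
  case (Suc m)
  have "(\<Sum>k<N + Suc m * P. F k) = (\<Sum>k<(N + m * P) + P. F k)" by (simp add: ac_simps)
  also have "\<dots> = (\<Sum>k<N + m * P. F k) + (\<Sum>l<P. F (N + m * P + l))" by (rule sum_lessThan_add)
  finally show ?case using Suc by (simp add: add.assoc)
qed simp

text \<open>Round z / |z| towards 0 on the grid of mesh 1 / (2 m). This keeps the vector in the unit
  ball, and the scalar product with z loses at most \<Sum> |z_i| / (2 m) <= |z| / 2. Finiteness
  matters because later blocks have to lie in the kernels of all functionals made from these
  directions.\<close>

lemma finite_norming_directions:
  fixes m :: nat
  assumes m: "m \<ge> 1"
  shows "\<exists>\<Theta> :: (nat \<Rightarrow> real) set. finite \<Theta> \<and> (\<forall>\<theta>\<in>\<Theta>. (\<Sum>i<m. (\<theta> i)\<^sup>2) \<le> 1) \<and>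
    (\<forall>z. \<exists>\<theta>\<in>\<Theta>. sqrt (\<Sum>i<m. (z i)\<^sup>2) \<le> 2 * (\<Sum>i<m. \<theta> i * z i))"
proof -
  define D where "D = (\<lambda>k::int. real_of_int k / (2 * real m)) ` {- 2 * int m..2 * int m}"
  define \<Theta> where "\<Theta> = {\<theta> \<in> PiE {..<m} (\<lambda>_. D). (\<Sum>i<m. (\<theta> i)\<^sup>2) \<le> 1}"
  have "finite (PiE {..<m} (\<lambda>_. D))" by (intro finite_PiE) (auto simp: D_def)
  then have "finite \<Theta>" unfolding \<Theta>_def by simp
  moreover have "\<exists>\<theta>\<in>\<Theta>. sqrt (\<Sum>i<m. (z i)\<^sup>2) \<le> 2 * (\<Sum>i<m. \<theta> i * z i)" for z
  proof -
    define n where "n = sqrt (\<Sum>i<m. (z i)\<^sup>2)"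
    have n2: "n\<^sup>2 = (\<Sum>i<m. (z i)\<^sup>2)" by (simp add: n_def sum_nonneg)
    have n0: "n \<ge> 0" by (simp add: n_def sum_nonneg)
    have zn: "\<bar>z i\<bar> \<le> n" if "i < m" for i
    proof (rule power2_le_imp_le)
      have "(z i)\<^sup>2 \<le> (\<Sum>i<m. (z i)\<^sup>2)" by (rule member_le_sum) (use that in auto)
      then show "\<bar>z i\<bar>\<^sup>2 \<le> n\<^sup>2" by (simp add: n2)
    qed (rule n0)
    \<comment> \<open>For z = 0 the division by n = 0 gives q i = 0, hence the direction 0.\<close>
    define q where "q i = \<lfloor>2 * m * \<bar>z i\<bar> / n\<rfloor>" for i
    define \<theta> where "\<theta> = (\<lambda>i\<in>{..<m}. sgn (z i) * (q i / (2 * real m)))"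
    have abs\<theta>: "\<bar>\<theta> i\<bar> \<le> \<bar>z i\<bar> / n" "\<bar>z i\<bar> / n - 1 / (2 * real m) \<le> q i / (2 * real m)" "0 \<le> q i" "q i \<le> 2 * int m"
      if "i < m" for i
    proof -
      have r: "real_of_int (q i) \<le> 2 * m * \<bar>z i\<bar> / n" "2 * m * \<bar>z i\<bar> / n - 1 \<le> q i"
        unfolding q_def by linarith+
      have "0 \<le> 2 * m * \<bar>z i\<bar> / n" using n0 by simp
      then show q0: "0 \<le> q i" unfolding q_def by simp
      have "q i / (2 * real m) \<le> (2 * m * \<bar>z i\<bar> / n) / (2 * real m)" using r by (intro divide_right_mono) auto
      also have "\<dots> = \<bar>z i\<bar> / n" using m by simp
      finally have le: "q i / (2 * real m) \<le> \<bar>z i\<bar> / n" .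
      then show "\<bar>\<theta> i\<bar> \<le> \<bar>z i\<bar> / n"
        using that q0 n0 by (auto simp: \<theta>_def abs_mult sgn_if)
      have "(2 * m * \<bar>z i\<bar> / n - 1) / (2 * real m) \<le> q i / (2 * real m)" using r by (intro divide_right_mono) auto
      then show "\<bar>z i\<bar> / n - 1 / (2 * real m) \<le> q i / (2 * real m)"
        using m by (simp add: diff_divide_distrib)
      have "\<bar>z i\<bar> / n \<le> 1" using zn[OF that] n0 by (simp add: divide_le_eq)
      from mult_left_mono[OF this, of "2 * m"] have "2 * m * \<bar>z i\<bar> / n \<le> 2 * m" by simp
      then show "q i \<le> 2 * int m" using r(1) by linarith
    qed
    have "\<theta> \<in> PiE {..<m} (\<lambda>_. D)"
    proof (rule PiE_I)
      fix i assume i: "i \<in> {..<m}"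
      consider "z i > 0" | "z i = 0" | "z i < 0" by linarith
      then show "\<theta> i \<in> D"
      proof cases
        case 1 then show ?thesis using i abs\<theta>(3,4)[of i] by (auto simp: \<theta>_def D_def intro!: image_eqI[of _ _ "q i"])
      next
        case 2 then show ?thesis using i by (auto simp: \<theta>_def D_def intro!: image_eqI[of _ _ 0])
      next
        case 3 then show ?thesis using i abs\<theta>(3,4)[of i] by (auto simp: \<theta>_def D_def intro!: image_eqI[of _ _ "- q i"])
      qed
    qed (simp add: \<theta>_def)
    moreover have "(\<Sum>i<m. (\<theta> i)\<^sup>2) \<le> 1"
    proof -
      have "(\<Sum>i<m. (\<theta> i)\<^sup>2) \<le> (\<Sum>i<m. (\<bar>z i\<bar> / n)\<^sup>2)"
        using abs\<theta>(1) by (intro sum_mono) (simp add: power2_le_iff_abs_le n0)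
      also have "\<dots> = n\<^sup>2 / n\<^sup>2" by (simp add: power_divide n2 flip: sum_divide_distrib)
      also have "\<dots> \<le> 1" by simp
      finally show ?thesis .
    qed
    ultimately have "\<theta> \<in> \<Theta>" by (simp add: \<Theta>_def)
    moreover have "n \<le> 2 * (\<Sum>i<m. \<theta> i * z i)"
    proof (cases "n = 0")
      case True
      have "0 \<le> (\<Sum>i<m. \<theta> i * z i)"
        using zn True by (intro sum_nonneg) auto
      then show ?thesis using True by simp
    next
      case False
      then have n: "n > 0" using n0 by simp
      have "\<theta> i * z i \<ge> (z i)\<^sup>2 / n - n / (2 * real m)" if i: "i < m" for i
      proof -
        have "\<theta> i * z i = q i / (2 * real m) * \<bar>z i\<bar>" using i by (simp add: \<theta>_def sgn_if)
        also have "\<dots> \<ge> (\<bar>z i\<bar> / n - 1 / (2 * real m)) * \<bar>z i\<bar>"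
          by (rule mult_right_mono[OF abs\<theta>(2)[OF i]]) simp
        also have "(\<bar>z i\<bar> / n - 1 / (2 * real m)) * \<bar>z i\<bar> = (z i)\<^sup>2 / n - \<bar>z i\<bar> / (2 * real m)"
          by (simp add: left_diff_distrib power2_eq_square)
        also have "\<dots> \<ge> (z i)\<^sup>2 / n - n / (2 * real m)"
          using zn[OF i] by (intro diff_left_mono divide_right_mono) auto
        finally show ?thesis .
      qed
      then have "(\<Sum>i<m. (z i)\<^sup>2 / n - n / (2 * real m)) \<le> (\<Sum>i<m. \<theta> i * z i)" by (intro sum_mono) auto
      moreover have "(\<Sum>i<m. (z i)\<^sup>2 / n - n / (2 * real m)) = n\<^sup>2 / n - n / 2"
        using m by (simp add: sum_subtractf n2 flip: sum_divide_distrib)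
      ultimately show ?thesis using n by (simp add: power2_eq_square)
    qed
    ultimately show ?thesis by (auto simp: n_def)
  qed
  ultimately show ?thesis by (intro exI[of _ \<Theta>]) (auto simp: \<Theta>_def)
qed


text \<open>Meant for the gauge \<open>s\<close> of a larger disc. As (1 / sqrt m)^m is, up to an
  exponential factor, the volume of the unit ball of dimension m, the last condition says that the
  lattice generated by the b_j, seen through \<open>A\<close>, has cells much larger than a ball of
  radius \<open>L\<close>. The freedom in \<Phi> later keeps the blocks independent of one
  another.\<close>

definition lattice_rich :: "'a::real_vector set \<Rightarrow> ('a \<Rightarrow> real) \<Rightarrow> bool" where
  "lattice_rich B s \<longleftrightarrow> (\<forall>(\<Phi> :: ('a \<Rightarrow> real) set) L. finite \<Phi> \<longrightarrow> (\<forall>\<phi>\<in>\<Phi>. linear \<phi> \<and> (\<exists>K. \<forall>x\<in>B. \<bar>\<phi> x\<bar> \<le> K)) \<longrightarrow>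
     (\<exists>m b A. m \<ge> 1 \<and> (\<forall>j<m. b j \<in> B \<and> (\<forall>\<phi>\<in>\<Phi>. \<phi> (b j) = 0)) \<and>
        contr m A (\<lambda>c. s (\<Sum>j<m. c j *\<^sub>R b j)) \<and> (L / sqrt m) ^ m < \<bar>dt m A\<bar>))"

text \<open>A QR rotation makes \<open>A\<close> triangular and preserves lengths. The dimension is
  forced to be large: |A e_j| <= s (b_j) <= 1 bounds the diagonal entries, so that (L / sqrt m)^m <
  1.\<close>

lemma lattice_rich_triangular:
  assumes rich: "lattice_rich B s" and s: "\<And>x. x \<in> B \<Longrightarrow> s x \<le> 1" "is_seminorm s"
    and \<Phi>: "finite (\<Phi> :: ('a::real_vector \<Rightarrow> real) set)" "\<And>\<phi>. \<phi> \<in> \<Phi> \<Longrightarrow> linear \<phi>" "\<And>\<phi>. \<phi> \<in> \<Phi> \<Longrightarrow> \<exists>K. \<forall>x\<in>B. \<bar>\<phi> x\<bar> \<le> K" and L: "L > 0"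
  shows "\<exists>m b A. m \<ge> 1 \<and> L\<^sup>2 < m \<and> (\<forall>j<m. b j \<in> B) \<and> (\<forall>j<m. \<forall>\<phi>\<in>\<Phi>. \<phi> (b j) = 0) \<and>
     contr m A (\<lambda>c. s (\<Sum>j<m. c j *\<^sub>R b j)) \<and> (\<forall>i<m. \<forall>j<i. A i j = 0) \<and> (\<forall>i<m. A i i \<noteq> 0) \<and>
     (L / sqrt m) ^ m < (\<Prod>i<m. \<bar>A i i\<bar>)"
proof -
  have "\<exists>m b A. m \<ge> 1 \<and> (\<forall>j<m. b j \<in> B \<and> (\<forall>\<phi>\<in>\<Phi>. \<phi> (b j) = 0)) \<and>
      contr m A (\<lambda>c. s (\<Sum>j<m. c j *\<^sub>R b j)) \<and> (L / sqrt m) ^ m < \<bar>dt m A\<bar>"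
    using rich \<Phi> unfolding lattice_rich_def by blast
  then obtain m b A where m: "m \<ge> 1" and b: "\<And>j. j < m \<Longrightarrow> b j \<in> B" "\<And>j \<phi>. j < m \<Longrightarrow> \<phi> \<in> \<Phi> \<Longrightarrow> \<phi> (b j) = 0"
    and A: "contr m A (\<lambda>c. s (\<Sum>j<m. c j *\<^sub>R b j))" "(L / sqrt m) ^ m < \<bar>dt m A\<bar>"
    by blast
  obtain Q where Q: "orth m Q" "\<And>i j. i < m \<Longrightarrow> j < i \<Longrightarrow> mm m Q A i j = 0"
    using QR_decomposition[of m A] by blast
  define A' where "A' = mm m Q A"
  have c: "contr m A' (\<lambda>c. s (\<Sum>j<m. c j *\<^sub>R b j))"
    using A(1) Q(1) by (simp add: contr_def A'_def mv_mm orth_def)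
  have "\<bar>dt m A'\<bar> = \<bar>dt m A\<bar>" using Q(1) by (simp add: A'_def dt_mm abs_mult orth_def)
  moreover have "dt m A' = (\<Prod>i<m. A' i i)" using Q(2) by (intro dt_upper_triangular) (auto simp: A'_def)
  ultimately have d: "(L / sqrt m) ^ m < (\<Prod>i<m. \<bar>A' i i\<bar>)" using A(2) by (simp add: abs_prod)
  have "0 < (L / sqrt m) ^ m" using L m by simp
  then have "(\<Prod>i<m. \<bar>A' i i\<bar>) \<noteq> 0" using d by linarith
  then have nz: "A' i i \<noteq> 0" if "i < m" for i using that by auto
  have "\<bar>A' j j\<bar> \<le> 1" if j: "j < m" for j
  proof -
    let ?e = "\<lambda>i. if i = j then 1 else (0 :: real)"
    have "(A' j j)\<^sup>2 = (mv m A' ?e j)\<^sup>2" using j by (simp add: mv_unit)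
    also have "\<dots> \<le> (\<Sum>i<m. (mv m A' ?e i)\<^sup>2)"
      using j by (intro member_le_sum[of j "{..<m}" "\<lambda>i. (mv m A' ?e i)\<^sup>2"]) auto
    also have "\<dots> \<le> (s (\<Sum>i<m. ?e i *\<^sub>R b i))\<^sup>2" using c by (simp add: contr_def)
    also have "(\<Sum>i<m. ?e i *\<^sub>R b i) = b j"
      using j by (simp add: if_distrib[of "\<lambda>x. x *\<^sub>R _"] cong: if_cong)
    also have "(s (b j))\<^sup>2 \<le> 1\<^sup>2"
      using s(1)[OF b(1)[OF j]] seminorm_nonneg[OF s(2), of "b j"] by (intro power_mono) auto
    finally show ?thesis by (simp add: abs_square_le_1)
  qed
  then have "(\<Prod>i<m. \<bar>A' i i\<bar>) \<le> 1" by (intro prod_le_1) auto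
  then have "(L / sqrt m) ^ m < 1" using d by linarith
  then have "L / sqrt m < 1" using L by (meson not_less one_le_power)
  then have "L < sqrt m" using m by (simp add: divide_less_eq)
  then have "L\<^sup>2 < (sqrt m)\<^sup>2" using L by (intro power_strict_mono) auto
  then have "L\<^sup>2 < m" by simp
  then show ?thesis using m b c nz d Q(2) unfolding A'_def by blast
qed


text \<open>Each direction \<theta> of a finite norming set gives the functional \<Sum> c_j b_j
  \<mapsto> <\<theta>, A c> / \<kappa>. By Mazur's inequality it is dominated by the distance to
  span W, hence extends to a functional that vanishes on W. In (2 \<kappa>)^2 the 2 comes from the
  norming set and \<kappa> from the normalization.\<close>

lemma block_functionals:
  fixes s :: "'a::real_vector \<Rightarrow> real" and b :: "nat \<Rightarrow> 'a"
  assumes s: "is_seminorm s" and \<kappa>: "\<kappa> > 0" and m: "m \<ge> 1"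
    and A: "contr m A (\<lambda>c. s (\<Sum>j<m. c j *\<^sub>R b j))"
    and mazur: "\<And>v c. v \<in> span W \<Longrightarrow> s (\<Sum>j<m. c j *\<^sub>R b j) \<le> \<kappa> * s (v + (\<Sum>j<m. c j *\<^sub>R b j))"
  shows "\<exists>\<Psi>. finite \<Psi> \<and> (\<forall>\<psi>\<in>\<Psi>. linear \<psi> \<and> (\<forall>y. \<bar>\<psi> y\<bar> \<le> s y) \<and> (\<forall>w\<in>W. \<psi> w = 0)) \<and>
    (\<forall>c. (\<forall>\<psi>\<in>\<Psi>. \<bar>\<psi> (\<Sum>j<m. c j *\<^sub>R b j)\<bar> \<le> 1) \<longrightarrow> (\<Sum>i<m. (mv m A c i)\<^sup>2) \<le> (2 * \<kappa>)\<^sup>2)"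
proof -
  obtain \<Theta> :: "(nat \<Rightarrow> real) set" where \<Theta>: "finite \<Theta>" "\<And>\<theta>. \<theta> \<in> \<Theta> \<Longrightarrow> (\<Sum>i<m. (\<theta> i)\<^sup>2) \<le> 1"
    "\<And>z. \<exists>\<theta>\<in>\<Theta>. sqrt (\<Sum>i<m. (z i)\<^sup>2) \<le> 2 * (\<Sum>i<m. \<theta> i * z i)"
    using finite_norming_directions[OF m] by blast
  have "\<exists>\<psi>. linear \<psi> \<and> (\<forall>y. \<bar>\<psi> y\<bar> \<le> sdist s W y) \<and> (\<forall>j<m. \<psi> (b j) = (\<Sum>i<m. \<theta> i * A i j) / \<kappa>)" if \<theta>: "\<theta> \<in> \<Theta>" for \<theta>
  proof (rule functional_with_values[OF is_seminorm_sdist[OF s]])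
    fix c
    let ?g = "\<Sum>j<m. c j *\<^sub>R b j"
    have "(\<Sum>j<m. (\<Sum>i<m. \<theta> i * A i j) / \<kappa> * c j) = (\<Sum>j<m. \<Sum>i<m. \<theta> i * A i j * c j) / \<kappa>"
      by (simp add: sum_distrib_right sum_divide_distrib)
    also have "(\<Sum>j<m. \<Sum>i<m. \<theta> i * A i j * c j) = (\<Sum>i<m. \<Sum>j<m. \<theta> i * A i j * c j)" by (rule sum.swap)
    also have "\<dots> = (\<Sum>i<m. \<theta> i * mv m A c i)" by (simp add: mv_def sum_distrib_left mult.assoc)
    also have "\<dots> \<le> sqrt (\<Sum>i<m. (\<theta> i)\<^sup>2) * sqrt (\<Sum>i<m. (mv m A c i)\<^sup>2)"
    proof -
      have "(\<Sum>i<m. \<theta> i * mv m A c i)\<^sup>2 \<le> (\<Sum>i<m. (\<theta> i)\<^sup>2) * (\<Sum>i<m. (mv m A c i)\<^sup>2)"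
        by (rule Cauchy_Schwarz_ineq_sum)
      then show ?thesis by (metis real_le_rsqrt real_sqrt_mult)
    qed
    also have "\<dots> \<le> 1 * s ?g"
    proof (rule mult_mono)
      show "sqrt (\<Sum>i<m. (\<theta> i)\<^sup>2) \<le> 1" using \<Theta>(2)[OF \<theta>] by simp
      have "(\<Sum>i<m. (mv m A c i)\<^sup>2) \<le> (s ?g)\<^sup>2" using A by (simp add: contr_def)
      then show "sqrt (\<Sum>i<m. (mv m A c i)\<^sup>2) \<le> s ?g" by (rule real_le_lsqrt[OF seminorm_nonneg[OF s]])
    qed (auto intro: sum_nonneg)
    also have "1 * s ?g / \<kappa> \<le> sdist s W ?g"
    proof (rule sdist_greatest)
      fix z assume "z \<in> span W"
      then have "s ?g \<le> \<kappa> * s (- z + ?g)" by (intro mazur span_neg)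
      also have "- z + ?g = ?g - z" by simp
      finally show "1 * s ?g / \<kappa> \<le> s (?g - z)" using \<kappa> by (simp add: divide_le_eq mult.commute)
    qed
    finally show "(\<Sum>j<m. (\<Sum>i<m. \<theta> i * A i j) / \<kappa> * c j) \<le> sdist s W ?g"
      using \<kappa> by (simp add: divide_right_mono)
  qed
  then have "\<forall>\<theta>\<in>\<Theta>. \<exists>\<psi>. linear \<psi> \<and> (\<forall>y. \<bar>\<psi> y\<bar> \<le> sdist s W y) \<and>
      (\<forall>j<m. \<psi> (b j) = (\<Sum>i<m. \<theta> i * A i j) / \<kappa>)" by blast
  from bchoice[OF this] obtain \<psi> where all: "\<forall>\<theta>\<in>\<Theta>. linear (\<psi> \<theta>) \<and> (\<forall>y. \<bar>\<psi> \<theta> y\<bar> \<le> sdist s W y) \<and>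
      (\<forall>j<m. \<psi> \<theta> (b j) = (\<Sum>i<m. \<theta> i * A i j) / \<kappa>)" ..
  have \<psi>: "\<And>\<theta>. \<theta> \<in> \<Theta> \<Longrightarrow> linear (\<psi> \<theta>)" "\<And>\<theta> y. \<theta> \<in> \<Theta> \<Longrightarrow> \<bar>\<psi> \<theta> y\<bar> \<le> sdist s W y"
    "\<And>\<theta> j. \<theta> \<in> \<Theta> \<Longrightarrow> j < m \<Longrightarrow> \<psi> \<theta> (b j) = (\<Sum>i<m. \<theta> i * A i j) / \<kappa>"
    using all by simp_all
  have val: "\<psi> \<theta> (\<Sum>j<m. c j *\<^sub>R b j) = (\<Sum>i<m. \<theta> i * mv m A c i) / \<kappa>" if \<theta>: "\<theta> \<in> \<Theta>" for \<theta> c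
  proof -
    have "\<psi> \<theta> (\<Sum>j<m. c j *\<^sub>R b j) = (\<Sum>j<m. c j * \<psi> \<theta> (b j))"
      using \<psi>(1)[OF \<theta>] by (simp add: linear_sum linear_scale)
    also have "\<dots> = (\<Sum>j<m. \<Sum>i<m. \<theta> i * A i j * c j) / \<kappa>"
    proof -
      have "c j * \<psi> \<theta> (b j) = (\<Sum>i<m. \<theta> i * A i j * c j) / \<kappa>" if "j < m" for j
        using \<psi>(3)[OF \<theta> that] by (simp add: sum_distrib_left mult_ac)
      then show ?thesis by (simp add: sum_divide_distrib)
    qed
    also have "(\<Sum>j<m. \<Sum>i<m. \<theta> i * A i j * c j) = (\<Sum>i<m. \<Sum>j<m. \<theta> i * A i j * c j)" by (rule sum.swap)
    also have "\<dots> = (\<Sum>i<m. \<theta> i * mv m A c i)" by (simp add: mv_def sum_distrib_left mult.assoc)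
    finally show ?thesis .
  qed
  have "(\<Sum>i<m. (mv m A c i)\<^sup>2) \<le> (2 * \<kappa>)\<^sup>2" if small: "\<forall>\<psi>\<in>\<psi> ` \<Theta>. \<bar>\<psi> (\<Sum>j<m. c j *\<^sub>R b j)\<bar> \<le> 1" for c
  proof -
    obtain \<theta> where \<theta>: "\<theta> \<in> \<Theta>" "sqrt (\<Sum>i<m. (mv m A c i)\<^sup>2) \<le> 2 * (\<Sum>i<m. \<theta> i * mv m A c i)"
      using \<Theta>(3)[of "mv m A c"] by blast
    have "\<bar>(\<Sum>i<m. \<theta> i * mv m A c i) / \<kappa>\<bar> \<le> 1" using small \<theta>(1) val[OF \<theta>(1), of c] by auto
    then have "(\<Sum>i<m. \<theta> i * mv m A c i) \<le> \<kappa>" using \<kappa> by (simp add: abs_le_iff divide_le_eq)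
    then have "sqrt (\<Sum>i<m. (mv m A c i)\<^sup>2) \<le> 2 * \<kappa>" using \<theta>(2) by linarith
    then show ?thesis by (rule sqrt_le_D)
  qed
  moreover have "\<psi> \<theta> w = 0" if "\<theta> \<in> \<Theta>" "w \<in> W" for \<theta> w
    using \<psi>(2)[OF that(1), of w] sdist_span[OF s span_base[OF that(2)]] by simp
  moreover have "\<bar>\<psi> \<theta> y\<bar> \<le> s y" if "\<theta> \<in> \<Theta>" for \<theta> y
    using \<psi>(2)[OF that, of y] sdist_le_seminorm[OF s, of W y] by linarith
  ultimately show ?thesis using \<Theta>(1) \<psi>(1)
    by (intro exI[of _ "\<psi> ` \<Theta>"] conjI ballI allI impI finite_imageI) auto
qed

text \<open>The vector y in the block comes from \<open>rounding_gap\<close>. An integer combination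
  of the block equals t x + w with w = \<epsilon> \<Sum> (t y_j + n_j) b_j, where t = K / N and K is
  the sum of the coefficients on the first \<open>N\<close> entries. If all tests in \<Psi> are at
  most 1 at w, then t y is close to the integer vector -n as measured by \<open>A\<close>, which the
  gap excludes for |t| >= 1 / P.\<close>

lemma block_exists:
  fixes B W :: "'a::real_vector set" and s :: "'a \<Rightarrow> real" and \<Phi> :: "('a \<Rightarrow> real) set"
  assumes B: "absconvex B" and rich: "lattice_rich B s"
    and s: "is_seminorm s" and sB: "\<And>y. y \<in> B \<Longrightarrow> s y \<le> 1"
    and x: "x \<in> span B" and W: "finite W"
    and \<Phi>: "finite \<Phi>" "\<And>\<phi>. \<phi> \<in> \<Phi> \<Longrightarrow> linear \<phi>" "\<And>\<phi>. \<phi> \<in> \<Phi> \<Longrightarrow> \<exists>K. \<forall>y\<in>B. \<bar>\<phi> y\<bar> \<le> K"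
    and \<epsilon>: "\<epsilon> > 0" and \<delta>: "\<delta> > 0"
  shows "\<exists>blk ws \<Psi>. blk \<noteq> [] \<and> finite ws \<and> finite \<Psi> \<and>
    (\<forall>v\<in>set blk. v \<in> span B \<and> minkowski_gauge B v \<le> \<epsilon>) \<and>
    (\<forall>\<psi>\<in>\<Psi>. linear \<psi> \<and> (\<forall>y. \<bar>\<psi> y\<bar> \<le> s y) \<and> (\<forall>w\<in>W. \<psi> w = 0)) \<and>
    (\<exists>c. (\<forall>k. \<bar>c k\<bar> \<le> 1) \<and> x = (\<Sum>k<length blk. c k *\<^sub>R blk ! k)) \<and>
    (\<forall>\<eta> :: nat \<Rightarrow> int. (\<forall>k. \<bar>\<eta> k\<bar> \<le> 1) \<longrightarrow>
      (\<exists>t w. (\<Sum>k<length blk. real_of_int (\<eta> k) *\<^sub>R blk ! k) = w + t *\<^sub>R x \<and> w \<in> span ws \<and>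
        (\<forall>\<phi>\<in>\<Phi>. \<phi> w = 0) \<and> ((\<forall>\<psi>\<in>\<Psi>. \<bar>\<psi> w\<bar> \<le> 1) \<longrightarrow> \<bar>t\<bar> \<le> \<delta>)))"
proof -
  from mazur_finite_codimension[OF s W] obtain \<Omega> \<kappa> where mz:
    "finite \<Omega> \<and> (\<forall>\<omega>\<in>\<Omega>. linear \<omega> \<and> (\<forall>x. \<bar>\<omega> x\<bar> \<le> s x)) \<and> \<kappa> > 0 \<and>
      (\<forall>v g. v \<in> span W \<longrightarrow> (\<forall>\<omega>\<in>\<Omega>. \<omega> g = 0) \<longrightarrow> s g \<le> \<kappa> * s (v + g))"
    by (elim exE)
  then have \<Omega>: "finite \<Omega>" "\<And>\<omega>. \<omega> \<in> \<Omega> \<Longrightarrow> linear \<omega>" "\<And>\<omega> y. \<omega> \<in> \<Omega> \<Longrightarrow> \<bar>\<omega> y\<bar> \<le> s y"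
    and \<kappa>: "\<kappa> > 0" by simp_all
  have \<kappa>2: "\<And>v g. v \<in> span W \<Longrightarrow> (\<And>\<omega>. \<omega> \<in> \<Omega> \<Longrightarrow> \<omega> g = 0) \<Longrightarrow> s g \<le> \<kappa> * s (v + g)"
    using mz by simp
  define g where "g = minkowski_gauge B x"
  have g0: "g \<ge> 0" unfolding g_def by (rule gauge_nonneg[OF B x])
  \<comment> \<open>1 / P <= \<delta>, so every t with |t| > \<delta> falls under the gap.
    \<open>P\<close> is also the number of copies of each \<epsilon> b_j, which bounds |n_j| and
    keeps the coefficients -y_j / P in [-1, 1].\<close>
  define P where "P = nat \<lceil>1 / \<delta>\<rceil>"
  have P: "P \<ge> 1" "1 / P \<le> \<delta>"
  proof -
    have "1 / \<delta> > 0" using \<delta> by simp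
    then show P1: "P \<ge> 1" unfolding P_def by linarith
    have "1 / \<delta> \<le> P" unfolding P_def by linarith
    then show "1 / P \<le> \<delta>" using \<delta> P1 by (simp add: field_simps)
  qed
  \<comment> \<open>Tests at most 1 give |A (\<epsilon> d)| <= 2 \<kappa>, that is, |A d| <=
    R.\<close>
  define R where "R = 2 * \<kappa> / \<epsilon>"
  have R: "R > 0" using \<kappa> \<epsilon> by (simp add: R_def)
  \<comment> \<open>It will turn out that N <= c1 m, and m > L^2 >= L >= c1 gives N < m^2 <= 4^m.
    This factor is absorbed by 864 = 4 * 216.\<close>
  define c1 where "c1 = g / \<epsilon> + P + 1"
  define L where "L = max c1 (864 * R)"
  have L: "L \<ge> 1" "L \<ge> c1" "L \<ge> 864 * R" using g0 \<epsilon> by (auto simp: L_def c1_def le_max_iff_disj)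
  have bd: "\<exists>K. \<forall>y\<in>B. \<bar>\<phi> y\<bar> \<le> K" if "\<phi> \<in> \<Phi> \<union> \<Omega>" for \<phi>
    using that \<Phi>(3) order_trans[OF \<Omega>(3) sB] by blast
  have lin: "linear \<phi>" if "\<phi> \<in> \<Phi> \<union> \<Omega>" for \<phi> using that \<Phi>(2) \<Omega>(2) by blast
  obtain m b A where m: "m \<ge> 1" "L\<^sup>2 < m" and b: "\<And>j. j < m \<Longrightarrow> b j \<in> B"
    "\<And>j \<phi>. j < m \<Longrightarrow> \<phi> \<in> \<Phi> \<union> \<Omega> \<Longrightarrow> \<phi> (b j) = 0"
    and A: "contr m A (\<lambda>c. s (\<Sum>j<m. c j *\<^sub>R b j))" "\<And>i j. i < m \<Longrightarrow> j < i \<Longrightarrow> A i j = 0" "\<And>i. i < m \<Longrightarrow> A i i \<noteq> 0"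
      "(L / sqrt m) ^ m < (\<Prod>i<m. \<bar>A i i\<bar>)"
  proof -
    have fin: "finite (\<Phi> \<union> \<Omega>)" and L0: "L > 0" using \<Phi>(1) \<Omega>(1) L(1) by auto
    have "\<exists>m b A. m \<ge> 1 \<and> L\<^sup>2 < m \<and> (\<forall>j<m. b j \<in> B) \<and> (\<forall>j<m. \<forall>\<phi>\<in>\<Phi> \<union> \<Omega>. \<phi> (b j) = 0) \<and>
        contr m A (\<lambda>c. s (\<Sum>j<m. c j *\<^sub>R b j)) \<and> (\<forall>i<m. \<forall>j<i. A i j = 0) \<and> (\<forall>i<m. A i i \<noteq> 0) \<and>
        (L / sqrt m) ^ m < (\<Prod>i<m. \<bar>A i i\<bar>)"
      by (rule lattice_rich_triangular[OF rich _ s fin _ _ L0]) (fact sB lin bd)+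
    then show ?thesis by (elim exE conjE) (rule that; simp)
  qed
  have kill: "\<phi> (\<Sum>j<m. c j *\<^sub>R b j) = 0" if "\<phi> \<in> \<Phi> \<union> \<Omega>" for \<phi> c
    using b(2)[OF _ that] by (simp add: linear_sum[OF lin[OF that]] linear_scale[OF lin[OF that]])
  obtain \<Psi> where \<Psi>: "finite \<Psi>" "\<And>\<psi>. \<psi> \<in> \<Psi> \<Longrightarrow> linear \<psi> \<and> (\<forall>y. \<bar>\<psi> y\<bar> \<le> s y) \<and> (\<forall>w\<in>W. \<psi> w = 0)"
    and small: "\<And>c. (\<forall>\<psi>\<in>\<Psi>. \<bar>\<psi> (\<Sum>j<m. c j *\<^sub>R b j)\<bar> \<le> 1) \<Longrightarrow> (\<Sum>i<m. (mv m A c i)\<^sup>2) \<le> (2 * \<kappa>)\<^sup>2"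
  proof -
    have mz: "s (\<Sum>j<m. c j *\<^sub>R b j) \<le> \<kappa> * s (v + (\<Sum>j<m. c j *\<^sub>R b j))" if "v \<in> span W" for v c
      using that kill by (intro \<kappa>2) auto
    have "\<exists>\<Psi>. finite \<Psi> \<and> (\<forall>\<psi>\<in>\<Psi>. linear \<psi> \<and> (\<forall>y. \<bar>\<psi> y\<bar> \<le> s y) \<and> (\<forall>w\<in>W. \<psi> w = 0)) \<and>
        (\<forall>c. (\<forall>\<psi>\<in>\<Psi>. \<bar>\<psi> (\<Sum>j<m. c j *\<^sub>R b j)\<bar> \<le> 1) \<longrightarrow> (\<Sum>i<m. (mv m A c i)\<^sup>2) \<le> (2 * \<kappa>)\<^sup>2)"
      by (rule block_functionals[OF s \<kappa> m(1) A(1)]) (rule mz)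
    then show ?thesis by (elim exE conjE) (rule that; blast)
  qed
  \<comment> \<open>Large enough for v0 to have gauge at most \<epsilon>, since the gauge of x +
    \<epsilon> \<Sum> y_j b_j is at most g + \<epsilon> P m.\<close>
  define N where "N = nat \<lceil>g / \<epsilon> + real P * real m\<rceil>"
  have N: "g / \<epsilon> + real P * real m \<le> N" "N \<le> c1 * m" "N \<ge> 1"
  proof -
    have nn: "g / \<epsilon> \<ge> 0" using g0 \<epsilon> by simp
    show 1: "g / \<epsilon> + real P * real m \<le> N" unfolding N_def by linarith
    have "1 * 1 \<le> real P * real m" using P m(1) by (intro mult_mono) auto
    then show "N \<ge> 1" using 1 nn by linarith
    have "g / \<epsilon> * 1 \<le> g / \<epsilon> * m" using nn m(1) by (intro mult_left_mono) auto
    moreover have "N \<le> g / \<epsilon> + real P * real m + 1"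
      unfolding N_def using nn mult_nonneg_nonneg[of "real P" "real m"] by linarith
    moreover have "1 \<le> real m" using m(1) by simp
    ultimately show "N \<le> c1 * m" by (simp add: c1_def algebra_simps)
  qed
  have gap: "real N * (216 * R / sqrt m) ^ m < (\<Prod>i<m. \<bar>A i i\<bar>)"
  proof -
    have "real N < 4 ^ m"
    proof -
      have "L \<le> L\<^sup>2" using L(1) by (simp add: power2_eq_square)
      then have "c1 < m" using L(2) m(2) by linarith
      then have "c1 * real m < real m * real m" using m(1) by simp
      moreover have "real m * real m \<le> 2 ^ m * 2 ^ m"
        by (intro mult_mono less_imp_le[OF of_nat_less_two_power]) auto
      moreover have "(2 :: real) ^ m * 2 ^ m = 4 ^ m" unfolding power_mult_distrib[symmetric] by simp
      ultimately show ?thesis using N(2) by linarith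
    qed
    then have "real N * (216 * R / sqrt m) ^ m < 4 ^ m * (216 * R / sqrt m) ^ m"
      using R m(1) by (intro mult_strict_right_mono) auto
    also have "\<dots> = (864 * R / sqrt m) ^ m"
      unfolding power_mult_distrib[symmetric] by simp
    also have "\<dots> \<le> (L / sqrt m) ^ m" using L R by (intro power_mono divide_right_mono) auto
    finally show ?thesis using A(4) by linarith
  qed
  have "\<exists>y. (\<forall>j. 0 \<le> y j \<and> y j \<le> real P) \<and>
    (\<forall>k\<in>{1..N}. 1 / P \<le> real k / N \<longrightarrow> (\<forall>n :: nat \<Rightarrow> int. (\<forall>j. \<bar>n j\<bar> \<le> int P) \<longrightarrow>
      R\<^sup>2 < (\<Sum>i<m. (mv m A (\<lambda>j. real k / N * y j - n j) i)\<^sup>2)))"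
    by (rule rounding_gap) (fact A R P(1) m(1) gap)+
  then obtain y where yf: "(\<forall>j. 0 \<le> y j \<and> y j \<le> real P) \<and>
    (\<forall>k\<in>{1..N}. 1 / P \<le> real k / N \<longrightarrow> (\<forall>n :: nat \<Rightarrow> int. (\<forall>j. \<bar>n j\<bar> \<le> int P) \<longrightarrow>
      R\<^sup>2 < (\<Sum>i<m. (mv m A (\<lambda>j. real k / N * y j - n j) i)\<^sup>2)))" ..
  then have y: "\<And>j. 0 \<le> y j \<and> y j \<le> real P" by blast
  have far: "R\<^sup>2 < (\<Sum>i<m. (mv m A (\<lambda>j. real k / N * y j - real_of_int (n j)) i)\<^sup>2)"
    if "k \<in> {1..N}" "1 / P \<le> real k / N" "\<forall>j. \<bar>n j\<bar> \<le> int P" for k and n :: "nat \<Rightarrow> int"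
    using yf[THEN conjunct2, THEN bspec, OF that(1), THEN mp, OF that(2), THEN spec, THEN mp, OF that(3)] .
  define v0 where "v0 = (1 / real N) *\<^sub>R (x + \<epsilon> *\<^sub>R (\<Sum>j<m. y j *\<^sub>R b j))"
  define f where "f k = (if k < N then v0 else \<epsilon> *\<^sub>R b ((k - N) div P))" for k
  define blk where "blk = map f [0..<N + m * P]"
  have len: "length blk = N + m * P" and nth: "\<And>k. k < N + m * P \<Longrightarrow> blk ! k = f k"
    by (simp_all add: blk_def)
  have fb: "f (N + j * P + l) = \<epsilon> *\<^sub>R b j" if "l < P" for j l using that P(1) by (simp add: f_def)
  have S: "(\<Sum>k<length blk. e k *\<^sub>R blk ! k) =
      (\<Sum>k<N. e k) *\<^sub>R v0 + \<epsilon> *\<^sub>R (\<Sum>j<m. (\<Sum>l<P. e (N + j * P + l)) *\<^sub>R b j)" for e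
  proof -
    have "(\<Sum>k<length blk. e k *\<^sub>R blk ! k) = (\<Sum>k<N + m * P. e k *\<^sub>R f k)"
      unfolding len by (intro sum.cong) (auto simp: nth)
    also have "\<dots> = (\<Sum>k<N. e k *\<^sub>R f k) + (\<Sum>j<m. \<Sum>l<P. e (N + j * P + l) *\<^sub>R f (N + j * P + l))"
      by (rule sum_lessThan_blocks)
    also have "(\<Sum>k<N. e k *\<^sub>R f k) = (\<Sum>k<N. e k) *\<^sub>R v0" by (simp add: f_def scaleR_sum_left)
    also have "(\<Sum>j<m. \<Sum>l<P. e (N + j * P + l) *\<^sub>R f (N + j * P + l)) =
        \<epsilon> *\<^sub>R (\<Sum>j<m. (\<Sum>l<P. e (N + j * P + l)) *\<^sub>R b j)"
      by (simp add: fb scaleR_sum_left scaleR_sum_right mult.commute)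
    finally show ?thesis .
  qed
  have bs: "b j \<in> span B" if "j < m" for j using b(1)[OF that] by (rule span_base)
  have gb: "minkowski_gauge B (b j) \<le> 1" if "j < m" for j using b(1)[OF that] by (intro gauge_le) auto
  have mem: "v \<in> span B \<and> minkowski_gauge B v \<le> \<epsilon>" if "v \<in> set blk" for v
  proof -
    have "v \<in> f ` {0..<N + m * P}" using that by (simp only: blk_def set_map set_upt)
    then obtain k where k: "k < N + m * P" "v = f k" by (elim imageE) simp
    show ?thesis
    proof (cases "k < N")
      case True
      have sp: "(\<Sum>j<m. y j *\<^sub>R b j) \<in> span B" using bs by (intro span_sum span_scale) auto
      have "gauge_ext B (\<Sum>j<m. y j *\<^sub>R b j) \<le> (\<Sum>j<m. gauge_ext B (y j *\<^sub>R b j))"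
        by (intro seminorm_sum gauge_ext(1)[OF B]) auto
      also have "\<dots> \<le> (\<Sum>j<m. real P)"
      proof (rule sum_mono)
        fix j assume "j \<in> {..<m}"
        then have "gauge_ext B (b j) \<le> 1" "0 \<le> gauge_ext B (b j)"
          using b(1) gauge_ext_le_1[OF B] seminorm_nonneg[OF gauge_ext(1)[OF B]] by auto
        then have "y j * gauge_ext B (b j) \<le> real P * 1" using y[of j] by (intro mult_mono) auto
        then show "gauge_ext B (y j *\<^sub>R b j) \<le> real P"
          using y[of j] by (simp add: seminorm_scale[OF gauge_ext(1)[OF B]])
      qed
      finally have 1: "gauge_ext B (\<Sum>j<m. y j *\<^sub>R b j) \<le> real P * real m" by (simp add: mult.commute)
      have "gauge_ext B (x + \<epsilon> *\<^sub>R (\<Sum>j<m. y j *\<^sub>R b j)) \<le> gauge_ext B x + \<epsilon> * gauge_ext B (\<Sum>j<m. y j *\<^sub>R b j)"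
        using seminorm_add[OF gauge_ext(1)[OF B], of x "\<epsilon> *\<^sub>R (\<Sum>j<m. y j *\<^sub>R b j)"] \<epsilon>
        by (simp add: seminorm_scale[OF gauge_ext(1)[OF B]])
      also have "\<dots> \<le> g + \<epsilon> * (real P * real m)"
        using 1 \<epsilon> gauge_ext(2)[OF B x] by (intro add_mono mult_left_mono) (auto simp: g_def)
      also have "\<dots> = \<epsilon> * (g / \<epsilon> + real P * real m)" using \<epsilon> by (simp add: distrib_left)
      also have "\<dots> \<le> \<epsilon> * N" using N(1) \<epsilon> by (intro mult_left_mono) auto
      finally have "gauge_ext B v0 \<le> \<epsilon>"
        using N(3) by (simp add: v0_def seminorm_scale[OF gauge_ext(1)[OF B]] divide_le_eq)
      moreover have "v0 \<in> span B" unfolding v0_def by (intro span_scale span_add x sp)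
      ultimately show ?thesis using True k gauge_ext(2)[OF B, of v0] by (simp add: f_def)
    next
      case False
      then have "k - N < m * P" using k(1) by simp
      then have j: "(k - N) div P < m" using P(1) by (simp add: div_less_iff_less_mult)
      have "minkowski_gauge B (\<epsilon> *\<^sub>R b ((k - N) div P)) \<le> \<epsilon>"
        using gauge_scale[OF B bs[OF j], of \<epsilon>] gb[OF j] \<epsilon> by simp
      then show ?thesis using False k bs[OF j] by (simp add: f_def span_scale)
    qed
  qed
  \<comment> \<open>Weight 1 on the copies of v0 and -y_j / P on the copies of \<epsilon> b_j: the
    perturbation cancels and x remains.\<close>
  define c where "c k = (if k < N then 1 else - (y ((k - N) div P) / P))" for k
  have c1: "\<bar>c k\<bar> \<le> 1" for k using y[of "(k - N) div P"] P(1) by (simp add: c_def divide_le_eq)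
  have cx: "x = (\<Sum>k<length blk. c k *\<^sub>R blk ! k)"
  proof -
    have cl: "c (N + j * P + l) = - (y j / P)" if "l < P" for j l using that P(1) by (simp add: c_def)
    have "(\<Sum>l<P. c (N + j * P + l)) = - y j" for j using P(1) by (simp add: cl)
    moreover have "(\<Sum>k<N. c k) = N" by (simp add: c_def)
    ultimately have "(\<Sum>k<length blk. c k *\<^sub>R blk ! k) = real N *\<^sub>R v0 + \<epsilon> *\<^sub>R (\<Sum>j<m. (- y j) *\<^sub>R b j)"
      by (simp only: S)
    also have "\<dots> = x" using N(3) by (simp add: v0_def sum_negf scaleR_add_right)
    finally show ?thesis by simp
  qed
  have sep: "\<exists>t w. (\<Sum>k<length blk. real_of_int (\<eta> k) *\<^sub>R blk ! k) = w + t *\<^sub>R x \<and> w \<in> span (b ` {..<m}) \<and>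
        (\<forall>\<phi>\<in>\<Phi>. \<phi> w = 0) \<and> ((\<forall>\<psi>\<in>\<Psi>. \<bar>\<psi> w\<bar> \<le> 1) \<longrightarrow> \<bar>t\<bar> \<le> \<delta>)"
    if \<eta>: "\<forall>k. \<bar>\<eta> k\<bar> \<le> 1" for \<eta> :: "nat \<Rightarrow> int"
  proof -
    define K where "K = (\<Sum>k<N. \<eta> k)"
    define n where "n j = (\<Sum>l<P. \<eta> (N + j * P + l))" for j
    define t where "t = real_of_int K / N"
    define d where "d j = t * y j + n j" for j
    define w where "w = (\<Sum>j<m. (\<epsilon> * d j) *\<^sub>R b j)"
    have Kn: "\<bar>K\<bar> \<le> int N" "\<bar>n j\<bar> \<le> int P" for j
    proof -
      have "\<bar>K\<bar> \<le> (\<Sum>k<N. \<bar>\<eta> k\<bar>)" unfolding K_def by (rule sum_abs)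
      also have "\<dots> \<le> (\<Sum>k<N. 1)" using \<eta> by (intro sum_mono) auto
      finally show "\<bar>K\<bar> \<le> int N" by simp
      have "\<bar>n j\<bar> \<le> (\<Sum>l<P. \<bar>\<eta> (N + j * P + l)\<bar>)" unfolding n_def by (rule sum_abs)
      also have "\<dots> \<le> (\<Sum>l<P. 1)" using \<eta> by (intro sum_mono) auto
      finally show "\<bar>n j\<bar> \<le> int P" by simp
    qed
    have "(\<Sum>k<length blk. real_of_int (\<eta> k) *\<^sub>R blk ! k) = real_of_int K *\<^sub>R v0 + \<epsilon> *\<^sub>R (\<Sum>j<m. real_of_int (n j) *\<^sub>R b j)"
      by (simp add: S K_def n_def)
    also have "real_of_int K *\<^sub>R v0 = t *\<^sub>R x + \<epsilon> *\<^sub>R (\<Sum>j<m. (t * y j) *\<^sub>R b j)"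
      by (simp add: v0_def t_def scaleR_add_right scaleR_sum_right ac_simps)
    finally have eq: "(\<Sum>k<length blk. real_of_int (\<eta> k) *\<^sub>R blk ! k) = w + t *\<^sub>R x"
      by (simp add: w_def d_def scaleR_add_left sum.distrib scaleR_add_right scaleR_sum_right distrib_left)
    have "\<bar>t\<bar> \<le> \<delta>" if sm: "\<forall>\<psi>\<in>\<Psi>. \<bar>\<psi> w\<bar> \<le> 1"
    proof (rule ccontr)
      assume "\<not> ?thesis"
      then have t: "\<bar>t\<bar> > 1 / P" using P(2) by simp
      define k where "k = nat \<bar>K\<bar>"
      have kt: "real k / N = \<bar>t\<bar>" using N(3) by (simp add: k_def t_def)
      have "\<bar>t\<bar> > 0" using t by (meson divide_nonneg_nonneg less_le_trans not_less of_nat_0_le_iff zero_le_one order_le_less_trans)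
      then have "K \<noteq> 0" by (auto simp: t_def)
      then have k: "k \<in> {1..N}" using Kn(1) by (auto simp: k_def)
      \<comment> \<open>The gap concerns positive multiples k / N and subtracts the integer vector.
        Both signs are adjusted here; for negative K the vector d is replaced by -d, which has the
        same length under \<open>A\<close>.\<close>
      define n' where "n' j = - sgn K * n j" for j
      have n': "\<bar>n' j\<bar> \<le> int P" for j using Kn(2)[of j] by (auto simp: n'_def sgn_if)
      have "real k / N * y j - n' j = real_of_int (sgn K) * d j" for j
        using N(3) by (auto simp: kt d_def n'_def t_def sgn_if abs_if divide_less_0_iff algebra_simps)
      then have "(\<Sum>i<m. (mv m A (\<lambda>j. real k / N * y j - real_of_int (n' j)) i)\<^sup>2) = (\<Sum>i<m. (mv m A d i)\<^sup>2)"
        using \<open>K \<noteq> 0\<close> by (auto simp: mv_scale power_mult_distrib sgn_if)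
      moreover have "R\<^sup>2 < (\<Sum>i<m. (mv m A (\<lambda>j. real k / N * y j - real_of_int (n' j)) i)\<^sup>2)"
        using far[OF k] n' t kt by simp
      ultimately have 1: "R\<^sup>2 < (\<Sum>i<m. (mv m A d i)\<^sup>2)" by simp
      have "(\<Sum>i<m. (mv m A (\<lambda>j. \<epsilon> * d j) i)\<^sup>2) \<le> (2 * \<kappa>)\<^sup>2" using sm by (intro small) (simp add: w_def)
      then have "\<epsilon>\<^sup>2 * (\<Sum>i<m. (mv m A d i)\<^sup>2) \<le> (2 * \<kappa>)\<^sup>2"
        by (simp add: mv_scale power_mult_distrib sum_distrib_left)
      also have "(2 * \<kappa>)\<^sup>2 = \<epsilon>\<^sup>2 * R\<^sup>2" using \<epsilon> by (simp add: R_def power_divide)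
      finally show False using 1 \<epsilon> by simp
    qed
    moreover have "w \<in> span (b ` {..<m})" unfolding w_def by (intro span_sum span_scale span_base) auto
    moreover have "\<forall>\<phi>\<in>\<Phi>. \<phi> w = 0" unfolding w_def by (intro ballI kill) auto
    ultimately show ?thesis using eq by blast
  qed
  have "blk \<noteq> []" using len N(3) by auto
  then show ?thesis
    using \<Psi> mem c1 cx sep by (intro exI[of _ blk] exI[of _ "b ` {..<m}"] exI[of _ \<Psi>] conjI) auto
qed

section \<open>The series built from the blocks\<close>

text \<open>The span of \<open>W n\<close> contains x and the w-parts of the blocks before n, and
  \<Phi> n contains the functionals of the stages before n. A functional in \<Psi> n vanishes on
  \<open>W n\<close> and belongs to \<Phi> i for i > n, where it annihilates the w-part: it sees
  only its own block. Bounding \<Psi> n by the gauge of \<open>D n\<close> rather than of a fixed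
  disc covers every disc in which a rearrangement may converge. The bounds (1/2)^(n + 2) add up to
  1/2.\<close>

locale block_sequence =
  fixes B :: "'a::locally_convex_space set" and D :: "nat \<Rightarrow> 'a set" and x :: 'a
    and p f :: "'a \<Rightarrow> real" and blk :: "nat \<Rightarrow> 'a list" and W :: "nat \<Rightarrow> 'a set"
    and \<Phi> \<Psi> :: "nat \<Rightarrow> ('a \<Rightarrow> real) set"
  assumes B: "B \<in> bdd_discs" and D: "is_fundamental_system D" and BD: "\<And>n. B \<subseteq> D n"
    and p: "p \<in> cs" and px: "p x > 0" and f: "linear f" "\<And>y. \<bar>f y\<bar> \<le> p y" "f x = p x"
    and xB: "x \<in> B"
    and blk: "\<And>n. blk n \<noteq> []" "\<And>n v. v \<in> set (blk n) \<Longrightarrow> v \<in> span B"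
      "\<And>n v. v \<in> set (blk n) \<Longrightarrow> minkowski_gauge B v \<le> 1 / Suc n"
    and \<Psi>: "\<And>n \<psi>. \<psi> \<in> \<Psi> n \<Longrightarrow> linear \<psi>" "\<And>n \<psi> y. \<psi> \<in> \<Psi> n \<Longrightarrow> \<bar>\<psi> y\<bar> \<le> gauge_ext (D n) y"
      "\<And>n \<psi> w. \<psi> \<in> \<Psi> n \<Longrightarrow> w \<in> W n \<Longrightarrow> \<psi> w = 0"
    and xW: "x \<in> W 0" and fin: "f \<in> \<Phi> 0"
    and W_mono: "\<And>n. W n \<subseteq> W (Suc n)"
    and \<Phi>_Suc: "\<And>n. \<Phi> n \<union> \<Psi> n \<subseteq> \<Phi> (Suc n)"
    and x_comb: "\<And>n. \<exists>c. (\<forall>k. \<bar>c k\<bar> \<le> 1) \<and> x = (\<Sum>k<length (blk n). c k *\<^sub>R blk n ! k)"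
    and sep: "\<And>n \<eta>. (\<forall>k. \<bar>\<eta> k :: int\<bar> \<le> 1) \<Longrightarrow>
      \<exists>t w. (\<Sum>k<length (blk n). real_of_int (\<eta> k) *\<^sub>R blk n ! k) = w + t *\<^sub>R x \<and> w \<in> span (W (Suc n)) \<and>
        (\<forall>\<phi>\<in>\<Phi> n. \<phi> w = 0) \<and> ((\<forall>\<psi>\<in>\<Psi> n. \<bar>\<psi> w\<bar> \<le> 1) \<longrightarrow> \<bar>t\<bar> \<le> (1 / 2) ^ (n + 2))"
begin

lemma absconvex_B: "absconvex B" and bounded_B: "tvs_bounded B"
  using B by (auto simp: bdd_discs_def)

lemma disc_D: "absconvex (D n)" "tvs_bounded (D n)"
  using D by (auto simp: is_fundamental_system_def bdd_discs_def)

lemma D_mono: "m \<le> n \<Longrightarrow> D m \<subseteq> D n"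
  using D by (simp add: is_fundamental_system_def incseq_def)

section \<open>Concatenation of the blocks into one series\<close>

definition start :: "nat \<Rightarrow> nat" where
  "start n = (\<Sum>i<n. length (blk i))"

lemma start_Suc: "start (Suc n) = start n + length (blk n)"
  by (simp add: start_def)

lemma start_mono: "m \<le> n \<Longrightarrow> start m \<le> start n"
  unfolding start_def by (intro sum_mono2) auto

lemma le_start: "n \<le> start n"
proof (induction n)
  case (Suc n)
  have "1 \<le> length (blk n)" using blk(1)[of n] by (cases "blk n") auto
  then show ?case using Suc by (simp add: start_Suc)
qed simp

definition idx :: "nat \<Rightarrow> nat" where
  "idx k = (LEAST n. k < start (Suc n))"

lemma idx: "start (idx k) \<le> k" "k < start (Suc (idx k))"
proof -
  have "k < start (Suc k)" using le_start[of "Suc k"] by simp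
  then show 1: "k < start (Suc (idx k))" unfolding idx_def by (rule LeastI)
  show "start (idx k) \<le> k"
  proof (cases "idx k")
    case (Suc n)
    then have "\<not> k < start (Suc n)" using not_less_Least[of n "\<lambda>n. k < start (Suc n)"] by (simp add: idx_def)
    then show ?thesis using Suc by simp
  qed (simp add: start_def)
qed

lemma idx_ge: "start n \<le> k \<Longrightarrow> n \<le> idx k"
  using idx(2)[of k] start_mono[of "Suc (idx k)" n] by (metis not_less not_less_eq_eq order_less_le_trans)

lemma idx_eq:
  assumes "l < length (blk n)"
  shows "idx (start n + l) = n"
proof (rule antisym)
  have "start n + l < start (Suc n)" using assms by (simp add: start_Suc)
  then show "idx (start n + l) \<le> n" unfolding idx_def by (rule Least_le)
qed (simp add: idx_ge)

definition V :: "nat \<Rightarrow> 'a" where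
  "V k = blk (idx k) ! (k - start (idx k))"

lemma V_block: "l < length (blk n) \<Longrightarrow> V (start n + l) = blk n ! l"
  by (simp add: V_def idx_eq)

lemma V_in_blk: "V k \<in> set (blk (idx k))"
  unfolding V_def using idx[of k] by (intro nth_mem) (simp add: start_Suc)

text \<open>Each term is followed at once by its negative. So the partial sums are 0 or a single
  \<open>V k\<close>, which tends to 0 in the gauge of B, and finite subsums have coefficients -1,
  0, 1 on the \<open>V k\<close>.\<close>

definition u :: "nat \<Rightarrow> 'a" where
  "u k = (if even k then V (k div 2) else - V (k div 2))"

lemma u_simps: "u (2 * k) = V k" "u (Suc (2 * k)) = - V k"
  by (simp_all add: u_def)

lemma sum_blocks: "(\<Sum>k<start n. F k) = (\<Sum>i<n. \<Sum>l<length (blk i). F (start i + l))"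
  for F :: "nat \<Rightarrow> 'b::comm_monoid_add"
  by (induction n) (simp_all add: start_def[of 0] start_Suc sum_lessThan_add)

lemma sum_pairs: "(\<Sum>k<2 * n. F k) = (\<Sum>k<n. F (2 * k) + F (Suc (2 * k)))"
  for F :: "nat \<Rightarrow> 'b::comm_monoid_add"
  by (induction n) (simp_all add: add.assoc)

lemma partial_sum: "(\<Sum>k<n. u k) = (if even n then 0 else V (n div 2))"
  by (induction n) (auto simp: u_def)

lemma V_span: "V k \<in> span B"
  using blk(2)[OF V_in_blk] .

lemma u_span: "u k \<in> span B"
  using V_span by (simp add: u_def span_neg)

lemma gauge_V_tendsto: "(\<lambda>k. minkowski_gauge B (V k)) \<longlonglongrightarrow> 0"
proof (rule LIMSEQ_I)
  fix e :: real assume "e > 0"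
  then obtain n where n: "1 / Suc n < e" by (meson nat_approx_posE)
  have "norm (minkowski_gauge B (V k) - 0) < e" if "start n \<le> k" for k
  proof -
    have "minkowski_gauge B (V k) \<le> 1 / Suc (idx k)" using blk(3)[OF V_in_blk] .
    also have "\<dots> \<le> 1 / Suc n" using idx_ge[OF that] by (simp add: field_simps)
    finally show ?thesis using n gauge_nonneg[OF absconvex_B V_span[of k]] by simp
  qed
  then show "\<exists>N. \<forall>k\<ge>N. norm (minkowski_gauge B (V k) - 0) < e" by blast
qed

lemma gauge_partial_sum_tendsto: "(\<lambda>n. minkowski_gauge B (\<Sum>k<n. u k)) \<longlonglongrightarrow> 0"
proof -
  have g0: "minkowski_gauge B 0 = 0" using gauge_scale[OF absconvex_B span_zero, of 0] by simp
  have lim: "(\<lambda>n. minkowski_gauge B (V (n div 2))) \<longlonglongrightarrow> 0"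
  proof (rule filterlim_compose[OF gauge_V_tendsto])
    show "filterlim (\<lambda>n::nat. n div 2) at_top sequentially"
      unfolding filterlim_at_top
    proof
      fix Z :: nat
      show "eventually (\<lambda>n. Z \<le> n div 2) sequentially" by (rule eventually_sequentiallyI[of "2 * Z"]) simp
    qed
  qed
  have "0 \<le> minkowski_gauge B (\<Sum>k<n. u k) \<and> minkowski_gauge B (\<Sum>k<n. u k) \<le> minkowski_gauge B (V (n div 2))" for n
    using gauge_nonneg[OF absconvex_B V_span[of "n div 2"]] by (simp add: partial_sum g0)
  then show ?thesis
    by (intro tendsto_sandwich[OF _ _ tendsto_const lim]) auto
qed

lemma ns_sums_u: "ns_sums (E_sub_B B) u 0"
proof -
  have "(\<Sum>k<n. u k) \<in> span B" for n using u_span by (intro span_sum) auto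
  then show ?thesis
    using gauge_partial_sum_tendsto u_span
    by (simp add: ns_sums_def ns_tendsto_def ns_psum_E_sub_B) (simp add: E_sub_B_def span_zero)
qed

lemma u_sums: "u sums 0"
  unfolding sums_def
  by (rule tendsto_of_gauge[OF absconvex_B bounded_B])
    (use gauge_partial_sum_tendsto u_span in \<open>auto intro: span_sum\<close>)

text \<open>Every single block represents x with coefficients in [-1, 1]. Thus |g x| is at most the
  part of \<Sum> |g (u k)| that belongs to the n-th block, and this is arbitrarily small by the
  Cauchy criterion.\<close>

lemma functional_vanishes:
  assumes g: "g \<in> ns_dual (E_sub_B B)" and s: "summable (\<lambda>k. \<bar>g (u k)\<bar>)"
  shows "g x = 0"
proof (rule ccontr)
  assume "g x \<noteq> 0"
  then have "\<bar>g x\<bar> > 0" by simp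
  have add: "g (y + z) = g y + g z" if "y \<in> span B" "z \<in> span B" for y z
    using g that by (simp add: ns_dual_def E_sub_B_def)
  have scale: "g (c *\<^sub>R y) = c * g y" if "y \<in> span B" for y c
    using g that by (simp add: ns_dual_def E_sub_B_def)
  have g0: "g 0 = 0" using scale[OF span_zero, of 0] by simp
  have sum: "g (\<Sum>k<n. h k) = (\<Sum>k<n. g (h k))" if "\<And>k. k < n \<Longrightarrow> h k \<in> span B" for h and n :: nat
    using that
  proof (induction n)
    case (Suc n)
    have "(\<Sum>k<n. h k) \<in> span B" using Suc.prems by (intro span_sum) auto
    then show ?case using Suc by (simp add: add)
  qed (simp add: g0)
  obtain n where n: "\<And>m k. n \<le> m \<Longrightarrow> norm (\<Sum>i\<in>{m..<k}. \<bar>g (u i)\<bar>) < \<bar>g x\<bar>"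
    using s \<open>\<bar>g x\<bar> > 0\<close> unfolding summable_Cauchy by metis
  obtain c where c: "\<And>k. \<bar>c k\<bar> \<le> 1" "x = (\<Sum>k<length (blk n). c k *\<^sub>R blk n ! k)"
    using x_comb[of n] by blast
  have sp: "blk n ! k \<in> span B" if "k < length (blk n)" for k using blk(2)[OF nth_mem[OF that]] .
  have "\<bar>g x\<bar> = \<bar>\<Sum>k<length (blk n). c k * g (blk n ! k)\<bar>"
    by (subst c(2), subst sum) (auto simp: sp span_scale scale)
  also have "\<dots> \<le> (\<Sum>k<length (blk n). \<bar>c k * g (blk n ! k)\<bar>)" by (rule sum_abs)
  also have "\<dots> \<le> (\<Sum>k<length (blk n). \<bar>g (u (2 * (start n + k)))\<bar>)"
  proof (rule sum_mono)
    fix k assume "k \<in> {..<length (blk n)}"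
    then have "u (2 * (start n + k)) = blk n ! k" unfolding u_simps by (intro V_block) simp
    moreover have "\<bar>c k\<bar> * \<bar>g (blk n ! k)\<bar> \<le> 1 * \<bar>g (blk n ! k)\<bar>" using c(1) by (intro mult_right_mono) auto
    ultimately show "\<bar>c k * g (blk n ! k)\<bar> \<le> \<bar>g (u (2 * (start n + k)))\<bar>" by (simp add: abs_mult)
  qed
  also have "\<dots> = (\<Sum>i\<in>(\<lambda>k. 2 * (start n + k)) ` {..<length (blk n)}. \<bar>g (u i)\<bar>)"
    by (subst sum.reindex) (auto simp: inj_on_def)
  also have "\<dots> \<le> (\<Sum>i\<in>{2 * start n..<2 * start (Suc n)}. \<bar>g (u i)\<bar>)"
    by (intro sum_mono2) (auto simp: start_Suc)
  also have "\<dots> < \<bar>g x\<bar>"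
    using n[of "2 * start n" "2 * start (Suc n)"] le_start[of n] by simp
  finally show False by simp
qed

lemma x_in_Gamma: "x \<in> Gamma_loc u"
proof -
  have "x \<in> Gamma_perp B u"
    using functional_vanishes xB by (simp add: Gamma_perp_def) (simp add: E_sub_B_def span_base)
  then have "x \<in> Gamma_loc_from B u"
    using absconvex_B bounded_B by (auto simp: Gamma_loc_from_def)
  then show ?thesis using Gamma_loc_eq[OF B ns_sums_u] by simp
qed

text \<open>The partial sums \<open>g M\<close> would converge to x in the gauge of some C
  \<subseteq> D n. Take M so large that all blocks before n are used up and cancel. The tests of
  each later block j apply to y = g M - x and bound t_j by (1/2)^(j + 2), so x enters
  \<open>g M\<close> with total coefficient at most 1/2. But f annihilates all w-parts, and its
  value at y shows that this coefficient differs from 1 by less than 1/2.\<close>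

lemma rearrangement_not_sums_x:
  assumes loc: "\<And>s :: nat \<Rightarrow> 'a. convergent s \<Longrightarrow> converges_locally s"
    and \<pi>: "bij \<pi>" and sums: "(\<lambda>k. u (\<pi> k)) sums x"
  shows False
proof -
  define g where "g M = (\<Sum>k<M. u (\<pi> k))" for M
  have g: "g \<longlonglongrightarrow> x" using sums by (simp add: sums_def g_def[abs_def])
  then have "convergent g" by (auto simp: convergent_def)
  from loc[OF this] obtain C l where C: "C \<in> bdd_discs" "ns_tendsto (E_sub_B C) g l"
    by (auto simp: converges_locally_def)
  have Cd: "absconvex C" "tvs_bounded C" using C(1) by (auto simp: bdd_discs_def)
  have gC: "g M \<in> span C" "l \<in> span C" "(\<lambda>M. minkowski_gauge C (g M - l)) \<longlonglongrightarrow> 0" for M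
    using C(2) by (auto simp: ns_tendsto_def E_sub_B_def)
  have "g \<longlonglongrightarrow> l"
    by (rule tendsto_of_gauge[OF Cd _ gC(3)]) (intro span_diff gC(1,2))
  then have l: "l = x" using g LIMSEQ_unique by blast
  obtain n where n: "C \<subseteq> D n" using C(1) D by (auto simp: is_fundamental_system_def)
  have lim1: "(\<lambda>M. gauge_ext C (g M - x)) \<longlonglongrightarrow> 0"
    using gC(3) gauge_ext(2)[OF Cd(1) span_diff[OF gC(1,2)]] by (simp add: l)
  obtain K where K: "\<And>y. y \<in> C \<Longrightarrow> p y \<le> K" using cs_bounded_on[OF Cd(2) p] by blast
  have lim2: "(\<lambda>M. K * minkowski_gauge C (g M - x)) \<longlonglongrightarrow> K * 0"
    using gC(3) by (intro tendsto_intros) (simp add: l)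
  have "eventually (\<lambda>M. gauge_ext C (g M - x) < 1) sequentially"
    using order_tendstoD(2)[OF lim1, of 1] by simp
  moreover have "eventually (\<lambda>M. K * minkowski_gauge C (g M - x) < p x / 2) sequentially"
    using order_tendstoD(2)[OF lim2, of "p x / 2"] px by simp
  \<comment> \<open>The blocks before n occupy the first 2 * start n terms, two for each
    \<open>V k\<close>.\<close>
  moreover have "eventually (\<lambda>M. {..<2 * start n} \<subseteq> \<pi> ` {..<M}) sequentially"
  proof (rule eventually_sequentiallyI)
    fix M assume M: "Suc (Max (insert 0 (inv_into UNIV \<pi> ` {..<2 * start n}))) \<le> M"
    show "{..<2 * start n} \<subseteq> \<pi> ` {..<M}"
    proof
      fix k assume k: "k \<in> {..<2 * start n}"
      have "inv_into UNIV \<pi> k \<le> Max (insert 0 (inv_into UNIV \<pi> ` {..<2 * start n}))" using k by (intro Max_ge) auto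
      then have "inv_into UNIV \<pi> k < M" using M by simp
      moreover have "k = \<pi> (inv_into UNIV \<pi> k)" using \<pi> by (simp add: bij_is_surj surj_f_inv_f)
      ultimately show "k \<in> \<pi> ` {..<M}" by blast
    qed
  qed
  ultimately have "eventually (\<lambda>M. gauge_ext C (g M - x) < 1 \<and> K * minkowski_gauge C (g M - x) < p x / 2 \<and>
      {..<2 * start n} \<subseteq> \<pi> ` {..<M}) sequentially"
    by eventually_elim auto
  then obtain M where M: "gauge_ext C (g M - x) < 1" "K * minkowski_gauge C (g M - x) < p x / 2"
    "{..<2 * start n} \<subseteq> \<pi> ` {..<M}"
    unfolding eventually_sequentially by blast
  define y where "y = g M - x"
  have yC: "y \<in> span C" using gC(1,2) l by (simp add: y_def span_diff)
  have py: "p y < p x / 2"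
    using seminorm_le_gauge[OF csD(1)[OF p] Cd(1) K yC] M(2) by (simp add: y_def)
  define J where "J = \<pi> ` {..<M}"
  have gJ: "g M = (\<Sum>i\<in>J. u i)"
    unfolding g_def J_def using \<pi> by (subst sum.reindex) (auto simp: bij_def intro: inj_on_subset)
  define H where "H = n + Suc (Max (insert 0 J))"
  have finJ: "finite J" by (simp add: J_def)
  have JH: "J \<subseteq> {..<2 * start H}"
  proof
    fix i assume "i \<in> J"
    then have "i \<le> Max (insert 0 J)" using finJ by (intro Max_ge) auto
    then show "i \<in> {..<2 * start H}" using le_start[of H] by (simp add: H_def)
  qed
  \<comment> \<open>The coefficient of \<open>V k\<close> in \<open>g M\<close>; it is 0 if both or
    none of the pair have been used.\<close>
  define \<eta> where "\<eta> k = (if 2 * k \<in> J then 1 else 0) - (if Suc (2 * k) \<in> J then 1 else (0 :: int))" for k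
  have \<eta>1: "\<bar>\<eta> k\<bar> \<le> 1" for k by (simp add: \<eta>_def)
  have "g M = (\<Sum>i<2 * start H. (if i \<in> J then u i else 0))"
    unfolding gJ using JH by (simp add: sum.inter_restrict[symmetric] Int_absorb1 flip: sum.inter_filter)
  also have "\<dots> = (\<Sum>k<start H. real_of_int (\<eta> k) *\<^sub>R V k)"
    unfolding sum_pairs by (intro sum.cong refl) (simp add: u_simps \<eta>_def)
  also have "\<dots> = (\<Sum>i<H. \<Sum>l<length (blk i). real_of_int (\<eta> (start i + l)) *\<^sub>R V (start i + l))"
    by (rule sum_blocks)
  also have "\<dots> = (\<Sum>i<H. \<Sum>l<length (blk i). real_of_int (\<eta> (start i + l)) *\<^sub>R blk i ! l)"
    by (intro sum.cong refl) (simp add: V_block)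
  also have "\<dots> = (\<Sum>i\<in>{n..<H}. \<Sum>l<length (blk i). real_of_int (\<eta> (start i + l)) *\<^sub>R blk i ! l)"
  proof (rule sum.mono_neutral_right)
    have "\<eta> (start i + l) = 0" if "i < n" "l < length (blk i)" for i l
    proof -
      have "start i + l < start (Suc i)" using that by (simp add: start_Suc)
      also have "start (Suc i) \<le> start n" using that by (intro start_mono) simp
      finally have "2 * (start i + l) \<in> J" "Suc (2 * (start i + l)) \<in> J"
        using M(3) by (auto simp: J_def subset_iff)
      then show ?thesis by (simp add: \<eta>_def)
    qed
    then show "\<forall>i\<in>{..<H} - {n..<H}. (\<Sum>l<length (blk i). real_of_int (\<eta> (start i + l)) *\<^sub>R blk i ! l) = 0"
      by (auto intro!: sum.neutral)
  qed auto
  finally have gM: "g M = (\<Sum>i\<in>{n..<H}. \<Sum>l<length (blk i). real_of_int (\<eta> (start i + l)) *\<^sub>R blk i ! l)" .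
  have "\<forall>i. \<exists>t w. (\<Sum>l<length (blk i). real_of_int (\<eta> (start i + l)) *\<^sub>R blk i ! l) = w + t *\<^sub>R x \<and>
      w \<in> span (W (Suc i)) \<and> (\<forall>\<phi>\<in>\<Phi> i. \<phi> w = 0) \<and> ((\<forall>\<psi>\<in>\<Psi> i. \<bar>\<psi> w\<bar> \<le> 1) \<longrightarrow> \<bar>t\<bar> \<le> (1 / 2) ^ (i + 2))"
    by (intro allI sep \<eta>1)
  then obtain t w where tw: "\<And>i. (\<Sum>l<length (blk i). real_of_int (\<eta> (start i + l)) *\<^sub>R blk i ! l) = w i + t i *\<^sub>R x"
    and wW: "\<And>i. w i \<in> span (W (Suc i))" and w\<Phi>: "\<And>i \<phi>. \<phi> \<in> \<Phi> i \<Longrightarrow> \<phi> (w i) = 0"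
    and t: "\<And>i. (\<forall>\<psi>\<in>\<Psi> i. \<bar>\<psi> (w i)\<bar> \<le> 1) \<Longrightarrow> \<bar>t i\<bar> \<le> (1 / 2) ^ (i + 2)"
    by metis
  have y: "y = (\<Sum>i\<in>{n..<H}. w i) + ((\<Sum>i\<in>{n..<H}. t i) - 1) *\<^sub>R x"
    unfolding y_def gM tw by (simp add: sum.distrib scaleR_sum_left scaleR_diff_left)
  have \<Phi>_mono: "\<Phi> i \<union> \<Psi> i \<subseteq> \<Phi> j" if "i < j" for i j
    using that
  proof (induction j)
    case (Suc j)
    then show ?case using \<Phi>_Suc[of j] by (cases "i = j") auto
  qed simp
  have W_mono': "W i \<subseteq> W j" if "i \<le> j" for i j using lift_Suc_mono_le[of W, OF W_mono that] .
  have eval: "h y = (\<Sum>i\<in>{n..<H}. h (w i)) + ((\<Sum>i\<in>{n..<H}. t i) - 1) * h x" if "linear h" for h :: "'a \<Rightarrow> real"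
    unfolding y by (simp add: linear_add[OF that] linear_sum[OF that] linear_scale[OF that])
  have geo: "(\<Sum>i<k. (1 / 2 :: real) ^ (i + 2)) = 1 / 2 - (1 / 2) ^ (k + 1)" for k :: nat
    by (induction k) simp_all
  \<comment> \<open>In \<psi> y only the j-th block survives, so \<psi> (w j) = \<psi> y, and \<psi>
    is bounded by the gauge of D j \<supseteq> C, which is below 1 at y.\<close>
  have "\<bar>t j\<bar> \<le> (1 / 2) ^ (j + 2)" if j: "j \<in> {n..<H}" for j
  proof (rule t, rule ballI)
    fix \<psi> assume \<psi>: "\<psi> \<in> \<Psi> j"
    have "\<psi> x = 0" using \<Psi>(3)[OF \<psi>] xW W_mono'[of 0 j] by blast
    moreover have "(\<Sum>i\<in>{n..<H}. \<psi> (w i)) = (\<Sum>i\<in>{j}. \<psi> (w i))"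
    proof (rule sum.mono_neutral_right)
      show "\<forall>i\<in>{n..<H} - {j}. \<psi> (w i) = 0"
      proof
        fix i assume i: "i \<in> {n..<H} - {j}"
        show "\<psi> (w i) = 0"
        proof (cases "i < j")
          case True
          then have "w i \<in> span (W j)" using wW[of i] span_mono[OF W_mono'[of "Suc i" j]] by auto
          then show ?thesis using linear_eq_0_on_span[OF \<Psi>(1)[OF \<psi>] \<Psi>(3)[OF \<psi>]] by blast
        next
          case False
          then have "\<psi> \<in> \<Phi> i" using i \<Phi>_mono[of j i] \<psi> by auto
          then show ?thesis by (rule w\<Phi>)
        qed
      qed
    qed (use j in auto)
    ultimately have "\<psi> (w j) = \<psi> y" using eval[OF \<Psi>(1)[OF \<psi>]] by simp
    moreover have "\<bar>\<psi> y\<bar> \<le> gauge_ext (D j) y" by (rule \<Psi>(2)[OF \<psi>])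
    moreover have "gauge_ext (D j) y \<le> gauge_ext C y"
      using n D_mono[of n j] j by (intro gauge_ext_antimono[OF Cd(1) disc_D(1) _ yC]) auto
    ultimately show "\<bar>\<psi> (w j)\<bar> \<le> 1" using M(1) by (simp add: y_def)
  qed
  then have "\<bar>\<Sum>i\<in>{n..<H}. t i\<bar> \<le> (\<Sum>i\<in>{n..<H}. (1 / 2) ^ (i + 2))"
    by (intro order_trans[OF sum_abs] sum_mono) auto
  also have "\<dots> \<le> (\<Sum>i<H. (1 / 2) ^ (i + 2))" by (intro sum_mono2) auto
  also have "\<dots> = 1 / 2 - (1 / 2) ^ (H + 1)" by (rule geo)
  also have "\<dots> \<le> (1 / 2 :: real)" by simp
  finally have T: "\<bar>\<Sum>i\<in>{n..<H}. t i\<bar> \<le> 1 / 2" .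
  have "f (w i) = 0" for i
  proof -
    have "f \<in> \<Phi> i" using fin \<Phi>_mono[of 0 i] by (cases "i = 0") auto
    then show ?thesis by (rule w\<Phi>)
  qed
  then have "f y = ((\<Sum>i\<in>{n..<H}. t i) - 1) * p x" using eval[OF f(1)] f(3) by simp
  then have "\<bar>f y\<bar> = \<bar>(\<Sum>i\<in>{n..<H}. t i) - 1\<bar> * p x" using px by (simp add: abs_mult)
  then have "\<bar>(\<Sum>i\<in>{n..<H}. t i) - 1\<bar> * p x < 1 / 2 * p x"
    using f(2)[of y] py by linarith
  then have "\<bar>(\<Sum>i\<in>{n..<H}. t i) - 1\<bar> < 1 / 2" using px by (simp only: mult_less_cancel_right_pos)
  then show False using T by linarith
qed

end

text \<open>Dependent choice of the blocks: richness against the gauge of \<open>D n\<close>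
  supplies the n-th one, subject to the finitely many vectors and functionals gathered so far. The
  point x is fixed at the outset, as all blocks must represent the same one.\<close>

lemma rich_disc_contradiction:
  fixes B :: "'a::locally_convex_space set" and D :: "nat \<Rightarrow> 'a set"
  assumes B: "B \<in> bdd_discs" and D: "is_fundamental_system D" and BD: "\<And>n. B \<subseteq> D n"
    and rich: "\<And>n. lattice_rich B (gauge_ext (D n))"
    and loc: "\<And>s :: nat \<Rightarrow> 'a. convergent s \<Longrightarrow> converges_locally s"
    and sums: "\<And>u :: nat \<Rightarrow> 'a. summable u \<Longrightarrow>
      domain_of_sums u = (\<lambda>x. (\<Sum>k. u k) + x) ` Gamma_loc u"
  shows False
proof -
  have Bd: "absconvex B" "tvs_bounded B" using B by (auto simp: bdd_discs_def)
  have Dd: "absconvex (D n)" for n using D by (auto simp: is_fundamental_system_def bdd_discs_def)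
  have s: "is_seminorm (gauge_ext (D n))" "\<And>y. y \<in> B \<Longrightarrow> gauge_ext (D n) y \<le> 1" for n
    using gauge_ext(1)[OF Dd] gauge_ext_le_1[OF Dd] BD by blast+
  \<comment> \<open>Richness provides a nonzero point of B: with b_0 = 0 the contraction would have
    A 0 0 = 0.\<close>
  obtain x where x: "x \<in> B" "x \<noteq> 0"
  proof -
    have "\<exists>m b A. m \<ge> 1 \<and> (1 :: real)\<^sup>2 < m \<and> (\<forall>j<m. b j \<in> B) \<and> (\<forall>j<m. \<forall>\<phi>\<in>({} :: ('a \<Rightarrow> real) set). \<phi> (b j) = 0) \<and>
        contr m A (\<lambda>c. gauge_ext (D 0) (\<Sum>j<m. c j *\<^sub>R b j)) \<and> (\<forall>i<m. \<forall>j<i. A i j = 0) \<and>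
        (\<forall>i<m. A i i \<noteq> 0) \<and> (1 / sqrt m) ^ m < (\<Prod>i<m. \<bar>A i i\<bar>)"
      by (rule lattice_rich_triangular[OF rich s(2) s(1)]) auto
    then obtain m b A where m: "m \<ge> 1" "\<forall>j<m. b j \<in> B" "contr m A (\<lambda>c. gauge_ext (D 0) (\<Sum>j<m. c j *\<^sub>R b j))"
      "\<forall>i<m. A i i \<noteq> 0" by blast
    have "b 0 \<noteq> 0"
    proof
      assume b0: "b 0 = 0"
      let ?e = "\<lambda>i. if i = 0 then 1 else (0 :: real)"
      have "(A 0 0)\<^sup>2 = (mv m A ?e 0)\<^sup>2" using m(1) by (simp add: mv_unit)
      also have "\<dots> \<le> (\<Sum>i<m. (mv m A ?e i)\<^sup>2)"
        using m(1) by (intro member_le_sum[of 0 "{..<m}" "\<lambda>i. (mv m A ?e i)\<^sup>2"]) auto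
      also have "\<dots> \<le> (gauge_ext (D 0) (\<Sum>j<m. ?e j *\<^sub>R b j))\<^sup>2" using m(3) by (simp add: contr_def)
      also have "(\<Sum>j<m. ?e j *\<^sub>R b j) = 0" using b0 by (intro sum.neutral) auto
      finally show False using m(1,4) by (simp add: seminorm_zero[OF s(1)])
    qed
    then show ?thesis using that m(1,2) by fastforce
  qed
  obtain p where p: "p \<in> cs" "p x > 0" using cs_separates[OF x(2)] by blast
  \<comment> \<open>For Z = {} the distance is p itself, so f is the usual norming functional of
    x.\<close>
  have "\<exists>f. linear f \<and> (\<forall>y. \<bar>f y\<bar> \<le> sdist p {} y) \<and> f x = sdist p {} x"
    by (rule functional_attaining_sdist[OF csD(1)[OF p(1)]])
  moreover have "sdist p {} y = p y" for y by (simp add: sdist_def)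
  ultimately obtain f where f: "linear f" "\<And>y. \<bar>f y\<bar> \<le> p y" "f x = p x" by auto
  \<comment> \<open>A state consists of a block, W, \<Phi> and \<Psi>. The n-th block and \<Psi> n
    are stored in state n + 1, being made from the W and \<Phi> of state n; the block and \<Psi> of
    state 0 are dummies.\<close>
  define P where "P n st \<longleftrightarrow> (case st of (blk :: 'a list, W, \<Phi>, \<Psi> :: ('a \<Rightarrow> real) set) \<Rightarrow>
      finite W \<and> finite \<Phi> \<and> (\<forall>\<phi>\<in>\<Phi>. linear \<phi> \<and> (\<exists>K. \<forall>y\<in>B. \<bar>\<phi> y\<bar> \<le> K)) \<and> (n = (0::nat) \<longrightarrow> x \<in> W \<and> f \<in> \<Phi>))" for n st
  define Q where "Q n st st' \<longleftrightarrow> (case st of (_ :: 'a list, W, \<Phi>, _ :: ('a \<Rightarrow> real) set) \<Rightarrow> case st' of (blk, W', \<Phi>', \<Psi>) \<Rightarrow>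
      blk \<noteq> [] \<and> (\<forall>v\<in>set blk. v \<in> span B \<and> minkowski_gauge B v \<le> 1 / Suc n) \<and>
      (\<forall>\<psi>\<in>\<Psi>. linear \<psi> \<and> (\<forall>y. \<bar>\<psi> y\<bar> \<le> gauge_ext (D n) y) \<and> (\<forall>w\<in>W. \<psi> w = 0)) \<and>
      W \<subseteq> W' \<and> \<Phi> \<union> \<Psi> \<subseteq> \<Phi>' \<and>
      (\<exists>c. (\<forall>k. \<bar>c k\<bar> \<le> 1) \<and> x = (\<Sum>k<length blk. c k *\<^sub>R blk ! k)) \<and>
      (\<forall>\<eta> :: nat \<Rightarrow> int. (\<forall>k. \<bar>\<eta> k\<bar> \<le> 1) \<longrightarrow>
        (\<exists>t w. (\<Sum>k<length blk. real_of_int (\<eta> k) *\<^sub>R blk ! k) = w + t *\<^sub>R x \<and> w \<in> span W' \<and>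
        (\<forall>\<phi>\<in>\<Phi>. \<phi> w = 0) \<and> ((\<forall>\<psi>\<in>\<Psi>. \<bar>\<psi> w\<bar> \<le> 1) \<longrightarrow> \<bar>t\<bar> \<le> (1 / 2) ^ (n + 2)))))" for n st st'
  have "\<exists>st. \<forall>n. P n (st n) \<and> Q n (st n) (st (Suc n))"
  proof (rule dependent_nat_choice)
    obtain K where "\<forall>y\<in>B. p y \<le> K" using cs_bounded_on[OF Bd(2) p(1)] by blast
    then have "\<forall>y\<in>B. \<bar>f y\<bar> \<le> K" using f(2) order_trans by blast
    then have "P 0 ([], {x}, {f}, {})" using f(1) by (auto simp: P_def)
    then show "\<exists>st. P 0 st" ..
  next
    fix st n assume Pst: "P n st"
    obtain blk0 W \<Phi> \<Psi>0 where st: "st = (blk0, W, \<Phi>, \<Psi>0)" by (cases st)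
    have st': "finite W" "finite \<Phi>" "\<And>\<phi>. \<phi> \<in> \<Phi> \<Longrightarrow> linear \<phi>" "\<And>\<phi>. \<phi> \<in> \<Phi> \<Longrightarrow> \<exists>K. \<forall>y\<in>B. \<bar>\<phi> y\<bar> \<le> K"
      using Pst by (auto simp: P_def st)
    have ex: "\<exists>blk ws \<Psi>. blk \<noteq> [] \<and> finite ws \<and> finite \<Psi> \<and>
      (\<forall>v\<in>set blk. v \<in> span B \<and> minkowski_gauge B v \<le> 1 / Suc n) \<and>
      (\<forall>\<psi>\<in>\<Psi>. linear \<psi> \<and> (\<forall>y. \<bar>\<psi> y\<bar> \<le> gauge_ext (D n) y) \<and> (\<forall>w\<in>W. \<psi> w = 0)) \<and>
      (\<exists>c. (\<forall>k. \<bar>c k\<bar> \<le> 1) \<and> x = (\<Sum>k<length blk. c k *\<^sub>R blk ! k)) \<and>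
      (\<forall>\<eta> :: nat \<Rightarrow> int. (\<forall>k. \<bar>\<eta> k\<bar> \<le> 1) \<longrightarrow>
        (\<exists>t w. (\<Sum>k<length blk. real_of_int (\<eta> k) *\<^sub>R blk ! k) = w + t *\<^sub>R x \<and> w \<in> span ws \<and>
          (\<forall>\<phi>\<in>\<Phi>. \<phi> w = 0) \<and> ((\<forall>\<psi>\<in>\<Psi>. \<bar>\<psi> w\<bar> \<le> 1) \<longrightarrow> \<bar>t\<bar> \<le> (1 / 2) ^ (n + 2))))"
      by (rule block_exists[OF Bd(1) rich s(1) s(2) span_base[OF x(1)] st']) auto
    obtain blk ws \<Psi> where new: "blk \<noteq> []" "finite ws" "finite \<Psi>"
      "\<forall>v\<in>set blk. v \<in> span B \<and> minkowski_gauge B v \<le> 1 / Suc n"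
      "\<forall>\<psi>\<in>\<Psi>. linear \<psi> \<and> (\<forall>y. \<bar>\<psi> y\<bar> \<le> gauge_ext (D n) y) \<and> (\<forall>w\<in>W. \<psi> w = 0)"
      "\<exists>c. (\<forall>k. \<bar>c k\<bar> \<le> 1) \<and> x = (\<Sum>k<length blk. c k *\<^sub>R blk ! k)"
      and sep: "\<forall>\<eta> :: nat \<Rightarrow> int. (\<forall>k. \<bar>\<eta> k\<bar> \<le> 1) \<longrightarrow>
        (\<exists>t w. (\<Sum>k<length blk. real_of_int (\<eta> k) *\<^sub>R blk ! k) = w + t *\<^sub>R x \<and> w \<in> span ws \<and>
          (\<forall>\<phi>\<in>\<Phi>. \<phi> w = 0) \<and> ((\<forall>\<psi>\<in>\<Psi>. \<bar>\<psi> w\<bar> \<le> 1) \<longrightarrow> \<bar>t\<bar> \<le> (1 / 2) ^ (n + 2)))"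
    proof -
      from ex show ?thesis by (elim exE) (elim conjE, rule that)
    qed
    have "\<exists>K. \<forall>y\<in>B. \<bar>\<psi> y\<bar> \<le> K" if "\<psi> \<in> \<Psi>" for \<psi>
      using new(5) s(2)[of _ n] that by (meson order_trans)
    then have "P (Suc n) (blk, W \<union> ws, \<Phi> \<union> \<Psi>, \<Psi>)"
      using new(2,3,5) st' by (auto simp: P_def)
    moreover have "Q n st (blk, W \<union> ws, \<Phi> \<union> \<Psi>, \<Psi>)"
    proof -
      have "span ws \<subseteq> span (W \<union> ws)" by (rule span_mono) simp
      then have "\<forall>\<eta> :: nat \<Rightarrow> int. (\<forall>k. \<bar>\<eta> k\<bar> \<le> 1) \<longrightarrow>
        (\<exists>t w. (\<Sum>k<length blk. real_of_int (\<eta> k) *\<^sub>R blk ! k) = w + t *\<^sub>R x \<and> w \<in> span (W \<union> ws) \<and>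
          (\<forall>\<phi>\<in>\<Phi>. \<phi> w = 0) \<and> ((\<forall>\<psi>\<in>\<Psi>. \<bar>\<psi> w\<bar> \<le> 1) \<longrightarrow> \<bar>t\<bar> \<le> (1 / 2) ^ (n + 2)))"
        using sep by (meson subsetD)
      then show ?thesis unfolding Q_def st using new by simp
    qed
    ultimately show "\<exists>st'. P (Suc n) st' \<and> Q n st st'" by blast
  qed
  then obtain st where st: "\<And>n. P n (st n)" "\<And>n. Q n (st n) (st (Suc n))" by blast
  define blk where "blk n = fst (st (Suc n))" for n
  define W where "W n = fst (snd (st n))" for n
  define \<Phi> where "\<Phi> n = fst (snd (snd (st n)))" for n
  define \<Psi> where "\<Psi> n = snd (snd (snd (st (Suc n))))" for n
  have q: "blk n \<noteq> []" "\<forall>v\<in>set (blk n). v \<in> span B \<and> minkowski_gauge B v \<le> 1 / Suc n"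
    "\<forall>\<psi>\<in>\<Psi> n. linear \<psi> \<and> (\<forall>y. \<bar>\<psi> y\<bar> \<le> gauge_ext (D n) y) \<and> (\<forall>w\<in>W n. \<psi> w = 0)"
    "W n \<subseteq> W (Suc n)" "\<Phi> n \<union> \<Psi> n \<subseteq> \<Phi> (Suc n)"
    "\<exists>c. (\<forall>k. \<bar>c k\<bar> \<le> 1) \<and> x = (\<Sum>k<length (blk n). c k *\<^sub>R blk n ! k)"
    "\<forall>\<eta> :: nat \<Rightarrow> int. (\<forall>k. \<bar>\<eta> k\<bar> \<le> 1) \<longrightarrow>
        (\<exists>t w. (\<Sum>k<length (blk n). real_of_int (\<eta> k) *\<^sub>R blk n ! k) = w + t *\<^sub>R x \<and> w \<in> span (W (Suc n)) \<and>
        (\<forall>\<phi>\<in>\<Phi> n. \<phi> w = 0) \<and> ((\<forall>\<psi>\<in>\<Psi> n. \<bar>\<psi> w\<bar> \<le> 1) \<longrightarrow> \<bar>t\<bar> \<le> (1 / 2) ^ (n + 2)))" for n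
    using st(2)[of n] unfolding Q_def blk_def W_def \<Phi>_def \<Psi>_def case_prod_unfold by blast+
  have q0: "x \<in> W 0" "f \<in> \<Phi> 0" using st(1)[of 0] unfolding P_def W_def \<Phi>_def case_prod_unfold by blast+
  have b: "\<And>n v. v \<in> set (blk n) \<Longrightarrow> v \<in> span B" "\<And>n v. v \<in> set (blk n) \<Longrightarrow> minkowski_gauge B v \<le> 1 / Suc n"
    using q(2) by blast+
  have \<psi>: "\<And>n \<psi>. \<psi> \<in> \<Psi> n \<Longrightarrow> linear \<psi>" "\<And>n \<psi> y. \<psi> \<in> \<Psi> n \<Longrightarrow> \<bar>\<psi> y\<bar> \<le> gauge_ext (D n) y"
      "\<And>n \<psi> w. \<psi> \<in> \<Psi> n \<Longrightarrow> w \<in> W n \<Longrightarrow> \<psi> w = 0"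
    using q(3) by blast+
  have sep: "\<exists>t w. (\<Sum>k<length (blk n). real_of_int (\<eta> k) *\<^sub>R blk n ! k) = w + t *\<^sub>R x \<and> w \<in> span (W (Suc n)) \<and>
      (\<forall>\<phi>\<in>\<Phi> n. \<phi> w = 0) \<and> ((\<forall>\<psi>\<in>\<Psi> n. \<bar>\<psi> w\<bar> \<le> 1) \<longrightarrow> \<bar>t\<bar> \<le> (1 / 2) ^ (n + 2))"
    if "\<forall>k. \<bar>\<eta> k\<bar> \<le> 1" for n and \<eta> :: "nat \<Rightarrow> int" using q(7)[of n] that by blast
  interpret block_sequence B D x p f blk W \<Phi> \<Psi>
    by (rule block_sequence.intro) (fact B D BD p f x(1) q(1) b \<psi> q0 q(4-6) sep)+
  have "domain_of_sums u = (\<lambda>x. (\<Sum>k. u k) + x) ` Gamma_loc u"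
    using u_sums by (intro sums) (auto simp: summable_def)
  then have "x \<in> domain_of_sums u"
    using x_in_Gamma sums_unique[OF u_sums] by (auto intro!: image_eqI[of _ _ x])
  then show False using rearrangement_not_sums_x[OF loc] by (auto simp: domain_of_sums_def)
qed

section \<open>Kolmogorov numbers\<close>

lemma dt_scale: "dt m (\<lambda>i j. r * A i j) = r ^ m * dt m A"
  using dt_scale_rows[of m "\<lambda>_. r" A] by simp

lemma is_seminorm_coords:
  assumes "is_seminorm s"
  shows "s (\<Sum>j<m. (r * c j) *\<^sub>R b j) = \<bar>r\<bar> * s (\<Sum>j<m. c j *\<^sub>R b j)"
proof -
  have "(\<Sum>j<m. (r * c j) *\<^sub>R b j) = r *\<^sub>R (\<Sum>j<m. c j *\<^sub>R b j)" by (simp add: scaleR_sum_right)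
  then show ?thesis using assms by (simp add: seminorm_scale)
qed

text \<open>Dvoretzky-Rogers for the gauge of C with \<delta> = (L / sqrt m)^m: small determinants
  of contractions mean large coefficient determinants for points of C. Halving brings the gauge
  below 1, hence the points into C itself, and turns 7 into 14.\<close>

lemma poor_lattice_step:
  fixes B C :: "'a::real_vector set" and b :: "nat \<Rightarrow> 'a"
  assumes C: "absconvex C" and BC: "B \<subseteq> C" and m: "m \<ge> 1" and L: "L > 0"
    and b: "\<And>j. j < m \<Longrightarrow> b j \<in> B"
    and poor: "\<And>A. contr m A (\<lambda>c. gauge_ext C (\<Sum>j<m. c j *\<^sub>R b j)) \<Longrightarrow> \<bar>dt m A\<bar> \<le> (L / sqrt m) ^ m"
    and A0: "contr m A0 (\<lambda>c. gauge_ext C (\<Sum>j<m. c j *\<^sub>R b j))" "dt m A0 \<noteq> 0"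
  shows "\<exists>Y. (\<forall>k<m. (\<Sum>j<m. Y j k *\<^sub>R b j) \<in> C) \<and> (sqrt m / (14 * L)) ^ m \<le> \<bar>dt m Y\<bar>"
proof -
  have s: "is_seminorm (gauge_ext C)" by (rule gauge_ext(1)[OF C])
  have "\<exists>X. (\<forall>k<m. gauge_ext C (\<Sum>j<m. X j k *\<^sub>R b j) \<le> 1) \<and> (1 / 7) ^ m \<le> \<bar>dt m X\<bar> * (L / sqrt m) ^ m"
    by (rule dvoretzky_rogers[where s = "\<lambda>c. gauge_ext C (\<Sum>j<m. c j *\<^sub>R b j)", OF is_seminorm_coords[OF s] seminorm_nonneg[OF s] A0 poor])
  then obtain X where X: "\<And>k. k < m \<Longrightarrow> gauge_ext C (\<Sum>j<m. X j k *\<^sub>R b j) \<le> 1" "(1 / 7) ^ m \<le> \<bar>dt m X\<bar> * (L / sqrt m) ^ m"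
    by blast
  define Y where "Y j k = 1 / 2 * X j k" for j k
  have "(\<Sum>j<m. Y j k *\<^sub>R b j) \<in> C" if k: "k < m" for k
  proof (rule gauge_ext_less_1D[OF C])
    have "b j \<in> span C" if "j < m" for j using b[OF that] BC by (intro span_base) auto
    then show "(\<Sum>j<m. Y j k *\<^sub>R b j) \<in> span C" by (intro span_sum span_scale) auto
    have "gauge_ext C (\<Sum>j<m. Y j k *\<^sub>R b j) = \<bar>1 / 2\<bar> * gauge_ext C (\<Sum>j<m. X j k *\<^sub>R b j)"
      unfolding Y_def by (rule is_seminorm_coords[OF s])
    then show "gauge_ext C (\<Sum>j<m. Y j k *\<^sub>R b j) < 1" using X(1)[OF k] by simp
  qed
  moreover have "(sqrt m / (14 * L)) ^ m \<le> \<bar>dt m Y\<bar>"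
  proof -
    have "dt m Y = (1 / 2) ^ m * dt m X" unfolding Y_def[abs_def] by (rule dt_scale)
    then have dY: "\<bar>dt m Y\<bar> = (1 / 2) ^ m * \<bar>dt m X\<bar>" by (simp add: abs_mult)
    have e: "(sqrt m / (14 * L)) = (1 / 2) * ((1 / 7) * (sqrt m / L))" using L by simp
    have "(sqrt m / (14 * L)) ^ m = (1 / 2) ^ m * ((1 / 7) ^ m * (sqrt m / L) ^ m)"
      unfolding e power_mult_distrib by simp
    also have "\<dots> \<le> (1 / 2) ^ m * (\<bar>dt m X\<bar> * (L / sqrt m) ^ m * (sqrt m / L) ^ m)"
      using X(2) L by (intro mult_left_mono mult_right_mono) auto
    also have "(\<bar>dt m X\<bar> * (L / sqrt m) ^ m * (sqrt m / L) ^ m) = \<bar>dt m X\<bar>"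
    proof -
      have "(L / sqrt m) ^ m * (sqrt m / L) ^ m = 1"
        unfolding power_mult_distrib[symmetric] using L m by simp
      then show ?thesis by (simp add: mult.assoc)
    qed
    finally show ?thesis using dY by simp
  qed
  ultimately show ?thesis by blast
qed

text \<open>Each step replaces the points in \<open>C k\<close> by combinations in
  \<open>C (Suc k)\<close> with coefficient determinant at least (sqrt m / (14 L))^m, and det (f_i
  (b_j)) is multiplied by this determinant. After K steps p <= \<kappa> bounds the result trivially,
  so the original determinant was small. The combinations stay in the kernels of \<Phi>, which keeps
  \<open>poor\<close> applicable.\<close>

lemma det_decay:
  fixes C :: "nat \<Rightarrow> 'a::real_vector set" and \<Phi> :: "('a \<Rightarrow> real) set" and p :: "'a \<Rightarrow> real"
  assumes C: "\<And>k. absconvex (C k)" "\<And>k. C k \<subseteq> C (Suc k)"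
    and \<Phi>: "\<And>\<phi>. \<phi> \<in> \<Phi> \<Longrightarrow> linear \<phi>" and L: "L > 0"
    and poor: "\<And>k m b A. k < K \<Longrightarrow> m \<ge> 1 \<Longrightarrow> (\<And>j. j < m \<Longrightarrow> b j \<in> C k) \<Longrightarrow>
      (\<And>j \<phi>. j < m \<Longrightarrow> \<phi> \<in> \<Phi> \<Longrightarrow> \<phi> (b j) = 0) \<Longrightarrow>
      contr m A (\<lambda>c. gauge_ext (C (Suc k)) (\<Sum>j<m. c j *\<^sub>R b j)) \<Longrightarrow> \<bar>dt m A\<bar> \<le> (L / sqrt m) ^ m"
    and p: "is_seminorm p" and \<kappa>: "\<kappa> > 0" "\<And>y. y \<in> C K \<Longrightarrow> p y \<le> \<kappa>"
    and m: "m \<ge> 1" and b: "\<And>j. j < m \<Longrightarrow> b j \<in> C 0" "\<And>j \<phi>. j < m \<Longrightarrow> \<phi> \<in> \<Phi> \<Longrightarrow> \<phi> (b j) = 0"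
    and f: "\<And>i. i < m \<Longrightarrow> linear (f i)" "\<And>i y. i < m \<Longrightarrow> \<bar>f i y\<bar> \<le> p y"
  shows "((sqrt m / (14 * L)) ^ K) ^ m * \<bar>dt m (\<lambda>i j. f i (b j))\<bar> \<le> (m * \<kappa>) ^ m"
proof -
  define G where "G = dt m (\<lambda>i j. f i (b j))"
  have CK: "C k \<subseteq> C K" if "k \<le> K" for k using lift_Suc_mono_le[of C, OF C(2) that] .
  have main: "\<exists>b'. (\<forall>j<m. b' j \<in> C k) \<and> (\<forall>j<m. \<forall>\<phi>\<in>\<Phi>. \<phi> (b' j) = 0) \<and>
      ((sqrt m / (14 * L)) ^ k) ^ m * \<bar>G\<bar> \<le> \<bar>dt m (\<lambda>i j. f i (b' j))\<bar>" if "k \<le> K" "G \<noteq> 0" for k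
    using that(1)
  proof (induction k)
    case 0
    show ?case using b by (intro exI[of _ b]) (auto simp: G_def)
  next
    case (Suc k)
    then obtain b' where b': "\<And>j. j < m \<Longrightarrow> b' j \<in> C k" "\<And>j \<phi>. j < m \<Longrightarrow> \<phi> \<in> \<Phi> \<Longrightarrow> \<phi> (b' j) = 0"
      "((sqrt m / (14 * L)) ^ k) ^ m * \<bar>G\<bar> \<le> \<bar>dt m (\<lambda>i j. f i (b' j))\<bar>" by auto
    \<comment> \<open>The functionals themselves furnish the nonsingular contraction that
      Dvoretzky-Rogers starts from: m values bounded by p / (\<kappa> sqrt m) have Euclidean length
      at most p / \<kappa>, which is below the gauge.\<close>
    define A0 where "A0 i j = 1 / (\<kappa> * sqrt m) * f i (b' j)" for i j
    have span': "(\<Sum>j<m. c j *\<^sub>R b' j) \<in> span (C (Suc k))" for c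
      using b'(1) C(2)[of k] by (intro span_sum span_scale span_base) auto
    have "contr m A0 (\<lambda>c. gauge_ext (C (Suc k)) (\<Sum>j<m. c j *\<^sub>R b' j))"
      unfolding contr_def
    proof
      fix c
      let ?w = "\<Sum>j<m. c j *\<^sub>R b' j"
      have "p y \<le> \<kappa>" if "y \<in> C (Suc k)" for y using that CK[of "Suc k"] Suc.prems \<kappa>(2) by blast
      then have "p ?w \<le> \<kappa> * gauge_ext (C (Suc k)) ?w"
        using seminorm_le_gauge[OF p C(1) _ span'] gauge_ext(2)[OF C(1) span'] by simp
      then have pw: "p ?w / \<kappa> \<le> gauge_ext (C (Suc k)) ?w" using \<kappa>(1) by (simp add: divide_le_eq mult.commute)
      have "mv m A0 c i = 1 / (\<kappa> * sqrt m) * f i ?w" if "i < m" for i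
        by (simp add: mv_def A0_def linear_sum[OF f(1)[OF that]] linear_scale[OF f(1)[OF that]] sum_distrib_left ac_simps)
      then have "(\<Sum>i<m. (mv m A0 c i)\<^sup>2) = (\<Sum>i<m. (1 / (\<kappa> * sqrt m) * f i ?w)\<^sup>2)" by (intro sum.cong) auto
      also have "\<dots> \<le> (\<Sum>i<m. (p ?w / \<kappa>)\<^sup>2 / m)"
      proof (rule sum_mono)
        fix i assume "i \<in> {..<m}"
        then have "(f i ?w)\<^sup>2 \<le> (p ?w)\<^sup>2" using f(2)[of i ?w] by (simp add: abs_le_square_iff[symmetric] seminorm_nonneg[OF p])
        then have "(f i ?w)\<^sup>2 / (\<kappa>\<^sup>2 * m) \<le> (p ?w)\<^sup>2 / (\<kappa>\<^sup>2 * m)" by (intro divide_right_mono) auto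
        then show "(1 / (\<kappa> * sqrt m) * f i ?w)\<^sup>2 \<le> (p ?w / \<kappa>)\<^sup>2 / m"
          by (simp add: power_mult_distrib power_divide)
      qed
      also have "\<dots> = (p ?w / \<kappa>)\<^sup>2" using m by simp
      also have "\<dots> \<le> (gauge_ext (C (Suc k)) ?w)\<^sup>2"
        using pw \<kappa>(1) seminorm_nonneg[OF p] by (intro power_mono) auto
      finally show "(\<Sum>i<m. (mv m A0 c i)\<^sup>2) \<le> (gauge_ext (C (Suc k)) ?w)\<^sup>2" .
    qed
    moreover have "dt m A0 \<noteq> 0"
    proof -
      have "dt m A0 = (1 / (\<kappa> * sqrt m)) ^ m * dt m (\<lambda>i j. f i (b' j))"
        unfolding A0_def[abs_def] by (rule dt_scale)
      moreover have "0 < ((sqrt m / (14 * L)) ^ k) ^ m * \<bar>G\<bar>" using that(2) L m by simp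
      ultimately show ?thesis using b'(3) \<kappa>(1) m by auto
    qed
    ultimately have "\<exists>Y. (\<forall>l<m. (\<Sum>j<m. Y j l *\<^sub>R b' j) \<in> C (Suc k)) \<and> (sqrt m / (14 * L)) ^ m \<le> \<bar>dt m Y\<bar>"
      using Suc.prems b'(1,2) m by (intro poor_lattice_step[OF C(1) C(2) m L, of b' k] poor[of k m b']) auto
    then obtain Y where Y: "\<And>l. l < m \<Longrightarrow> (\<Sum>j<m. Y j l *\<^sub>R b' j) \<in> C (Suc k)" "(sqrt m / (14 * L)) ^ m \<le> \<bar>dt m Y\<bar>"
      by blast
    define b'' where "b'' l = (\<Sum>j<m. Y j l *\<^sub>R b' j)" for l
    have "dt m (\<lambda>i j. f i (b'' j)) = dt m (mm m (\<lambda>i j. f i (b' j)) Y)"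
      by (rule dt_cong) (simp add: mm_def b''_def linear_sum[OF f(1)] linear_scale[OF f(1)] mult.commute)
    then have d: "\<bar>dt m (\<lambda>i j. f i (b'' j))\<bar> = \<bar>dt m Y\<bar> * \<bar>dt m (\<lambda>i j. f i (b' j))\<bar>"
      by (simp add: dt_mm abs_mult)
    have "((sqrt m / (14 * L)) ^ Suc k) ^ m * \<bar>G\<bar> = (sqrt m / (14 * L)) ^ m * (((sqrt m / (14 * L)) ^ k) ^ m * \<bar>G\<bar>)"
      by (simp only: power_Suc power_mult_distrib mult.assoc)
    also have "\<dots> \<le> \<bar>dt m Y\<bar> * \<bar>dt m (\<lambda>i j. f i (b' j))\<bar>"
      using Y(2) b'(3) L by (intro mult_mono) auto
    finally have "((sqrt m / (14 * L)) ^ Suc k) ^ m * \<bar>G\<bar> \<le> \<bar>dt m (\<lambda>i j. f i (b'' j))\<bar>" using d by simp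
    moreover have "\<phi> (b'' j) = 0" if "\<phi> \<in> \<Phi>" for \<phi> j
      using b'(2)[OF _ that] by (simp add: b''_def linear_sum[OF \<Phi>[OF that]] linear_scale[OF \<Phi>[OF that]])
    ultimately show ?case using Y(1) by (intro exI[of _ b'']) (auto simp: b''_def)
  qed
  show ?thesis
  proof (cases "G = 0")
    case True
    then show ?thesis using \<kappa>(1) by (simp add: G_def)
  next
    case False
    then obtain b' where b': "\<And>j. j < m \<Longrightarrow> b' j \<in> C K" "((sqrt m / (14 * L)) ^ K) ^ m * \<bar>G\<bar> \<le> \<bar>dt m (\<lambda>i j. f i (b' j))\<bar>"
      using main[of K] by auto
    have "\<bar>dt m (\<lambda>i j. f i (b' j))\<bar> \<le> (real m * \<kappa>) ^ m"
      by (rule abs_dt_le) (use f(2) \<kappa>(2) b'(1) order_trans in blast)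
    then show ?thesis using b'(2) by (simp add: G_def)
  qed
qed

text \<open>Greedy choice: if no m points suffice, there is always a further point of S at distance
  more than 2 K from the span of the earlier ones, with a functional that attains this distance and
  vanishes on that span. After m + 1 choices the matrix is triangular with diagonal entries at least
  2 K, which contradicts the bound K^(m + 1).\<close>

lemma kolmogorov_of_dets:
  fixes p :: "'a::real_vector \<Rightarrow> real"
  assumes p: "is_seminorm p" and K: "K > 0"
    and det: "\<And>b f. (\<And>j. j \<le> m \<Longrightarrow> b j \<in> S) \<Longrightarrow> (\<And>i. i \<le> m \<Longrightarrow> linear (f i)) \<Longrightarrow>
      (\<And>i y. i \<le> m \<Longrightarrow> \<bar>f i y\<bar> \<le> p y) \<Longrightarrow> \<bar>dt (Suc m) (\<lambda>i j. f i (b j))\<bar> \<le> K ^ Suc m"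
  shows "\<exists>Z. finite Z \<and> card Z \<le> m \<and> (\<forall>y\<in>S. sdist p Z y \<le> 2 * K)"
proof (rule ccontr)
  assume neg: "\<not> ?thesis"
  have "\<exists>b f. (\<forall>j<n. b j \<in> S) \<and> (\<forall>i<n. linear (f i) \<and> (\<forall>y. \<bar>f i y\<bar> \<le> p y) \<and> (\<forall>j<i. f i (b j) = 0) \<and> 2 * K \<le> f i (b i))"
    if "n \<le> Suc m" for n
    using that
  proof (induction n)
    case (Suc n)
    then obtain b :: "nat \<Rightarrow> 'a" and f :: "nat \<Rightarrow> 'a \<Rightarrow> real" where b: "\<forall>j<n. b j \<in> S"
      and f: "\<forall>i<n. linear (f i) \<and> (\<forall>y. \<bar>f i y\<bar> \<le> p y) \<and> (\<forall>j<i. f i (b j) = 0) \<and> 2 * K \<le> f i (b i)"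
      by auto
    let ?Z = "b ` {..<n}"
    have "card ?Z \<le> n" using card_image_le[of "{..<n}" b] by simp
    then have "finite ?Z \<and> card ?Z \<le> m" using Suc.prems by simp
    then obtain y where y: "y \<in> S" "2 * K < sdist p ?Z y" using neg by (meson not_less)
    obtain g where g: "linear g" "\<And>y. \<bar>g y\<bar> \<le> sdist p ?Z y" "g y = sdist p ?Z y"
      using functional_attaining_sdist[OF p, of ?Z y] by blast
    have gp: "\<bar>g y\<bar> \<le> p y" for y using g(2)[of y] sdist_le_seminorm[OF p, of ?Z y] by linarith
    have g0: "g (b j) = 0" if "j < n" for j
      using g(2)[of "b j"] sdist_span[OF p span_base[of "b j" ?Z]] that by simp
    have "linear ((f(n := g)) i) \<and> (\<forall>z. \<bar>(f(n := g)) i z\<bar> \<le> p z) \<and> (\<forall>j<i. (f(n := g)) i ((b(n := y)) j) = 0) \<and>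
        2 * K \<le> (f(n := g)) i ((b(n := y)) i)" if "i < Suc n" for i
      using that f g(1,3) gp g0 y(2) by (cases "i = n") auto
    then show ?case using b y(1) by (intro exI[of _ "b(n := y)"] exI[of _ "f(n := g)"]) (auto simp: less_Suc_eq)
  qed simp
  from this[of "Suc m"] obtain b :: "nat \<Rightarrow> 'a" and f :: "nat \<Rightarrow> 'a \<Rightarrow> real" where b: "\<forall>j<Suc m. b j \<in> S"
    and f: "\<forall>i<Suc m. linear (f i) \<and> (\<forall>y. \<bar>f i y\<bar> \<le> p y) \<and> (\<forall>j<i. f i (b j) = 0) \<and> 2 * K \<le> f i (b i)" by auto
  have "(2 * K) ^ Suc m = (\<Prod>i<Suc m. 2 * K)" by simp
  also have "\<dots> \<le> (\<Prod>i<Suc m. f i (b i))" using f K by (intro prod_mono) auto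
  also have "\<dots> = dt (Suc m) (\<lambda>i j. f i (b j))" using f by (subst dt_upper_triangular) auto
  also have "\<dots> \<le> \<bar>dt (Suc m) (\<lambda>i j. f i (b j))\<bar>" by simp
  also have "\<dots> \<le> K ^ Suc m" using b f by (intro det) auto
  finally have "2 * K \<le> K" using K by (subst (asm) power_mono_iff) auto
  then show False using K by simp
qed

text \<open>Restricting to a common kernel costs finitely many dimensions and a constant factor. If
  the new functional \<phi> is nonzero at some e in B annihilated by the earlier ones, then g - a e
  with a = \<phi> g / \<phi> e is annihilated by all, and it lies in d B because d = 1 + K / |\<phi>
  e| >= 1 + |a|.\<close>

lemma finite_codimension_decomposition:
  fixes B :: "'a::real_vector set" and \<Phi> :: "('a \<Rightarrow> real) set"
  assumes B: "absconvex B" and "finite \<Phi>" "\<And>\<phi>. \<phi> \<in> \<Phi> \<Longrightarrow> linear \<phi>" "\<And>\<phi>. \<phi> \<in> \<Phi> \<Longrightarrow> \<exists>K. \<forall>y\<in>B. \<bar>\<phi> y\<bar> \<le> K"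
  shows "\<exists>E c. finite E \<and> c > 0 \<and> (\<forall>y\<in>B. \<exists>z\<in>span E. \<exists>g\<in>B. (\<forall>\<phi>\<in>\<Phi>. \<phi> g = 0) \<and> y = z + c *\<^sub>R g)"
  using assms(2-)
proof (induction \<Phi> rule: finite_induct)
  case empty
  have "\<exists>z\<in>span {}. \<exists>g\<in>B. (\<forall>\<phi>\<in>{}. \<phi> g = 0) \<and> y = z + 1 *\<^sub>R g" if "y \<in> B" for y using that by auto
  then show ?case by (intro exI[of _ "{}"] exI[of _ 1]) auto
next
  case (insert \<phi> \<Phi>)
  then obtain E c where E: "finite E" "c > 0" "\<And>y. y \<in> B \<Longrightarrow> \<exists>z\<in>span E. \<exists>g\<in>B. (\<forall>\<phi>\<in>\<Phi>. \<phi> g = 0) \<and> y = z + c *\<^sub>R g"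
    by auto
  have lin: "linear \<phi>" "\<And>\<psi>. \<psi> \<in> \<Phi> \<Longrightarrow> linear \<psi>" using insert.prems by auto
  obtain K where K: "\<And>y. y \<in> B \<Longrightarrow> \<bar>\<phi> y\<bar> \<le> K" using insert.prems by blast
  show ?case
  proof (cases "\<forall>g\<in>B. (\<forall>\<psi>\<in>\<Phi>. \<psi> g = 0) \<longrightarrow> \<phi> g = 0")
    case True
    then show ?thesis using E by (intro exI[of _ E] exI[of _ c]) (metis insert_iff)
  next
    case False
    then obtain e where e: "e \<in> B" "\<And>\<psi>. \<psi> \<in> \<Phi> \<Longrightarrow> \<psi> e = 0" "\<phi> e \<noteq> 0" by blast
    define d where "d = 1 + K / \<bar>\<phi> e\<bar>"
    have "0 \<le> K" using K[OF e(1)] by linarith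
    then have d: "d \<ge> 1" by (simp add: d_def)
    have "\<exists>z\<in>span (insert e E). \<exists>g\<in>B. (\<forall>\<psi>\<in>insert \<phi> \<Phi>. \<psi> g = 0) \<and> y = z + (c * d) *\<^sub>R g" if "y \<in> B" for y
    proof -
      obtain z g where g: "z \<in> span E" "g \<in> B" "\<And>\<psi>. \<psi> \<in> \<Phi> \<Longrightarrow> \<psi> g = 0" "y = z + c *\<^sub>R g" using E(3)[OF \<open>y \<in> B\<close>] by blast
      define a where "a = \<phi> g / \<phi> e"
      have a: "\<bar>a\<bar> \<le> K / \<bar>\<phi> e\<bar>" using K[OF g(2)] by (simp add: a_def divide_right_mono)
      define g' where "g' = (1 / d) *\<^sub>R g + (- a / d) *\<^sub>R e"
      have "\<bar>1 / d\<bar> + \<bar>- a / d\<bar> = (1 + \<bar>a\<bar>) / d" using d by (simp add: add_divide_distrib)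
      also have "\<dots> \<le> d / d" using a d by (intro divide_right_mono) (simp_all add: d_def)
      also have "\<dots> = 1" using d by simp
      finally have "g' \<in> B" unfolding g'_def by (intro absconvex_comb[OF B g(2) e(1)])
      moreover have "\<psi> g' = 0" if "\<psi> \<in> insert \<phi> \<Phi>" for \<psi>
      proof (cases "\<psi> = \<phi>")
        case True
        have "\<phi> g' = (1 / d) * \<phi> g + (- a / d) * \<phi> e"
          unfolding g'_def linear_add[OF lin(1)] linear_scale[OF lin(1)] by simp
        also have "\<dots> = 0" using e(3) by (simp add: a_def)
        finally show ?thesis using True by simp
      next
        case False
        then have "\<psi> \<in> \<Phi>" using that by simp
        with g(3)[OF \<open>\<psi> \<in> \<Phi>\<close>] e(2)[OF \<open>\<psi> \<in> \<Phi>\<close>] show ?thesis unfolding g'_def linear_add[OF lin(2)[OF \<open>\<psi> \<in> \<Phi>\<close>]] linear_scale[OF lin(2)[OF \<open>\<psi> \<in> \<Phi>\<close>]] by simp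
      qed
      moreover have "y = (z + (c * a) *\<^sub>R e) + (c * d) *\<^sub>R g'"
      proof -
        have "(c * d) *\<^sub>R g' = c *\<^sub>R g - (c * a) *\<^sub>R e"
          unfolding g'_def scaleR_add_right scaleR_scaleR using d by simp
        then show ?thesis by (simp add: g(4))
      qed
      moreover have "z + (c * a) *\<^sub>R e \<in> span (insert e E)"
      proof -
        have "span E \<subseteq> span (insert e E)" by (rule span_mono) blast
        then have "z \<in> span (insert e E)" using g(1) by blast
        then show ?thesis by (intro span_add span_scale span_base[of e]) simp_all
      qed
      ultimately show ?thesis by blast
    qed
    then show ?thesis using E(1,2) d by (intro exI[of _ "insert e E"] exI[of _ "c * d"]) auto
  qed
qed

text \<open>Eight inclusions give the factor (sqrt m)^8 = m^4 in \<open>det_decay\<close>; the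
  trivial bound takes back one m. The resulting estimate holds on the common kernel of \<Phi> and
  carries over to \<open>C 0\<close> at the cost of a fixed number d of dimensions.\<close>

lemma kolmogorov_decay:
  fixes C :: "nat \<Rightarrow> 'a::real_vector set" and \<Phi> :: "('a \<Rightarrow> real) set" and p :: "'a \<Rightarrow> real"
  assumes C: "\<And>k. absconvex (C k)" "\<And>k. C k \<subseteq> C (Suc k)"
    and \<Phi>: "finite \<Phi>" "\<And>\<phi>. \<phi> \<in> \<Phi> \<Longrightarrow> linear \<phi>" "\<And>\<phi>. \<phi> \<in> \<Phi> \<Longrightarrow> \<exists>K. \<forall>y\<in>C 0. \<bar>\<phi> y\<bar> \<le> K" and L: "L > 0"
    and poor: "\<And>k m b A. k < 8 \<Longrightarrow> m \<ge> 1 \<Longrightarrow> (\<And>j. j < m \<Longrightarrow> b j \<in> C k) \<Longrightarrow>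
      (\<And>j \<phi>. j < m \<Longrightarrow> \<phi> \<in> \<Phi> \<Longrightarrow> \<phi> (b j) = 0) \<Longrightarrow>
      contr m A (\<lambda>c. gauge_ext (C (Suc k)) (\<Sum>j<m. c j *\<^sub>R b j)) \<Longrightarrow> \<bar>dt m A\<bar> \<le> (L / sqrt m) ^ m"
    and p: "is_seminorm p" and \<kappa>: "\<kappa> > 0" "\<And>y. y \<in> C 8 \<Longrightarrow> p y \<le> \<kappa>"
  shows "\<exists>r\<ge>0. \<forall>m\<ge>1. \<exists>Z. finite Z \<and> card Z \<le> m \<and> (\<forall>y\<in>C 0. sdist p Z y \<le> r / real m ^ 3)"
proof -
  define M where "M = \<kappa> * (14 * L) ^ 8"
  have M: "M > 0" using \<kappa>(1) L by (simp add: M_def)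
  define S where "S = {y \<in> C 0. \<forall>\<phi>\<in>\<Phi>. \<phi> y = 0}"
  have "\<exists>Z. finite Z \<and> card Z \<le> m \<and> (\<forall>y\<in>S. sdist p Z y \<le> 2 * (M / real (Suc m) ^ 3))" for m
  proof (rule kolmogorov_of_dets[OF p])
    show "0 < M / real (Suc m) ^ 3" using M by simp
    fix b :: "nat \<Rightarrow> 'a" and f :: "nat \<Rightarrow> 'a \<Rightarrow> real"
    assume b: "\<And>j. j \<le> m \<Longrightarrow> b j \<in> S" and f: "\<And>i. i \<le> m \<Longrightarrow> linear (f i)" "\<And>i y. i \<le> m \<Longrightarrow> \<bar>f i y\<bar> \<le> p y"
    define n where "n = Suc m"
    have "((sqrt n / (14 * L)) ^ 8) ^ n * \<bar>dt n (\<lambda>i j. f i (b j))\<bar> \<le> (n * \<kappa>) ^ n"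
      by (rule det_decay[where C = C and K = 8 and \<Phi> = \<Phi> and L = L and p = p and \<kappa> = \<kappa>];
          (fact C \<Phi>(2) L p \<kappa> | (rule poor; assumption) | (use b f in \<open>auto simp: n_def S_def less_Suc_eq_le\<close>)))
    \<comment> \<open>The rate M / n^3 is adjusted so that the gain n^4 leaves exactly the factor n
      of the trivial bound.\<close>
    moreover have "(n * \<kappa>) ^ n = ((sqrt n / (14 * L)) ^ 8) ^ n * (M / real n ^ 3) ^ n"
    proof -
      have "(sqrt n) ^ 8 = real n ^ 4"
        using power_mult[of "sqrt n" 2 4] by simp
      then have "(sqrt n / (14 * L)) ^ 8 * (M / real n ^ 3) = real n ^ 4 / real n ^ 3 * \<kappa>"
        using L by (simp add: M_def power_divide)
      also have "real n ^ 4 / real n ^ 3 = n" by (simp add: n_def divide_eq_eq eval_nat_numeral)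
      finally show ?thesis by (simp flip: power_mult_distrib)
    qed
    moreover have "0 < ((sqrt n / (14 * L)) ^ 8) ^ n" using L by (simp add: n_def)
    ultimately show "\<bar>dt (Suc m) (\<lambda>i j. f i (b j))\<bar> \<le> (M / real (Suc m) ^ 3) ^ Suc m"
      unfolding n_def[symmetric] by (simp only: mult_le_cancel_left_pos)
  qed
  then obtain Z where Z: "\<And>m. finite (Z m)" "\<And>m. card (Z m) \<le> m" "\<And>m y. y \<in> S \<Longrightarrow> sdist p (Z m) y \<le> 2 * (M / real (Suc m) ^ 3)"
    by metis
  have "\<exists>E c. finite E \<and> c > 0 \<and> (\<forall>y\<in>C 0. \<exists>z\<in>span E. \<exists>g\<in>C 0. (\<forall>\<phi>\<in>\<Phi>. \<phi> g = 0) \<and> y = z + c *\<^sub>R g)"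
    by (rule finite_codimension_decomposition[OF C(1) \<Phi>])
  then obtain E c where E: "finite E" "c > 0"
    and dec: "\<forall>y\<in>C 0. \<exists>z\<in>span E. \<exists>g\<in>C 0. (\<forall>\<phi>\<in>\<Phi>. \<phi> g = 0) \<and> y = z + c *\<^sub>R g"
    by (elim exE conjE)
  define d where "d = card E"
  \<comment> \<open>The first term covers m <= 2 d with the zero subspace. For larger m the d
    generators in E join k = m - d others, and m <= 2 (k + 1) costs 8 = 2^3.\<close>
  define r where "r = max (\<kappa> * (2 * real d) ^ 3) (c * (2 * M) * 8)"
  have r0: "r \<ge> 0" using \<kappa>(1) by (simp add: r_def le_max_iff_disj)
  have "\<exists>Z. finite Z \<and> card Z \<le> m \<and> (\<forall>y\<in>C 0. sdist p Z y \<le> r / real m ^ 3)" if m: "m \<ge> 1" for m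
  proof (cases "m \<le> 2 * d")
    case True
    have "sdist p {} y \<le> r / real m ^ 3" if y: "y \<in> C 0" for y
    proof -
      have "y \<in> C 8" using y lift_Suc_mono_le[of C, OF C(2), of 0 8] by auto
      then have "sdist p {} y \<le> \<kappa>" using \<kappa>(2) sdist_le_seminorm[OF p, of "{}" y] by fastforce
      also have "\<kappa> * real m ^ 3 \<le> \<kappa> * (2 * real d) ^ 3" using True \<kappa>(1) by (intro mult_left_mono power_mono) auto
      then have "\<kappa> * real m ^ 3 \<le> r" by (simp add: r_def)
      then have "\<kappa> \<le> r / real m ^ 3" using m by (simp add: le_divide_eq)
      finally show ?thesis .
    qed
    then show ?thesis by (intro exI[of _ "{}"]) auto
  next
    case False
    define k where "k = m - d"
    have k: "real m \<le> 2 * real (Suc k)" using False by (simp add: k_def of_nat_diff)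
    have "card (E \<union> Z k) \<le> d + k" using card_Un_le[of E "Z k"] Z(2)[of k] by (simp add: d_def)
    then have "card (E \<union> Z k) \<le> m" using False by (simp add: k_def)
    moreover have "sdist p (E \<union> Z k) y \<le> r / real m ^ 3" if y: "y \<in> C 0" for y
    proof -
      from bspec[OF dec y] obtain z g where zg: "z \<in> span E" "g \<in> C 0" "\<forall>\<phi>\<in>\<Phi>. \<phi> g = 0" "y = z + c *\<^sub>R g"
        by (elim bexE conjE)
      then have g: "z \<in> span E" "g \<in> S" "y = z + c *\<^sub>R g" by (simp_all add: S_def)
      have sd: "is_seminorm (sdist p (E \<union> Z k))" by (rule is_seminorm_sdist[OF p])
      have "z \<in> span (E \<union> Z k)" using g(1) span_mono[of E "E \<union> Z k"] by auto
      then have "sdist p (E \<union> Z k) y \<le> c * sdist p (E \<union> Z k) g"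
        using seminorm_add[OF sd, of z "c *\<^sub>R g"] E(2) by (simp add: g(3) sdist_span[OF p] seminorm_scale[OF sd])
      also have "\<dots> \<le> c * (2 * (M / real (Suc k) ^ 3))"
        using E(2) Z(3)[OF g(2), of k] sdist_mono[OF p, of "Z k" "E \<union> Z k" g] by (intro mult_left_mono) auto
      also have "\<dots> \<le> c * (2 * (M * 8 / real m ^ 3))"
      proof -
        have "real m ^ 3 \<le> (2 * real (Suc k)) ^ 3" using k by (intro power_mono) auto
        moreover have "(2 * real (Suc k)) ^ 3 = 8 * real (Suc k) ^ 3" by (simp only: power_mult_distrib) simp
        ultimately have "real m ^ 3 \<le> 8 * real (Suc k) ^ 3" by (simp only:)
        then have "1 / real (Suc k) ^ 3 \<le> 8 / real m ^ 3" using m by (simp add: divide_simps del: of_nat_Suc)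
        then have "M * (1 / real (Suc k) ^ 3) \<le> M * (8 / real m ^ 3)" using M by (intro mult_left_mono) auto
        then show ?thesis using E(2) by (intro mult_left_mono) auto
      qed
      also have "\<dots> = c * (2 * M) * 8 / real m ^ 3" by simp
      also have "\<dots> \<le> r / real m ^ 3" by (intro divide_right_mono) (auto simp: r_def)
      finally show ?thesis .
    qed
    ultimately show ?thesis using E(1) Z(1) by (intro exI[of _ "E \<union> Z k"]) auto
  qed
  then show ?thesis using r0 by blast
qed

text \<open>A disc cannot be rich against all larger discs, so each has a successor against which it
  is not rich. Iterating the successor map provides the eight inclusions required above B.\<close>

lemma rapid_kolmogorov_numbers:
  fixes B :: "'a::locally_convex_space set"
  assumes DF: "DF_space TYPE('a)"
    and loc: "\<And>s :: nat \<Rightarrow> 'a. convergent s \<Longrightarrow> converges_locally s"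
    and sums: "\<And>u :: nat \<Rightarrow> 'a. summable u \<Longrightarrow>
      domain_of_sums u = (\<lambda>x. (\<Sum>k. u k) + x) ` Gamma_loc u"
    and B: "B \<in> bdd_discs" and p: "p \<in> cs"
  shows "\<exists>r\<ge>0. \<forall>m\<ge>1. \<exists>Z. finite Z \<and> card Z \<le> m \<and> (\<forall>y\<in>B. sdist p Z y \<le> r / real m ^ 3)"
proof -
  obtain D :: "nat \<Rightarrow> 'a set" where D: "is_fundamental_system D" using DF by (auto simp: DF_space_def)
  have "\<exists>C'. C' \<in> bdd_discs \<and> C \<subseteq> C' \<and> \<not> lattice_rich C (gauge_ext C')" if C: "C \<in> bdd_discs" for C :: "'a set"
  proof (rule ccontr)
    assume neg: "\<not> ?thesis"
    obtain n0 where n0: "C \<subseteq> D n0" using C D by (auto simp: is_fundamental_system_def)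
    have mono: "D i \<subseteq> D j" if "i \<le> j" for i j using D that by (simp add: is_fundamental_system_def incseq_def)
    \<comment> \<open>Dropping the first members leaves a fundamental system all of whose discs
      contain C.\<close>
    have D': "is_fundamental_system (\<lambda>n. D (n + n0))"
      unfolding is_fundamental_system_def incseq_def
    proof (intro conjI allI impI ballI)
      show "D (m + n0) \<subseteq> D (n + n0)" if "m \<le> n" for m n using that by (intro mono) simp
      show "D (n + n0) \<in> bdd_discs" for n using D by (simp add: is_fundamental_system_def)
      fix X :: "'a set" assume "X \<in> bdd_discs"
      then obtain n where "X \<subseteq> D n" using D by (auto simp: is_fundamental_system_def)
      also have "D n \<subseteq> D (n + n0)" by (rule mono) simp
      finally show "\<exists>n. X \<subseteq> D (n + n0)" by blast
    qed
    have sub: "C \<subseteq> D (n + n0)" for n using n0 mono[of n0 "n + n0"] by auto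
    have rich: "lattice_rich C (gauge_ext (D (n + n0)))" for n
      using neg sub[of n] D by (auto simp: is_fundamental_system_def)
    show False by (rule rich_disc_contradiction[OF C D' sub rich loc sums])
  qed
  then obtain nxt where nxt: "\<And>C :: 'a set. C \<in> bdd_discs \<Longrightarrow> nxt C \<in> bdd_discs" "\<And>C. C \<in> bdd_discs \<Longrightarrow> C \<subseteq> nxt C"
    "\<And>C. C \<in> bdd_discs \<Longrightarrow> \<not> lattice_rich C (gauge_ext (nxt C))"
    by metis
  define C where "C k = (nxt ^^ k) B" for k
  have Cd: "C k \<in> bdd_discs" for k by (induction k) (simp_all add: C_def B nxt(1))
  have Cs: "C (Suc k) = nxt (C k)" for k by (simp add: C_def)
  have Csub: "C k \<subseteq> C (Suc k)" for k unfolding Cs by (rule nxt(2)[OF Cd])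
  have Cac: "absconvex (C k)" for k using Cd[of k] by (simp add: bdd_discs_def)
  define Q where "Q k \<Phi> L \<longleftrightarrow> finite \<Phi> \<and> (\<forall>\<phi>\<in>\<Phi>. linear \<phi> \<and> (\<exists>K. \<forall>x\<in>C k. \<bar>\<phi> x\<bar> \<le> K)) \<and>
      \<not> (\<exists>m b A. m \<ge> 1 \<and> (\<forall>j<m. b j \<in> C k \<and> (\<forall>\<phi>\<in>\<Phi>. \<phi> (b j) = 0)) \<and>
        contr m A (\<lambda>c. gauge_ext (C (Suc k)) (\<Sum>j<m. c j *\<^sub>R b j)) \<and> (L / sqrt m) ^ m < \<bar>dt m A\<bar>)"
    for k and \<Phi> :: "('a \<Rightarrow> real) set" and L :: real
  have "\<exists>\<Phi> L. Q k \<Phi> L" for k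
  proof -
    have "\<not> lattice_rich (C k) (gauge_ext (C (Suc k)))" unfolding Cs by (rule nxt(3)[OF Cd])
    then show ?thesis unfolding lattice_rich_def Q_def not_all not_imp by simp
  qed
  then have "\<forall>k. \<exists>\<Phi>. \<exists>L. Q k \<Phi> L" by blast
  from choice[OF this] obtain \<Phi> where "\<forall>k. \<exists>L. Q k (\<Phi> k) L" ..
  from choice[OF this] obtain L where Q: "\<forall>k. Q k (\<Phi> k) (L k)" ..
  have \<Phi>: "\<And>k. finite (\<Phi> k)" "\<And>k \<phi>. \<phi> \<in> \<Phi> k \<Longrightarrow> linear \<phi> \<and> (\<exists>K. \<forall>x\<in>C k. \<bar>\<phi> x\<bar> \<le> K)"
    using Q unfolding Q_def by simp_all
  have poor: "\<bar>dt m A\<bar> \<le> (L k / sqrt m) ^ m"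
    if "m \<ge> 1" "\<forall>j<m. b j \<in> C k \<and> (\<forall>\<phi>\<in>\<Phi> k. \<phi> (b j) = 0)"
      "contr m A (\<lambda>c. gauge_ext (C (Suc k)) (\<Sum>j<m. c j *\<^sub>R b j))" for k m b A
  proof (rule ccontr)
    assume "\<not> ?thesis"
    then have "(L k / sqrt m) ^ m < \<bar>dt m A\<bar>" by simp
    moreover have "\<not> (\<exists>m b A. m \<ge> 1 \<and> (\<forall>j<m. b j \<in> C k \<and> (\<forall>\<phi>\<in>\<Phi> k. \<phi> (b j) = 0)) \<and>
        contr m A (\<lambda>c. gauge_ext (C (Suc k)) (\<Sum>j<m. c j *\<^sub>R b j)) \<and> (L k / sqrt m) ^ m < \<bar>dt m A\<bar>)"
      using spec[OF Q, of k] unfolding Q_def by (elim conjE)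
    ultimately show False
      using that by (elim notE) (intro exI[of _ m] exI[of _ b] exI[of _ A] conjI)
  qed
  define \<Phi>' where "\<Phi>' = (\<Union>k<8. \<Phi> k)"
  define L' where "L' = 1 + (\<Sum>k<8. \<bar>L k\<bar>)"
  have L': "L' > 0" unfolding L'_def by (intro add_pos_nonneg sum_nonneg) auto
  have LL: "\<bar>L k\<bar> \<le> L'" if "k < 8" for k
    using member_le_sum[of k "{..<8}" "\<lambda>k. \<bar>L k\<bar>"] that by (simp add: L'_def)
  obtain \<kappa> where \<kappa>: "\<kappa> > 0" "\<And>y. y \<in> C 8 \<Longrightarrow> p y \<le> \<kappa>"
    using cs_bounded_on[OF _ p, of "C 8"] Cd[of 8] by (auto simp: bdd_discs_def)
  have "\<exists>r\<ge>0. \<forall>m\<ge>1. \<exists>Z. finite Z \<and> card Z \<le> m \<and> (\<forall>y\<in>C 0. sdist p Z y \<le> r / real m ^ 3)"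
  proof (rule kolmogorov_decay[where C = C and p = p and \<kappa> = \<kappa> and \<Phi> = \<Phi>' and L = L', OF Cac Csub _ _ _ L' _ csD(1)[OF p] \<kappa>])
    show "finite \<Phi>'" using \<Phi>(1) by (simp add: \<Phi>'_def)
    show "linear \<phi>" if "\<phi> \<in> \<Phi>'" for \<phi> using that \<Phi>(2) by (auto simp: \<Phi>'_def)
    show "\<exists>K. \<forall>y\<in>C 0. \<bar>\<phi> y\<bar> \<le> K" if "\<phi> \<in> \<Phi>'" for \<phi>
    proof -
      from that obtain k where "\<phi> \<in> \<Phi> k" unfolding \<Phi>'_def by (rule UN_E)
      then show ?thesis using \<Phi>(2) lift_Suc_mono_le[of C, OF Csub, of 0 k] by blast
    qed
    fix k m :: nat and b A
    assume k: "k < 8" and m: "m \<ge> 1" and b: "\<And>j. j < m \<Longrightarrow> b j \<in> C k" "\<And>j \<phi>. j < m \<Longrightarrow> \<phi> \<in> \<Phi>' \<Longrightarrow> \<phi> (b j) = 0"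
      and A: "contr m A (\<lambda>c. gauge_ext (C (Suc k)) (\<Sum>j<m. c j *\<^sub>R b j))"
    have "\<bar>dt m A\<bar> \<le> (L k / sqrt m) ^ m" using b k by (intro poor[OF m _ A]) (auto simp: \<Phi>'_def)
    also have "\<dots> \<le> \<bar>(L k / sqrt m) ^ m\<bar>" by simp
    also have "\<dots> = (\<bar>L k\<bar> / sqrt m) ^ m" by (simp add: power_abs)
    also have "\<dots> \<le> (L' / sqrt m) ^ m" using LL[OF k] by (intro power_mono divide_right_mono) auto
    finally show "\<bar>dt m A\<bar> \<le> (L' / sqrt m) ^ m" .
  qed
  then show ?thesis by (simp add: C_def)
qed

section \<open>Auerbach bases\<close>

lemma dt_inverse:
  assumes "dt m A \<noteq> 0"
  shows "\<exists>B. (\<forall>i<m. \<forall>j<m. (\<Sum>k<m. A i k * B k j) = (if i = j then 1 else 0)) \<and>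
    (\<forall>i<m. \<forall>j<m. (\<Sum>k<m. B i k * A k j) = (if i = j then 1 else 0))"
proof -
  let ?M = "Matrix.mat m m (\<lambda>(i, j). A i j)"
  have M: "?M \<in> carrier_mat m m" by simp
  note adj = adj_mat[OF M]
  define J where "J i j = adj_mat ?M $$ (i, j)" for i j
  define B where "B i j = J i j / dt m A" for i j
  have e: "(\<Sum>k<m. A i k * J k j) = (?M * adj_mat ?M) $$ (i, j)"
    "(\<Sum>k<m. J i k * A k j) = (adj_mat ?M * ?M) $$ (i, j)" if "i < m" "j < m" for i j
    using that adj(1) by (auto simp: J_def scalar_prod_def atLeast0LessThan intro!: sum.cong)
  have "(\<Sum>k<m. A i k * J k j) = (if i = j then dt m A else 0)"
    "(\<Sum>k<m. J i k * A k j) = (if i = j then dt m A else 0)" if "i < m" "j < m" for i j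
    unfolding e[OF that] adj(2,3) dt_def using that by simp_all
  then have "(\<Sum>k<m. A i k * B k j) = (if i = j then 1 else 0)"
    "(\<Sum>k<m. B i k * A k j) = (if i = j then 1 else 0)" if "i < m" "j < m" for i j
    using assms that by (simp_all add: B_def flip: sum_divide_distrib)
  then show ?thesis by (intro exI[of _ B]) auto
qed

text \<open>Auerbach's argument without an attained maximum. Among d functionals below p and d
  points of the p-unit ball of span W, take |det (f_i (z_j))| within a factor 2 of its supremum,
  where d is the largest size admitting a nonzero determinant. By Cramer's rule the coordinate
  functionals are quotients of such determinants, hence bounded by 2 p on span W, and Hahn-Banach
  extends them. As p is a seminorm, points are reproduced up to p-distance 0 only.\<close>

lemma approximate_auerbach_basis:
  fixes p :: "'a::real_vector \<Rightarrow> real"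
  assumes p: "is_seminorm p" and W: "finite W"
  shows "\<exists>d \<phi> z. d \<le> card W \<and> (\<forall>i<d. linear (\<phi> i) \<and> (\<forall>y. \<bar>\<phi> i y\<bar> \<le> 2 * p y)) \<and>
    (\<forall>i<d. z i \<in> span W \<and> p (z i) \<le> 1) \<and> (\<forall>y\<in>span W. p (y - (\<Sum>i<d. \<phi> i y *\<^sub>R z i)) = 0)"
proof -
  define adm where "adm d f z \<longleftrightarrow> (\<forall>i<d. linear (f i) \<and> (\<forall>y. \<bar>f i y\<bar> \<le> p y)) \<and> (\<forall>j<d. z j \<in> span W \<and> p (z j) \<le> 1)"
    for d and f :: "nat \<Rightarrow> 'a \<Rightarrow> real" and z :: "nat \<Rightarrow> 'a"
  define G where "G d f z = dt d (\<lambda>i j. f i (z j))" for d and f :: "nat \<Rightarrow> 'a \<Rightarrow> real" and z :: "nat \<Rightarrow> 'a"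
  have inverse: "\<exists>\<psi>. (\<forall>k<d. linear (\<psi> k)) \<and> (\<forall>k<d. \<forall>j<d. \<psi> k (z j) = (if k = j then 1 else 0)) \<and>
      (\<forall>i<d. \<forall>y. f i (\<Sum>k<d. \<psi> k y *\<^sub>R z k) = f i y)" if a: "adm d f z" and nz: "G d f z \<noteq> 0" for d f z
  proof -
    obtain B where B: "\<forall>i<d. \<forall>j<d. (\<Sum>k<d. f i (z k) * B k j) = (if i = j then 1 else 0)"
      "\<forall>i<d. \<forall>j<d. (\<Sum>k<d. B i k * f k (z j)) = (if i = j then 1 else 0)"
      using dt_inverse[OF nz[unfolded G_def]] by blast
    have lf: "linear (f i)" if "i < d" for i using a that by (simp add: adm_def)
    define \<psi> where "\<psi> k y = (\<Sum>i<d. B k i * f i y)" for k y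
    have "linear (\<psi> k)" for k
      by (rule linearI) (simp_all add: \<psi>_def linear_add[OF lf] linear_scale[OF lf] distrib_left sum.distrib sum_distrib_left ac_simps)
    moreover have "\<psi> k (z j) = (if k = j then 1 else 0)" if "k < d" "j < d" for k j
      using B(2) that by (simp add: \<psi>_def)
    moreover have "f i (\<Sum>k<d. \<psi> k y *\<^sub>R z k) = f i y" if i: "i < d" for i y
    proof -
      have "f i (\<Sum>k<d. \<psi> k y *\<^sub>R z k) = (\<Sum>k<d. \<Sum>l<d. f i (z k) * B k l * f l y)"
        by (simp add: linear_sum[OF lf[OF i]] linear_scale[OF lf[OF i]] \<psi>_def sum_distrib_right sum_distrib_left ac_simps)
      also have "\<dots> = (\<Sum>l<d. (\<Sum>k<d. f i (z k) * B k l) * f l y)"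
        by (subst sum.swap) (simp add: sum_distrib_right)
      also have "\<dots> = (\<Sum>l<d. (if i = l then 1 else 0) * f l y)" using B(1) i by (intro sum.cong) auto
      also have "\<dots> = f i y" using i by (simp add: if_distrib[of "\<lambda>x. x * _"] cong: if_cong)
      finally show ?thesis .
    qed
    ultimately show ?thesis by (intro exI[of _ \<psi>]) auto
  qed
  \<comment> \<open>The sizes of nonsingular systems. Dual functionals make the points independent,
    so sizes are at most \<open>card W\<close>; size 0 is included, as the empty determinant is
    1.\<close>
  define N where "N = {d. \<exists>f z. adm d f z \<and> G d f z \<noteq> 0}"
  have Nle: "d \<le> card W" if "d \<in> N" for d
  proof -
    from that obtain f z where fz: "adm d f z" "G d f z \<noteq> 0" by (auto simp: N_def)
    obtain \<psi> where \<psi>: "\<forall>k<d. linear (\<psi> k)" "\<forall>k<d. \<forall>j<d. \<psi> k (z j) = (if k = j then 1 else (0 :: real))"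
      using inverse[OF fz] by blast
    have inj: "inj_on z {..<d}"
    proof (rule inj_onI)
      fix i j assume "i \<in> {..<d}" "j \<in> {..<d}" and zz: "z i = z j"
      then have ij: "i < d" "j < d" by simp_all
      show "i = j"
      proof (rule ccontr)
        assume "i \<noteq> j"
        then have "\<psi> i (z i) = 1" "\<psi> i (z j) = 0" using \<psi>(2) ij by simp_all
        then show False using zz by simp
      qed
    qed
    have "independent (z ` {..<d})"
      unfolding dependent_def
    proof
      assume "\<exists>a\<in>z ` {..<d}. a \<in> span (z ` {..<d} - {a})"
      then obtain j where j: "j < d" "z j \<in> span (z ` {..<d} - {z j})" by auto
      have "\<psi> j x = 0" if "x \<in> z ` {..<d} - {z j}" for x using that \<psi>(2) j(1) by auto
      then have "\<psi> j (z j) = 0" using linear_eq_0_on_span[of "\<psi> j"] \<psi>(1) j by blast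
      then show False using \<psi>(2) j(1) by simp
    qed
    moreover have "z ` {..<d} \<subseteq> span W" using fz(1) by (auto simp: adm_def)
    ultimately have "card (z ` {..<d}) \<le> card W" using independent_span_bound[OF W] by blast
    then show ?thesis by (simp add: card_image[OF inj])
  qed
  have "0 \<in> N" unfolding N_def by (auto simp: adm_def G_def dt_def)
  moreover have finN: "finite N" using Nle by (intro finite_subset[of N "{..card W}"]) auto
  ultimately have "Max N \<in> N" by (intro Max_in) auto
  then obtain d where d: "d \<in> N" "Suc d \<notin> N" using Max_ge[OF finN] by (metis Suc_n_not_le_n)
  then obtain f0 z0 where f0: "adm d f0 z0" "G d f0 z0 \<noteq> 0" by (auto simp: N_def)
  let ?S = "{\<bar>G d f z\<bar> | f z. adm d f z}"
  have "\<bar>G d f z\<bar> \<le> (real d * 1) ^ d" if "adm d f z" for f z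
    unfolding G_def
  proof (rule abs_dt_le)
    fix i j assume "i < d" "j < d"
    then have "\<bar>f i (z j)\<bar> \<le> p (z j)" "p (z j) \<le> 1" using that by (auto simp: adm_def)
    then show "\<bar>f i (z j)\<bar> \<le> 1" by linarith
  qed
  then have bdd: "bdd_above ?S" by (intro bdd_aboveI[of _ "(real d * 1) ^ d"]) auto
  have le: "\<bar>G d f z\<bar> \<le> Sup ?S" if "adm d f z" for f z by (rule cSup_upper[OF _ bdd]) (use that in auto)
  have "0 < \<bar>G d f0 z0\<bar>" using f0(2) by simp
  then have pos: "Sup ?S > 0" using le[OF f0(1)] by linarith
  then have half: "Sup ?S / 2 < Sup ?S" by simp
  have "?S \<noteq> {}" using f0(1) by auto
  then obtain g where "g \<in> ?S" "Sup ?S / 2 < g" using less_cSup_iff[OF _ bdd, of "Sup ?S / 2"] half by blast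
  then obtain f z where fz: "adm d f z" "Sup ?S / 2 < \<bar>G d f z\<bar>" by auto
  have nz: "G d f z \<noteq> 0" using fz(2) pos by auto
  obtain \<psi> where \<psi>: "\<forall>k<d. linear (\<psi> k)" "\<forall>i<d. \<forall>y. f i (\<Sum>k<d. \<psi> k y *\<^sub>R z k) = f i y"
    using inverse[OF fz(1) nz] by blast
  have lf: "linear (f i)" "\<bar>f i y\<bar> \<le> p y" if "i < d" for i y using fz(1) that by (auto simp: adm_def)
  have zW: "z j \<in> span W" "p (z j) \<le> 1" if "j < d" for j using fz(1) that by (auto simp: adm_def)
  have cramer: "\<psi> k y * G d f z = G d f (z(k := y))" if k: "k < d" for k y
  proof -
    have "\<psi> k y * G d f z = dt d (\<lambda>i j. if j = k then \<Sum>l<d. f i (z l) * \<psi> l y else f i (z j))"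
      unfolding G_def by (rule dt_replace_col[OF k, symmetric])
    also have "\<dots> = G d f (z(k := y))"
      unfolding G_def
    proof (rule dt_cong)
      fix i j assume i: "i < d"
      have "(\<Sum>l<d. f i (z l) * \<psi> l y) = f i (\<Sum>k<d. \<psi> k y *\<^sub>R z k)"
        by (simp add: linear_sum[OF lf(1)[OF i]] linear_scale[OF lf(1)[OF i]] mult.commute)
      also have "\<dots> = f i y" using \<psi>(2) i by blast
      finally show "(if j = k then \<Sum>l<d. f i (z l) * \<psi> l y else f i (z j)) = f i ((z(k := y)) j)" by simp
    qed
    finally show ?thesis .
  qed
  have bound1: "\<bar>\<psi> k y\<bar> \<le> 2" if k: "k < d" and y: "y \<in> span W" "p y \<le> 1" for k y
  proof -
    have "adm d f (z(k := y))" using fz(1) y by (auto simp: adm_def)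
    then have "\<bar>\<psi> k y * G d f z\<bar> \<le> Sup ?S" unfolding cramer[OF k] by (rule le)
    then have "\<bar>\<psi> k y\<bar> * \<bar>G d f z\<bar> \<le> 2 * \<bar>G d f z\<bar>" using fz(2) by (simp add: abs_mult)
    then show ?thesis using nz by simp
  qed
  have bound: "\<bar>\<psi> k y\<bar> \<le> 2 * p y" if k: "k < d" and y: "y \<in> span W" for k y
  proof (rule field_le_epsilon)
    fix e :: real assume e: "e > 0"
    define t where "t = p y + e / 2"
    have t: "t > 0" using e seminorm_nonneg[OF p, of y] by (simp add: t_def)
    have "p ((1 / t) *\<^sub>R y) \<le> 1" using t e by (simp add: seminorm_scale[OF p] t_def)
    then have "\<bar>\<psi> k ((1 / t) *\<^sub>R y)\<bar> \<le> 2" using y by (intro bound1[OF k]) (auto intro: span_scale)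
    then have "\<bar>\<psi> k y\<bar> / t \<le> 2" using \<psi>(1) k t by (simp add: linear_scale abs_mult)
    then show "\<bar>\<psi> k y\<bar> \<le> 2 * p y + e" using t by (simp add: t_def divide_le_eq)
  qed
  have "\<exists>\<phi>. linear \<phi> \<and> (\<forall>y. \<bar>\<phi> y\<bar> \<le> 2 * p y) \<and> (\<forall>y\<in>span W. \<phi> y = \<psi> k y)" if k: "k < d" for k
  proof -
    have lk: "linear (\<psi> k)" using \<psi>(1) k by blast
    let ?\<G> = "(\<lambda>y. (y, \<psi> k y)) ` span W"
    have "linear (\<lambda>y. (y, \<psi> k y))"
      by (rule linearI) (simp_all add: linear_add[OF lk] linear_scale[OF lk])
    then have "subspace ?\<G>" by (intro linear_subspace_image) auto
    moreover have "is_seminorm (\<lambda>y. 2 * p y)"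
      unfolding is_seminorm_def
    proof (intro conjI allI)
      show "2 * p (x + y) \<le> 2 * p x + 2 * p y" for x y using seminorm_add[OF p, of x y] by linarith
      show "2 * p (c *\<^sub>R x) = \<bar>c\<bar> * (2 * p x)" for c x by (simp add: seminorm_scale[OF p])
    qed
    moreover have "r \<le> 2 * p y" if "(y, r) \<in> ?\<G>" for y r using that bound[OF k, of y] by auto
    ultimately obtain \<phi> where "linear \<phi> \<and> (\<forall>x. \<bar>\<phi> x\<bar> \<le> 2 * p x) \<and> (\<forall>x r. (x, r) \<in> ?\<G> \<longrightarrow> \<phi> x = r)"
      using hahn_banach_graph[of "\<lambda>y. 2 * p y" ?\<G>] by blast
    then show ?thesis by (intro exI[of _ \<phi>]) auto
  qed
  then have "\<forall>k. \<exists>\<phi>. k < d \<longrightarrow> linear \<phi> \<and> (\<forall>y. \<bar>\<phi> y\<bar> \<le> 2 * p y) \<and> (\<forall>y\<in>span W. \<phi> y = \<psi> k y)" by blast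
  from choice[OF this] obtain \<phi> where \<phi>: "\<forall>k. k < d \<longrightarrow> linear (\<phi> k) \<and> (\<forall>y. \<bar>\<phi> k y\<bar> \<le> 2 * p y) \<and>
      (\<forall>y\<in>span W. \<phi> k y = \<psi> k y)" ..
  have "p (y - (\<Sum>i<d. \<phi> i y *\<^sub>R z i)) = 0" if y: "y \<in> span W" for y
  proof (rule ccontr)
    define r where "r = y - (\<Sum>i<d. \<psi> i y *\<^sub>R z i)"
    have e: "y - (\<Sum>i<d. \<phi> i y *\<^sub>R z i) = r" using \<phi> y by (simp add: r_def)
    \<comment> \<open>If p r > 0, then r / p r and a norming functional of r border the matrix. The
      old functionals vanish at r, so the determinant is unchanged, and d would not be
      maximal.\<close>
    assume "p (y - (\<Sum>i<d. \<phi> i y *\<^sub>R z i)) \<noteq> 0"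
    then have pr: "p r > 0" unfolding e using seminorm_nonneg[OF p, of r] by simp
    have rW: "r \<in> span W" unfolding r_def using y zW by (intro span_diff span_sum span_scale) auto
    have fr: "f i r = 0" if "i < d" for i
      using \<psi>(2) that by (simp add: r_def linear_diff[OF lf(1)[OF that]])
    obtain h where h: "linear h" "\<And>y. \<bar>h y\<bar> \<le> sdist p {} y" "h r = sdist p {} r"
      using functional_attaining_sdist[OF p, of "{}" r] by blast
    have s0: "sdist p {} y = p y" for y by (simp add: sdist_def)
    define z' where "z' = z(d := (1 / p r) *\<^sub>R r)"
    define f' where "f' = f(d := h)"
    have "adm (Suc d) f' z'"
      unfolding adm_def f'_def z'_def
      using lf zW h(1,2) s0 pr rW by (auto simp: less_Suc_eq seminorm_scale[OF p] span_scale)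
    moreover have "G (Suc d) f' z' = f' d (z' d) * dt d (\<lambda>i j. f' i (z' j))"
      unfolding G_def by (rule dt_bordered) (simp add: f'_def z'_def fr linear_scale[OF lf(1)])
    moreover have "f' d (z' d) = 1" using pr h(3) s0 by (simp add: f'_def z'_def linear_scale[OF h(1)])
    moreover have "dt d (\<lambda>i j. f' i (z' j)) = G d f z" unfolding G_def by (rule dt_cong) (simp add: f'_def z'_def)
    ultimately have "adm (Suc d) f' z' \<and> G (Suc d) f' z' \<noteq> 0" using nz by simp
    then have "Suc d \<in> N" unfolding N_def by blast
    then show False using d(2) by simp
  qed
  then show ?thesis using Nle[OF d(1)] \<phi> zW by (intro exI[of _ d] exI[of _ \<phi>] exI[of _ z]) auto
qed

section \<open>Gluing in (DF)-spaces\<close>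

lemma cs_closed_ball:
  fixes p :: "'a::locally_convex_space \<Rightarrow> real"
  assumes p: "p \<in> cs" and e: "e > 0"
  shows "closed {x. p x \<le> e}" "absconvex {x. p x \<le> e}" "zero_nhd {x. p x \<le> e}"
proof -
  note s = csD(1)[OF p]
  show "closed {x. p x \<le> e}" by (rule closed_Collect_le[OF csD(2)[OF p] continuous_on_const])
  show "absconvex {x. p x \<le> e}"
    unfolding absconvex_def
  proof (intro conjI ballI allI impI)
    show "{x. p x \<le> e} \<noteq> {}" using e seminorm_zero[OF s] by (auto intro!: exI[of _ 0])
    fix x y a b assume xy: "x \<in> {x. p x \<le> e}" "y \<in> {x. p x \<le> e}" "\<bar>a\<bar> + \<bar>b\<bar> \<le> (1 :: real)"
    have "p (a *\<^sub>R x + b *\<^sub>R y) \<le> \<bar>a\<bar> * p x + \<bar>b\<bar> * p y"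
      using seminorm_add[OF s, of "a *\<^sub>R x" "b *\<^sub>R y"] by (simp add: seminorm_scale[OF s])
    also have "\<dots> \<le> \<bar>a\<bar> * e + \<bar>b\<bar> * e" using xy by (intro add_mono mult_left_mono) auto
    also have "\<dots> = (\<bar>a\<bar> + \<bar>b\<bar>) * e" by (simp add: algebra_simps)
    also have "\<dots> \<le> 1 * e" using xy(3) e by (intro mult_right_mono) auto
    finally show "a *\<^sub>R x + b *\<^sub>R y \<in> {x. p x \<le> e}" by simp
  qed
  have "interior {x. p x < e} \<subseteq> interior {x. p x \<le> e}" by (rule interior_mono) auto
  then show "zero_nhd {x. p x \<le> e}" using cs_ball(2)[OF p e] by (auto simp: zero_nhd_def)
qed

text \<open>The (DF) condition is applied to the sets where the distance \<open>d k\<close> to span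
  (W k) is at most 8^(-k). On \<open>D n\<close> this distance is at most R / 8^k with R depending
  on n, so the intersection absorbs all bounded sets. The gauge of the resulting neighbourhood
  controls all distances at once, although the approximating spaces were found for each disc
  separately.\<close>

lemma dominating_seminorm:
  fixes p :: "'a::locally_convex_space \<Rightarrow> real"
  assumes DF: "DF_space TYPE('a)" and p: "p \<in> cs"
    and rapid: "\<And>B. B \<in> bdd_discs \<Longrightarrow>
      \<exists>r\<ge>0. \<forall>m\<ge>1. \<exists>Z. finite Z \<and> card Z \<le> m \<and> (\<forall>y\<in>B. sdist p Z y \<le> r / real m ^ 3)"
  shows "\<exists>q\<in>cs. \<exists>W. (\<forall>x. p x \<le> q x) \<and> (\<forall>k. finite (W k) \<and> card (W k) \<le> (k + 1)\<^sup>2 * 2 ^ k \<and> W k \<subseteq> W (Suc k)) \<and>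
    (\<forall>k x. sdist p (W k) x \<le> q x / 8 ^ k)"
proof -
  note s = csD(1)[OF p]
  obtain D :: "nat \<Rightarrow> 'a set" where D: "is_fundamental_system D" using DF by (auto simp: DF_space_def)
  have Dd: "D n \<in> bdd_discs" for n using D by (simp add: is_fundamental_system_def)
  have "\<forall>n. \<exists>r. r \<ge> 0 \<and> (\<forall>m\<ge>1. \<exists>Z. finite Z \<and> card Z \<le> m \<and> (\<forall>y\<in>D n. sdist p Z y \<le> r / real m ^ 3))"
    using rapid[OF Dd] by blast
  from choice[OF this] obtain r where r: "\<forall>n. r n \<ge> 0 \<and> (\<forall>m\<ge>1. \<exists>Z. finite Z \<and> card Z \<le> m \<and> (\<forall>y\<in>D n. sdist p Z y \<le> r n / real m ^ 3))" ..
  have "\<forall>n. \<exists>Z. \<forall>m. finite (Z m) \<and> (m \<ge> 1 \<longrightarrow> card (Z m) \<le> m \<and> (\<forall>y\<in>D n. sdist p (Z m) y \<le> r n / real m ^ 3))"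
  proof
    fix n
    have "\<forall>m. \<exists>Z. finite Z \<and> (m \<ge> 1 \<longrightarrow> card Z \<le> m \<and> (\<forall>y\<in>D n. sdist p Z y \<le> r n / real m ^ 3))"
      using r by (metis finite.emptyI)
    from choice[OF this] show "\<exists>Z. \<forall>m. finite (Z m) \<and> (m \<ge> 1 \<longrightarrow> card (Z m) \<le> m \<and> (\<forall>y\<in>D n. sdist p (Z m) y \<le> r n / real m ^ 3))" .
  qed
  from choice[OF this] obtain Z where Z: "\<forall>n m. finite (Z n m) \<and> (m \<ge> 1 \<longrightarrow> card (Z n m) \<le> m \<and> (\<forall>y\<in>D n. sdist p (Z n m) y \<le> r n / real m ^ 3))" ..
  have Zc: "finite (Z n (2 ^ k))" "card (Z n (2 ^ k)) \<le> 2 ^ k" "\<And>y. y \<in> D n \<Longrightarrow> sdist p (Z n (2 ^ k)) y \<le> r n / 8 ^ k" for n k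
  proof -
    show "finite (Z n (2 ^ k))" "card (Z n (2 ^ k)) \<le> 2 ^ k" using Z by simp_all
    \<comment> \<open>At m = 2^k the rate m^(-3) becomes 8^(-k).\<close>
    have "(2 ^ k) ^ 3 = (8 :: real) ^ k" by (simp flip: power_mult) (simp add: power_mult mult.commute[of k])
    then show "sdist p (Z n (2 ^ k)) y \<le> r n / 8 ^ k" if "y \<in> D n" for y
      using Z[THEN spec, THEN spec, of n "2 ^ k"] that by simp
  qed
  \<comment> \<open>The spaces for the discs \<open>D n\<close> at scale 2^l with n <= l <= k. Every
    disc is served from k = n on, the sets increase with k, and the cardinality grows only by the
    factor (k + 1)^2.\<close>
  define W where "W k = (\<Union>l\<le>k. \<Union>n\<le>l. Z n (2 ^ l))" for k
  have finW: "finite (W k)" for k using Zc(1) by (auto simp: W_def)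
  have cardW: "card (W k) \<le> (k + 1)\<^sup>2 * 2 ^ k" for k
  proof -
    have "card (\<Union>n\<le>l. Z n (2 ^ l)) \<le> (k + 1) * 2 ^ k" if "l \<le> k" for l
    proof -
      have "card (\<Union>n\<le>l. Z n (2 ^ l)) \<le> (\<Sum>n\<le>l. card (Z n (2 ^ l)))" by (rule card_UN_le) simp
      also have "\<dots> \<le> (\<Sum>n\<le>l. 2 ^ l)" by (intro sum_mono Zc(2))
      also have "\<dots> = (l + 1) * 2 ^ l" by simp
      also have "\<dots> \<le> (k + 1) * 2 ^ k" using that by (intro mult_le_mono power_increasing) auto
      finally show ?thesis .
    qed
    then have "(\<Sum>l\<le>k. card (\<Union>n\<le>l. Z n (2 ^ l))) \<le> (\<Sum>l\<le>k. (k + 1) * 2 ^ k)" by (intro sum_mono) auto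
    moreover have "card (W k) \<le> (\<Sum>l\<le>k. card (\<Union>n\<le>l. Z n (2 ^ l)))" unfolding W_def by (rule card_UN_le) simp
    ultimately show ?thesis by (simp add: power2_eq_square algebra_simps)
  qed
  have monoW: "W k \<subseteq> W (Suc k)" for k unfolding W_def by (intro UN_mono) auto
  define d where "d k = sdist p (W k)" for k
  have ds: "is_seminorm (d k)" for k unfolding d_def by (rule is_seminorm_sdist[OF s])
  have dp: "d k x \<le> p x" for k x unfolding d_def by (rule sdist_le_seminorm[OF s])
  have dcs: "d k \<in> cs" for k
  proof (rule seminorm_in_cs[OF ds])
    show "zero_nhd {x. p x < 1}" by (rule cs_ball(2)[OF p]) simp
    show "d k x \<le> 1" if "x \<in> {x. p x < 1}" for x using that dp[of k x] by simp
  qed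
  define U where "U k = {x. d k x \<le> 1 / 8 ^ k}" for k
  have U: "closed (U k)" "absconvex (U k)" "zero_nhd (U k)" for k
    unfolding U_def by (rule cs_closed_ball[OF dcs], simp)+
  have "absorbs (\<Inter>k. U k) X" if X: "tvs_bounded X" for X
  proof -
    obtain C where C: "C \<in> bdd_discs" "X \<subseteq> C" using bounded_subset_disc[OF X] by blast
    have "\<forall>C\<in>bdd_discs. \<exists>n. C \<subseteq> D n" using D by (simp add: is_fundamental_system_def)
    from bspec[OF this C(1)] obtain n where "C \<subseteq> D n" ..
    with C(2) have n: "X \<subseteq> D n" by (rule subset_trans)
    obtain \<kappa> where \<kappa>: "\<kappa> > 0" "\<forall>x\<in>D n. p x \<le> \<kappa>"
      using cs_bounded_on[OF _ p, of "D n"] Dd[of n] by (auto simp: bdd_discs_def)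
    \<comment> \<open>The second summand covers the scales k < n by the trivial bound d k <= p <=
      \<kappa> on \<open>D n\<close>, at the price of 8^n.\<close>
    define R where "R = r n + 8 ^ n * \<kappa>"
    have R: "R > 0" using r \<kappa>(1) by (simp add: R_def add_nonneg_pos)
    have dR: "d k x \<le> R / 8 ^ k" if x: "x \<in> D n" for k x
    proof (cases "n \<le> k")
      case True
      then have "Z n (2 ^ k) \<subseteq> W k" by (auto simp: W_def)
      then have "d k x \<le> sdist p (Z n (2 ^ k)) x" unfolding d_def by (rule sdist_mono[OF s])
      also have "\<dots> \<le> r n / 8 ^ k" by (rule Zc(3)[OF x])
      also have "\<dots> \<le> R / 8 ^ k" using \<kappa>(1) by (intro divide_right_mono) (auto simp: R_def)
      finally show ?thesis .
    next
      case False
      have "d k x * 8 ^ k \<le> \<kappa> * 8 ^ n"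
        using order_trans[OF dp] \<kappa> x False seminorm_nonneg[OF ds] by (intro mult_mono power_increasing) auto
      also have "\<dots> \<le> R" using r by (simp add: R_def mult.commute)
      finally show ?thesis by (simp add: le_divide_eq)
    qed
    have "X \<subseteq> (\<lambda>x. t *\<^sub>R x) ` (\<Inter>k. U k)" if t: "R \<le> \<bar>t\<bar>" for t
    proof
      fix x assume "x \<in> X"
      then have x: "x \<in> D n" using n by blast
      have t0: "\<bar>t\<bar> > 0" using t R by linarith
      have "d k ((1 / t) *\<^sub>R x) \<le> 1 / 8 ^ k" for k
      proof -
        have "d k ((1 / t) *\<^sub>R x) = d k x / \<bar>t\<bar>" by (simp add: seminorm_scale[OF ds])
        also have "\<dots> \<le> (\<bar>t\<bar> / 8 ^ k) / \<bar>t\<bar>"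
          using order_trans[OF dR[OF x] divide_right_mono[OF t]] by (intro divide_right_mono) auto
        also have "\<dots> = 1 / 8 ^ k" using t0 by simp
        finally show ?thesis .
      qed
      then show "x \<in> (\<lambda>x. t *\<^sub>R x) ` (\<Inter>k. U k)"
        using t0 by (intro image_eqI[of _ _ "(1 / t) *\<^sub>R x"]) (auto simp: U_def)
    qed
    then show ?thesis unfolding absorbs_def using R by blast
  qed
  then have nhd: "zero_nhd (\<Inter>k. U k)"
    using DF U unfolding DF_space_def by blast
  have ac: "absconvex (\<Inter>k. U k)"
    using U(2) absconvex_zero[OF U(2)] unfolding absconvex_def by blast
  have "x \<in> span (\<Inter>k. U k)" for x
    using zero_nhd_absorbing[OF nhd, of x] by (auto intro: span_scale span_base)
  then have span: "span (\<Inter>k. U k) = UNIV" by blast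
  define g where "g = minkowski_gauge (\<Inter>k. U k)"
  have gs: "is_seminorm g" unfolding g_def by (rule is_seminorm_gauge[OF ac span])
  have gcs: "g \<in> cs" by (rule seminorm_in_cs[OF gs nhd]) (auto simp: g_def intro!: gauge_le)
  \<comment> \<open>The gauge g controls the distances; adding p secures p <= q.\<close>
  define q where "q x = p x + g x" for x
  have "is_seminorm q"
    unfolding is_seminorm_def q_def
  proof (intro conjI allI)
    show "p (x + y) + g (x + y) \<le> p x + g x + (p y + g y)" for x y
      using seminorm_add[OF s, of x y] seminorm_add[OF gs, of x y] by linarith
    show "p (c *\<^sub>R x) + g (c *\<^sub>R x) = \<bar>c\<bar> * (p x + g x)" for c x
      by (simp add: seminorm_scale[OF s] seminorm_scale[OF gs] distrib_left)
  qed
  moreover have "continuous_on UNIV q"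
    unfolding q_def[abs_def] by (intro continuous_on_add csD(2) p gcs)
  ultimately have "q \<in> cs" by (simp add: cs_def)
  moreover have "d k x \<le> q x / 8 ^ k" for k x
  proof -
    have "d k x \<le> 1 / 8 ^ k * g x"
      unfolding g_def
    proof (rule seminorm_le_gauge[OF ds ac])
      show "d k y \<le> 1 / 8 ^ k" if "y \<in> (\<Inter>k. U k)" for y using that by (auto simp: U_def)
      show "x \<in> span (\<Inter>k. U k)" using span by simp
    qed
    also have "\<dots> \<le> q x / 8 ^ k" using seminorm_nonneg[OF s, of x] by (simp add: q_def divide_right_mono)
    finally show ?thesis .
  qed
  moreover have "p x \<le> q x" for x using seminorm_nonneg[OF gs, of x] by (simp add: q_def)
  ultimately show ?thesis
    using finW cardW monoW by (intro bexI[of _ q] exI[of _ W]) (auto simp: d_def)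
qed

section \<open>Nuclear maps\<close>

text \<open>From 1 + k / 8 <= (9/8)^k. The base 9/8 is taken because its fourth power 6561 / 4096 is
  below 2; 4096 is 8^4.\<close>

lemma geometric_domination: "real (k + 1) ^ 4 / 2 ^ k \<le> 4096 * (6561 / 8192) ^ k"
proof -
  have "1 + real k * (1 / 8) \<le> (1 + 1 / 8) ^ k" by (rule Bernoulli_inequality) simp
  then have "real (k + 1) \<le> 8 * (9 / 8) ^ k" by simp
  then have "real (k + 1) ^ 4 \<le> (8 * (9 / 8) ^ k) ^ 4" by (intro power_mono) auto
  also have "\<dots> = 4096 * (6561 / 4096) ^ k"
  proof -
    have "((9 / 8 :: real) ^ k) ^ 4 = ((9 / 8) ^ 4) ^ k" by (metis power_mult mult.commute)
    also have "(9 / 8 :: real) ^ 4 = 6561 / 4096" by (simp add: power_divide)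
    finally have "((9 / 8 :: real) ^ k) ^ 4 = (6561 / 4096) ^ k" .
    then show ?thesis by (simp only: power_mult_distrib) simp
  qed
  finally have "real (k + 1) ^ 4 / 2 ^ k \<le> 4096 * (6561 / 4096) ^ k / 2 ^ k" by (rule divide_right_mono) simp
  also have "4096 * (6561 / 4096 :: real) ^ k / 2 ^ k = 4096 * ((6561 / 4096) ^ k / 2 ^ k)" by simp
  also have "(6561 / 4096 :: real) ^ k / 2 ^ k = (6561 / 8192) ^ k" unfolding power_divide[symmetric] by simp
  finally show ?thesis .
qed

text \<open>The code of a pair is at least as large as both coordinates, so an initial segment of
  the enumeration lies in a square, where the sum can be taken row by row.\<close>

lemma summable_pairs:
  fixes \<alpha> :: "nat \<Rightarrow> nat \<Rightarrow> real"
  assumes nonneg: "\<And>k i. 0 \<le> \<alpha> k i" and row: "\<And>k n. (\<Sum>i<n. \<alpha> k i) \<le> \<beta> k" and \<beta>: "summable \<beta>"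
  shows "summable (\<lambda>n. \<alpha> (fst (prod_decode n)) (snd (prod_decode n)))"
proof (rule summableI_nonneg_bounded)
  show "0 \<le> \<alpha> (fst (prod_decode n)) (snd (prod_decode n))" for n by (rule nonneg)
  have \<beta>0: "0 \<le> \<beta> k" for k using row[of k 0] by simp
  fix n
  have "(\<Sum>m<n. \<alpha> (fst (prod_decode m)) (snd (prod_decode m))) = (\<Sum>(k, i)\<in>prod_decode ` {..<n}. \<alpha> k i)"
    by (subst sum.reindex) (auto simp: inj_prod_decode case_prod_unfold)
  also have "\<dots> \<le> (\<Sum>(k, i)\<in>{..<n} \<times> {..<n}. \<alpha> k i)"
  proof (rule sum_mono2)
    show "prod_decode ` {..<n} \<subseteq> {..<n} \<times> {..<n}"
    proof
      fix y assume "y \<in> prod_decode ` {..<n}"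
      then obtain m where m: "m < n" "y = prod_decode m" by auto
      obtain k i where ki: "prod_decode m = (k, i)" by (cases "prod_decode m")
      then have "prod_encode (k, i) = m" by (metis prod_decode_inverse)
      then have "k \<le> m" "i \<le> m" using le_prod_encode_1[of k i] le_prod_encode_2[of i k] by auto
      then show "y \<in> {..<n} \<times> {..<n}" using m ki by simp
    qed
  qed (use nonneg in auto)
  also have "\<dots> = (\<Sum>k<n. \<Sum>i<n. \<alpha> k i)" by (simp add: sum.cartesian_product)
  also have "\<dots> \<le> (\<Sum>k<n. \<beta> k)" by (intro sum_mono row)
  also have "\<dots> \<le> suminf \<beta>" by (rule sum_le_suminf[OF \<beta>]) (auto simp: \<beta>0)
  finally show "(\<Sum>m<n. \<alpha> (fst (prod_decode m)) (snd (prod_decode m))) \<le> suminf \<beta>" .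
qed

text \<open>Transport to cosets. As |F n| <= c n q, the functional \<open>F n\<close> vanishes on
  ker q, so its value at an arbitrarily chosen representative defines a functional on E_q, of dual
  norm at most \<open>c n\<close>.\<close>

lemma nuclear_map_of_representation:
  fixes p q :: "'a::real_vector \<Rightarrow> real"
  assumes p: "is_seminorm p" and q: "is_seminorm q" and pq: "\<And>x. p x \<le> q x"
    and F: "\<And>n. linear (F n)" "\<And>n x. \<bar>F n x\<bar> \<le> c n * q x" and c: "\<And>n. 0 \<le> c n"
    and sm: "summable (\<lambda>n. c n * p (z n))"
    and lim: "\<And>x. (\<lambda>N. p ((\<Sum>n<N. F n x *\<^sub>R z n) - x)) \<longlonglongrightarrow> 0"
  shows "nuclear_map (E_sub_p q) (E_sub_p p) (canonical_map p)"
proof -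
  define f where "f n A = F n (SOME a. a \<in> A)" for n and A :: "'a set"
  have f: "f n (ker_coset q x) = F n x" for n x
  proof -
    have "x \<in> ker_coset q x" by (simp add: ker_coset_iff seminorm_zero[OF q])
    then have "(SOME a. a \<in> ker_coset q x) \<in> ker_coset q x" by (rule someI)
    then have "q ((SOME a. a \<in> ker_coset q x) - x) = 0" by (simp add: ker_coset_iff)
    then have "F n ((SOME a. a \<in> ker_coset q x) - x) = 0" using F(2)[of n "(SOME a. a \<in> ker_coset q x) - x"] by simp
    then show ?thesis by (simp add: f_def linear_diff[OF F(1)])
  qed
  have dual: "f n \<in> ns_dual (E_sub_p q)" for n
    unfolding ns_dual_def mem_Collect_eq E_sub_p_carrier
    by (auto simp: E_sub_p_add[OF q] E_sub_p_scale[OF q] E_sub_p_norm[OF q] f linear_add[OF F(1)] linear_scale[OF F(1)]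
        intro!: exI[of _ "c n"] F(2))
  have norm: "0 \<le> ns_dual_norm (E_sub_p q) (f n) \<and> ns_dual_norm (E_sub_p q) (f n) \<le> c n" for n
  proof -
    let ?S = "{A \<in> ns_carrier (E_sub_p q). ns_norm (E_sub_p q) A \<le> 1}"
    have le: "\<bar>f n A\<bar> \<le> c n" if "A \<in> ?S" for A
    proof -
      from that obtain x where x: "A = ker_coset q x" "q x \<le> 1" by (auto simp: E_sub_p_carrier E_sub_p_norm[OF q])
      have "\<bar>F n x\<bar> \<le> c n * q x" by (rule F(2))
      also have "\<dots> \<le> c n * 1" using x(2) c by (intro mult_left_mono) auto
      finally show ?thesis by (simp add: x f)
    qed
    have zero: "ker_coset q 0 \<in> ?S" by (simp add: E_sub_p_carrier E_sub_p_norm[OF q] seminorm_zero[OF q])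
    have "bdd_above ((\<lambda>A. \<bar>f n A\<bar>) ` ?S)" using le by (intro bdd_aboveI[of _ "c n"]) auto
    then have "\<bar>f n (ker_coset q 0)\<bar> \<le> ns_dual_norm (E_sub_p q) (f n)"
      unfolding ns_dual_norm_def by (rule cSUP_upper[OF zero])
    moreover have "ns_dual_norm (E_sub_p q) (f n) \<le> c n"
      unfolding ns_dual_norm_def by (rule cSUP_least) (use zero le in blast)+
    ultimately show ?thesis by linarith
  qed
  have psum: "ns_psum (E_sub_p p) (\<lambda>n. ns_scale (E_sub_p p) (f n (ker_coset q x)) (ker_coset p (z n))) N =
      ker_coset p (\<Sum>n<N. F n x *\<^sub>R z n)" for x N
    by (induction N) (simp_all add: E_sub_p_zero E_sub_p_add[OF p] E_sub_p_scale[OF p] f)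
  have "ns_sums (E_sub_p p) (\<lambda>n. ns_scale (E_sub_p p) (f n A) (ker_coset p (z n))) (canonical_map p A)"
    if "A \<in> ns_carrier (E_sub_p q)" for A
  proof -
    from that obtain x where A: "A = ker_coset q x" by (auto simp: E_sub_p_carrier)
    have can: "canonical_map p (ker_coset q x) = ker_coset p x" by (rule canonical_map_coset[OF p q pq])
    have "ns_norm (E_sub_p p) (ns_add (E_sub_p p) (ker_coset p y) (ns_scale (E_sub_p p) (- 1) (ker_coset p x))) = p (y - x)" for y
      by (simp add: E_sub_p_add[OF p] E_sub_p_scale[OF p] E_sub_p_norm[OF p])
    then show ?thesis
      unfolding ns_sums_def ns_tendsto_def A can psum
      using lim[of x] by (simp add: E_sub_p_scale[OF p] E_sub_p_carrier)
  qed
  moreover have "summable (\<lambda>n. ns_dual_norm (E_sub_p q) (f n) * ns_norm (E_sub_p p) (ker_coset p (z n)))"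
    by (rule summable_comparison_test'[OF sm, of 0])
      (use norm in \<open>simp add: E_sub_p_norm[OF p] abs_mult seminorm_nonneg[OF p] mult_right_mono\<close>)
  ultimately show ?thesis
    unfolding nuclear_map_def using dual
    by (intro exI[of _ f] exI[of _ "\<lambda>n. ker_coset p (z n)"]) (simp add: E_sub_p_carrier)
qed

text \<open>The Auerbach systems give maps \<open>P k\<close> into span (W k) of norm at most 2 d k
  for p, so their error is at most 1 + 2 d k times the distance, that is, of order (k + 1)^2 2^k /
  8^k. The differences S k = P k - P (k - 1), with S 0 = P 0, telescope. They take values in span (W
  k) because the W k increase, hence are reproduced by the k-th Auerbach system.\<close>

lemma rapid_projections:
  fixes p q :: "'a::real_vector \<Rightarrow> real" and W :: "nat \<Rightarrow> 'a set"
  assumes p: "is_seminorm p" and pq: "\<And>x. p x \<le> q x"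
    and W: "\<And>k. finite (W k)" "\<And>k. card (W k) \<le> (k + 1)\<^sup>2 * 2 ^ k" "\<And>k. W k \<subseteq> W (Suc k)"
    and rapid: "\<And>k x. sdist p (W k) x \<le> q x / 8 ^ k"
  shows "\<exists>d \<phi> z S. (\<forall>k. d k \<le> (k + 1)\<^sup>2 * 2 ^ k) \<and> (\<forall>k i. i < d k \<longrightarrow> linear (\<phi> k i) \<and> (\<forall>y. \<bar>\<phi> k i y\<bar> \<le> 2 * p y) \<and> p (z k i) \<le> 1) \<and>
    (\<forall>k. linear (S k)) \<and> (\<forall>k x. p (S k x) \<le> 15 * (real (k + 1))\<^sup>2 / 4 ^ k * q x) \<and>
    (\<forall>k x. p (S k x - (\<Sum>i<d k. \<phi> k i (S k x) *\<^sub>R z k i)) = 0) \<and>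
    (\<forall>k x. p ((\<Sum>j\<le>k. S j x) - x) \<le> 3 * (real (k + 1))\<^sup>2 / 4 ^ k * q x)"
proof -
  have "\<forall>k. \<exists>d \<phi> z. d \<le> card (W k) \<and> (\<forall>i<d. linear (\<phi> i) \<and> (\<forall>y. \<bar>\<phi> i y\<bar> \<le> 2 * p y)) \<and>
    (\<forall>i<d. z i \<in> span (W k) \<and> p (z i) \<le> 1) \<and> (\<forall>y\<in>span (W k). p (y - (\<Sum>i<d. \<phi> i y *\<^sub>R z i)) = 0)"
    using approximate_auerbach_basis[OF p W(1)] by blast
  from choice[OF this] obtain d where "\<forall>k. \<exists>\<phi> z. d k \<le> card (W k) \<and> (\<forall>i<d k. linear (\<phi> i) \<and> (\<forall>y. \<bar>\<phi> i y\<bar> \<le> 2 * p y)) \<and>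
    (\<forall>i<d k. z i \<in> span (W k) \<and> p (z i) \<le> 1) \<and> (\<forall>y\<in>span (W k). p (y - (\<Sum>i<d k. \<phi> i y *\<^sub>R z i)) = 0)" ..
  from choice[OF this] obtain \<phi> where "\<forall>k. \<exists>z. d k \<le> card (W k) \<and> (\<forall>i<d k. linear (\<phi> k i) \<and> (\<forall>y. \<bar>\<phi> k i y\<bar> \<le> 2 * p y)) \<and>
    (\<forall>i<d k. z i \<in> span (W k) \<and> p (z i) \<le> 1) \<and> (\<forall>y\<in>span (W k). p (y - (\<Sum>i<d k. \<phi> k i y *\<^sub>R z i)) = 0)" ..
  from choice[OF this] obtain z where all: "\<forall>k. d k \<le> card (W k) \<and> (\<forall>i<d k. linear (\<phi> k i) \<and> (\<forall>y. \<bar>\<phi> k i y\<bar> \<le> 2 * p y)) \<and>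
    (\<forall>i<d k. z k i \<in> span (W k) \<and> p (z k i) \<le> 1) \<and> (\<forall>y\<in>span (W k). p (y - (\<Sum>i<d k. \<phi> k i y *\<^sub>R z k i)) = 0)" ..
  have d: "d k \<le> (k + 1)\<^sup>2 * 2 ^ k" for k using all W(2)[of k] by (meson order_trans)
  have \<phi>: "linear (\<phi> k i)" "\<bar>\<phi> k i y\<bar> \<le> 2 * p y" if "i < d k" for k i y using all that by blast+
  have z: "z k i \<in> span (W k)" "p (z k i) \<le> 1" if "i < d k" for k i using all that by blast+
  have proj: "p (y - (\<Sum>i<d k. \<phi> k i y *\<^sub>R z k i)) = 0" if "y \<in> span (W k)" for k y using all that by blast
  define P where "P k y = (\<Sum>i<d k. \<phi> k i y *\<^sub>R z k i)" for k y
  have linP: "linear (P k)" for k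
    by (rule linearI) (simp_all add: P_def linear_add[OF \<phi>(1)] linear_scale[OF \<phi>(1)] scaleR_add_left sum.distrib scaleR_sum_right)
  have PW: "P k y \<in> span (W k)" for k y unfolding P_def using z by (intro span_sum span_scale) auto
  have pP: "p (P k y) \<le> 2 * real (d k) * p y" for k y
  proof -
    have "p (P k y) \<le> (\<Sum>i<d k. p (\<phi> k i y *\<^sub>R z k i))" unfolding P_def by (rule seminorm_sum[OF p]) simp
    also have "\<dots> \<le> (\<Sum>i<d k. 2 * p y)"
    proof (rule sum_mono)
      fix i assume "i \<in> {..<d k}"
      then have "\<bar>\<phi> k i y\<bar> * p (z k i) \<le> (2 * p y) * 1"
        using \<phi>(2) z(2) seminorm_nonneg[OF p] by (intro mult_mono) auto
      then show "p (\<phi> k i y *\<^sub>R z k i) \<le> 2 * p y" by (simp add: seminorm_scale[OF p])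
    qed
    finally show ?thesis by simp
  qed
  define err where "err k = 3 * (real (k + 1))\<^sup>2 / 4 ^ k" for k
  have errP: "p (P k x - x) \<le> err k * q x" for k x
  proof -
    have q0: "0 \<le> q x" using order_trans[OF seminorm_nonneg[OF p] pq] .
    have D: "1 \<le> real ((k + 1)\<^sup>2 * 2 ^ k)"
    proof -
      have "0 < (k + 1)\<^sup>2 * 2 ^ k" by simp
      then show ?thesis by linarith
    qed
    have "p (P k x - x) / (1 + 2 * real (d k)) \<le> sdist p (W k) x"
    proof (rule sdist_greatest)
      fix y assume y: "y \<in> span (W k)"
      \<comment> \<open>Up to p-distance 0, \<open>P k\<close> fixes y in span (W k), so the error
        at x is that at x - y; then y is varied to reach the distance.\<close>
      have e: "P k x - x = P k (x - y) + ((P k y - y) - (x - y))" by (simp add: linear_diff[OF linP])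
      have "p (P k y - y) = 0" using proj[OF y] seminorm_commute[OF p] by (simp add: P_def)
      then have "p (P k x - x) \<le> p (P k (x - y)) + p (x - y)"
        unfolding e using seminorm_add[OF p, of "P k (x - y)" "(P k y - y) - (x - y)"] seminorm_diff[OF p, of "P k y - y" "x - y"] by linarith
      also have "\<dots> \<le> (1 + 2 * real (d k)) * p (x - y)" using pP[of k "x - y"] by (simp add: algebra_simps)
      finally show "p (P k x - x) / (1 + 2 * real (d k)) \<le> p (x - y)" by (simp add: divide_le_eq mult.commute)
    qed
    also have "\<dots> \<le> q x / 8 ^ k" by (rule rapid)
    finally have "p (P k x - x) \<le> (1 + 2 * real (d k)) * (q x / 8 ^ k)" by (simp add: divide_le_eq mult.commute)
    also have "\<dots> \<le> (3 * real ((k + 1)\<^sup>2 * 2 ^ k)) * (q x / 8 ^ k)"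
    proof (rule mult_right_mono)
      have "real (d k) \<le> real ((k + 1)\<^sup>2 * 2 ^ k)" using d[of k] by (simp only: of_nat_le_iff)
      then show "1 + 2 * real (d k) \<le> 3 * real ((k + 1)\<^sup>2 * 2 ^ k)" using D by linarith
    qed (use q0 in simp)
    also have "\<dots> = err k * q x"
    proof -
      have "(8 :: real) ^ k = 2 ^ k * 4 ^ k" unfolding power_mult_distrib[symmetric] by simp
      then show ?thesis by (simp add: err_def)
    qed
    finally show ?thesis .
  qed
  define S where "S k x = (case k of 0 \<Rightarrow> P 0 x | Suc j \<Rightarrow> P k x - P j x)" for k x
  have S_simps: "S 0 = P 0" "S (Suc j) = (\<lambda>x. P (Suc j) x - P j x)" for j by (simp_all add: S_def[abs_def])
  have linS: "linear (S k)" for k by (cases k) (simp_all add: S_simps linP linear_compose_sub)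
  have SW: "S k x \<in> span (W k)" for k x
  proof (cases k)
    case (Suc j)
    have "span (W j) \<subseteq> span (W (Suc j))" by (rule span_mono[OF W(3)])
    then show ?thesis using PW Suc by (simp add: S_simps) (intro span_diff; blast)
  qed (simp add: S_simps PW)
  have pS: "p (S k x) \<le> 15 * (real (k + 1))\<^sup>2 / 4 ^ k * q x" for k x
  proof (cases k)
    case 0
    have "p (P 0 x) \<le> p (P 0 x - x) + p x" using seminorm_add[OF p, of "P 0 x - x" x] by simp
    then show ?thesis
      using errP[of 0 x] pq[of x] order_trans[OF seminorm_nonneg[OF p] pq, of x] unfolding 0 S_simps
      by (simp add: err_def)
  next
    case (Suc j)
    have q0: "0 \<le> q x" using order_trans[OF seminorm_nonneg[OF p] pq] .
    have "p (S k x) \<le> p (P (Suc j) x - x) + p (P j x - x)"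
      using seminorm_diff[OF p, of "P (Suc j) x - x" "P j x - x"] by (simp add: Suc S_simps)
    also have "\<dots> \<le> (err (Suc j) + err j) * q x" using errP[of "Suc j" x] errP[of j x] by (simp add: distrib_right)
    also have "\<dots> \<le> 15 * (real (k + 1))\<^sup>2 / 4 ^ k * q x"
    proof (rule mult_right_mono[OF _ q0])
      have "(real (j + 1))\<^sup>2 \<le> (real (k + 1))\<^sup>2" by (intro power_mono) (auto simp: Suc)
      then have "12 * (real (j + 1))\<^sup>2 / 4 ^ k \<le> 12 * (real (k + 1))\<^sup>2 / 4 ^ k" by (intro divide_right_mono) auto
      \<comment> \<open>Passing from 4^j to 4^(j + 1) turns 3 into 12; with the 3 of the other term
        this makes 15.\<close>
      moreover have "err j = 12 * (real (j + 1))\<^sup>2 / 4 ^ k" by (simp add: err_def Suc)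
      moreover have "err (Suc j) = 3 * (real (k + 1))\<^sup>2 / 4 ^ k" by (simp add: err_def Suc)
      moreover have "15 * (real (k + 1))\<^sup>2 / 4 ^ k = 3 * (real (k + 1))\<^sup>2 / 4 ^ k + 12 * (real (k + 1))\<^sup>2 / 4 ^ k"
        by (simp flip: add_divide_distrib)
      ultimately show "err (Suc j) + err j \<le> 15 * (real (k + 1))\<^sup>2 / 4 ^ k" by linarith
    qed
    finally show ?thesis .
  qed
  have sumS: "(\<Sum>j\<le>k. S j x) = P k x" for k x by (induction k) (simp_all add: S_simps)
  show ?thesis
    using d \<phi> z(2) linS pS proj[OF SW] errP
    by (intro exI[of _ d] exI[of _ \<phi>] exI[of _ z] exI[of _ S]) (simp add: sumS err_def)
qed

text \<open>The rank-one terms are \<phi> k i (S k x) z k i. Each has coefficient at most 30 (k +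
  1)^2 / 4^k q x, and there are at most (k + 1)^2 2^k of them for each k, so their sizes add up to
  at most 30 (k + 1)^4 / 2^k, which is summable. Convergence to x is obtained from complete groups
  plus the tail of this series.\<close>

lemma nuclear_map_of_rapid_approximation:
  fixes p q :: "'a::real_vector \<Rightarrow> real" and W :: "nat \<Rightarrow> 'a set"
  assumes p: "is_seminorm p" and q: "is_seminorm q" and pq: "\<And>x. p x \<le> q x"
    and W: "\<And>k. finite (W k)" "\<And>k. card (W k) \<le> (k + 1)\<^sup>2 * 2 ^ k" "\<And>k. W k \<subseteq> W (Suc k)"
    and rapid: "\<And>k x. sdist p (W k) x \<le> q x / 8 ^ k"
  shows "nuclear_map (E_sub_p q) (E_sub_p p) (canonical_map p)"
proof -
  have "\<exists>d \<phi> z S. (\<forall>k. d k \<le> (k + 1)\<^sup>2 * 2 ^ k) \<and> (\<forall>k i. i < d k \<longrightarrow> linear (\<phi> k i) \<and> (\<forall>y. \<bar>\<phi> k i y\<bar> \<le> 2 * p y) \<and> p (z k i) \<le> 1) \<and>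
    (\<forall>k. linear (S k)) \<and> (\<forall>k x. p (S k x) \<le> 15 * (real (k + 1))\<^sup>2 / 4 ^ k * q x) \<and>
    (\<forall>k x. p (S k x - (\<Sum>i<d k. \<phi> k i (S k x) *\<^sub>R z k i)) = 0) \<and>
    (\<forall>k x. p ((\<Sum>j\<le>k. S j x) - x) \<le> 3 * (real (k + 1))\<^sup>2 / 4 ^ k * q x)"
    by (rule rapid_projections[OF p pq W rapid])
  then obtain d \<phi> z S where all: "(\<forall>k. d k \<le> (k + 1)\<^sup>2 * 2 ^ k) \<and> (\<forall>k i. i < d k \<longrightarrow> linear (\<phi> k i) \<and> (\<forall>y. \<bar>\<phi> k i y\<bar> \<le> 2 * p y) \<and> p (z k i) \<le> 1) \<and>
    (\<forall>k. linear (S k)) \<and> (\<forall>k x. p (S k x) \<le> 15 * (real (k + 1))\<^sup>2 / 4 ^ k * q x) \<and>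
    (\<forall>k x. p (S k x - (\<Sum>i<d k. \<phi> k i (S k x) *\<^sub>R z k i)) = 0) \<and>
    (\<forall>k x. p ((\<Sum>j\<le>k. S j x) - x) \<le> 3 * (real (k + 1))\<^sup>2 / 4 ^ k * q x)"
    by (elim exE)
  have d: "d k \<le> (k + 1)\<^sup>2 * 2 ^ k" for k using all by blast
  have \<phi>: "linear (\<phi> k i)" "\<bar>\<phi> k i y\<bar> \<le> 2 * p y" "p (z k i) \<le> 1" if "i < d k" for k i y using all that by blast+
  have S: "linear (S k)" "p (S k x) \<le> 15 * (real (k + 1))\<^sup>2 / 4 ^ k * q x"
    "p (S k x - (\<Sum>i<d k. \<phi> k i (S k x) *\<^sub>R z k i)) = 0"
    "p ((\<Sum>j\<le>k. S j x) - x) \<le> 3 * (real (k + 1))\<^sup>2 / 4 ^ k * q x" for k x using all by blast+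
  have q0: "0 \<le> q x" for x by (rule seminorm_nonneg[OF q])
  define row col where "row n = fst (prod_decode n)" and "col n = snd (prod_decode n)" for n
  \<comment> \<open>Pairs (k, i) with i >= d k carry no term; they are filled with zeros so that all
    pairs can be enumerated at once.\<close>
  define act where "act n \<longleftrightarrow> col n < d (row n)" for n
  define F where "F n x = (if act n then \<phi> (row n) (col n) (S (row n) x) else 0)" for n x
  define Z where "Z n = (if act n then z (row n) (col n) else 0)" for n
  \<comment> \<open>30 = 2 * 15: the Auerbach functionals are bounded by 2 p, and S k by the factor
    15.\<close>
  define e where "e k = 30 * (real (k + 1))\<^sup>2 / 4 ^ k" for k
  have e0: "0 \<le> e k" for k by (simp add: e_def)
  define c where "c n = (if act n then e (row n) else 0)" for n
  have linF: "linear (F n)" for n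
  proof (cases "act n")
    case True
    then have "linear (\<phi> (row n) (col n) \<circ> S (row n))"
      by (intro linear_compose S(1) \<phi>(1)) (simp add: act_def)
    then show ?thesis using True by (simp add: F_def[abs_def] comp_def)
  qed (simp add: F_def[abs_def] linear_zero)
  have boundF: "\<bar>F n x\<bar> \<le> c n * q x" for n x
  proof (cases "act n")
    case True
    then have "\<bar>F n x\<bar> \<le> 2 * p (S (row n) x)" unfolding F_def using \<phi>(2) by (simp add: act_def)
    also have "\<dots> \<le> 2 * (15 * (real (row n + 1))\<^sup>2 / 4 ^ row n * q x)" using S(2) by (intro mult_left_mono) auto
    finally show ?thesis using True by (simp add: c_def e_def)
  qed (simp add: F_def c_def)
  have c0: "0 \<le> c n" for n by (simp add: c_def e0)
  have Z1: "p (Z n) \<le> 1" for n using \<phi>(3) by (simp add: Z_def act_def seminorm_zero[OF p])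
  have sumc: "summable c"
  proof -
    define \<alpha> where "\<alpha> k i = (if i < d k then e k else 0)" for k i
    define \<beta> where "\<beta> k = real (d k) * e k" for k
    have "summable (\<lambda>n. \<alpha> (fst (prod_decode n)) (snd (prod_decode n)))"
    proof (rule summable_pairs)
      show "0 \<le> \<alpha> k i" for k i by (simp add: \<alpha>_def e0)
      show "(\<Sum>i<n. \<alpha> k i) \<le> \<beta> k" for k n
      proof -
        have "(\<Sum>i<n. \<alpha> k i) = (\<Sum>i\<in>{..<n} \<inter> {..<d k}. e k)"
          unfolding \<alpha>_def by (subst sum.inter_restrict) (simp_all only: lessThan_iff finite_lessThan)
        also have "\<dots> \<le> (\<Sum>i<d k. e k)" by (intro sum_mono2) (auto simp: e0)
        finally show ?thesis by (simp add: \<beta>_def)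
      qed
      show "summable \<beta>"
      proof (rule summable_comparison_test')
        show "summable (\<lambda>k. 30 * (4096 * (6561 / 8192 :: real) ^ k))"
          by (intro summable_mult summable_geometric) simp
        fix k :: nat
        have "\<beta> k \<le> real ((k + 1)\<^sup>2 * 2 ^ k) * e k"
          unfolding \<beta>_def using d[of k] e0 by (intro mult_right_mono) (simp_all only: of_nat_le_iff)
        also have "\<dots> = 30 * (real (k + 1) ^ 4 / 2 ^ k)"
        proof -
          have "(4 :: real) ^ k = 2 ^ k * 2 ^ k" unfolding power_mult_distrib[symmetric] by simp
          moreover have "real (k + 1) ^ 4 = (real (k + 1))\<^sup>2 * (real (k + 1))\<^sup>2" by (simp flip: power_add)
          ultimately show ?thesis by (simp add: e_def)
        qed
        also have "\<dots> \<le> 30 * (4096 * (6561 / 8192) ^ k)" by (intro mult_left_mono geometric_domination) simp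
        finally show "norm (\<beta> k) \<le> 30 * (4096 * (6561 / 8192) ^ k)" by (simp add: \<beta>_def e0)
      qed
    qed
    then show ?thesis unfolding \<alpha>_def c_def[abs_def] act_def row_def col_def .
  qed
  show ?thesis
  proof (rule nuclear_map_of_representation[OF p q pq linF boundF c0])
    show "summable (\<lambda>n. c n * p (Z n))"
      by (rule summable_comparison_test'[OF sumc, of 0])
        (use c0 Z1 seminorm_nonneg[OF p] in \<open>simp add: abs_mult mult_left_le\<close>)
    fix x
    show "(\<lambda>N. p ((\<Sum>n<N. F n x *\<^sub>R Z n) - x)) \<longlonglongrightarrow> 0"
    proof (rule LIMSEQ_I)
      fix \<epsilon> :: real assume \<epsilon>: "\<epsilon> > 0"
      define \<epsilon>' where "\<epsilon>' = \<epsilon> / (3 * (q x + 1))"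
      have \<epsilon>': "\<epsilon>' > 0" "\<epsilon>' * q x < \<epsilon> / 2"
        using \<epsilon> q0[of x] by (simp_all add: \<epsilon>'_def field_simps add_nonneg_pos)
      obtain n0 where n0: "\<And>m n. n0 \<le> m \<Longrightarrow> norm (\<Sum>i\<in>{m..<n}. c i) < \<epsilon>'"
        using sumc \<epsilon>'(1) unfolding summable_Cauchy by metis
      have "(\<lambda>k. 3 * (real (k + 1))\<^sup>2 / 4 ^ k) \<longlonglongrightarrow> 0" by real_asymp
      then have "eventually (\<lambda>k. 3 * (real (k + 1))\<^sup>2 / 4 ^ k < \<epsilon>') sequentially"
        using \<epsilon>'(1) by (rule order_tendstoD(2))
      then obtain k0 where "\<And>k. k \<ge> k0 \<Longrightarrow> 3 * (real (k + 1))\<^sup>2 / 4 ^ k < \<epsilon>'"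
        unfolding eventually_sequentially by blast
      then obtain K where K: "n0 \<le> K" "3 * (real (K + 1))\<^sup>2 / 4 ^ K < \<epsilon>'" by (meson max.cobounded1 max.cobounded2)
      \<comment> \<open>The complete groups k <= K. Their sum is \<Sum> S k x up to p-distance 0,
        hence close to x. A term outside either vanishes or has index at least n0, where the tail of
        the summable \<open>c\<close> controls it.\<close>
      define I where "I = prod_encode ` (SIGMA k:{..K}. {..<d k})"
      have finI: "finite I" by (simp add: I_def)
      have actI: "n \<in> I \<longleftrightarrow> act n \<and> row n \<le> K" for n
      proof -
        have "n \<in> prod_encode ` X \<longleftrightarrow> prod_decode n \<in> X" for X
          by (auto intro: image_eqI[of _ _ "prod_decode n"])
        then show ?thesis unfolding I_def act_def row_def col_def by (cases "prod_decode n") auto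
      qed
      have low: "n \<in> I" if n: "n < n0" "act n" for n
      proof -
        obtain k i where ki: "prod_decode n = (k, i)" by (cases "prod_decode n")
        then have "prod_encode (k, i) = n" by (metis prod_decode_inverse)
        then have "row n \<le> n" using le_prod_encode_1[of k i] ki by (simp add: row_def)
        then show ?thesis using n K(1) by (simp add: actI)
      qed
      have sumI: "(\<Sum>n\<in>I. F n x *\<^sub>R Z n) = (\<Sum>k\<le>K. \<Sum>i<d k. \<phi> k i (S k x) *\<^sub>R z k i)"
      proof -
        have "(\<Sum>n\<in>I. F n x *\<^sub>R Z n) = (\<Sum>(k, i)\<in>(SIGMA k:{..K}. {..<d k}). \<phi> k i (S k x) *\<^sub>R z k i)"
          unfolding I_def by (subst sum.reindex[OF inj_prod_encode])
            (auto simp: F_def Z_def act_def row_def col_def intro!: sum.cong)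
        then show ?thesis by (simp add: sum.Sigma)
      qed
      have pI: "p ((\<Sum>n\<in>I. F n x *\<^sub>R Z n) - x) \<le> \<epsilon>' * q x"
      proof -
        let ?R = "\<lambda>k. S k x - (\<Sum>i<d k. \<phi> k i (S k x) *\<^sub>R z k i)"
        have e: "(\<Sum>n\<in>I. F n x *\<^sub>R Z n) - x = ((\<Sum>k\<le>K. S k x) - x) - (\<Sum>k\<le>K. ?R k)"
          by (simp add: sumI sum_subtractf)
        have "p ((\<Sum>n\<in>I. F n x *\<^sub>R Z n) - x) \<le> p ((\<Sum>k\<le>K. S k x) - x) + p (\<Sum>k\<le>K. ?R k)"
          unfolding e by (rule seminorm_diff[OF p])
        also have "p (\<Sum>k\<le>K. ?R k) \<le> (\<Sum>k\<le>K. p (?R k))" by (rule seminorm_sum[OF p]) simp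
        also have "(\<Sum>k\<le>K. p (?R k)) = 0" by (simp add: S(3))
        also have "p ((\<Sum>k\<le>K. S k x) - x) + 0 \<le> 3 * (real (K + 1))\<^sup>2 / 4 ^ K * q x" using S(4)[where k = K and x = x] by simp
        also have "\<dots> \<le> \<epsilon>' * q x" using K(2) q0 by (intro mult_right_mono) auto
        finally show ?thesis by simp
      qed
      have "norm (p ((\<Sum>n<N. F n x *\<^sub>R Z n) - x) - 0) < \<epsilon>" if N: "Suc (Max (insert 0 I)) \<le> N" for N
      proof -
        have IN: "I \<subseteq> {..<N}"
        proof
          fix n assume "n \<in> I"
          then have "n \<le> Max (insert 0 I)" using finI by (intro Max_ge) auto
          then show "n \<in> {..<N}" using N by simp
        qed
        have e: "(\<Sum>n<N. F n x *\<^sub>R Z n) - x = ((\<Sum>n\<in>I. F n x *\<^sub>R Z n) - x) + (\<Sum>n\<in>{..<N} - I. F n x *\<^sub>R Z n)"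
          using sum.subset_diff[OF IN, of "\<lambda>n. F n x *\<^sub>R Z n"] by simp
        have tail: "p (\<Sum>n\<in>{..<N} - I. F n x *\<^sub>R Z n) \<le> \<epsilon>' * q x"
        proof -
          have "p (\<Sum>n\<in>{..<N} - I. F n x *\<^sub>R Z n) \<le> (\<Sum>n\<in>{..<N} - I. p (F n x *\<^sub>R Z n))"
            by (rule seminorm_sum[OF p]) simp
          also have "\<dots> \<le> (\<Sum>n\<in>{..<N} - I. c n * q x)"
          proof (rule sum_mono)
            fix n
            have "\<bar>F n x\<bar> * p (Z n) \<le> (c n * q x) * 1"
              using boundF Z1 seminorm_nonneg[OF p] c0 q0 by (intro mult_mono) auto
            then show "p (F n x *\<^sub>R Z n) \<le> c n * q x" by (simp add: seminorm_scale[OF p])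
          qed
          also have "\<dots> = (\<Sum>n\<in>{..<N} - I. c n) * q x" by (simp add: sum_distrib_right)
          also have "\<dots> \<le> \<epsilon>' * q x"
          proof (rule mult_right_mono[OF _ q0])
            have n0_le: "n0 \<le> n" if "n \<notin> I" "c n \<noteq> 0" for n
              using low[of n] that by (cases "n < n0"; cases "act n") (auto simp: c_def)
            have "(\<Sum>n\<in>{..<N} - I. c n) = (\<Sum>n\<in>({..<N} - I) \<inter> {n0..<N}. c n)"
              using n0_le by (intro sum.mono_neutral_right) auto
            also have "\<dots> \<le> (\<Sum>n\<in>{n0..<N}. c n)" using c0 by (intro sum_mono2) auto
            also have "\<dots> \<le> \<epsilon>'" using n0[of n0 N] by simp
            finally show "(\<Sum>n\<in>{..<N} - I. c n) \<le> \<epsilon>'" .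
          qed
          finally show ?thesis .
        qed
        have "p ((\<Sum>n<N. F n x *\<^sub>R Z n) - x) \<le> p ((\<Sum>n\<in>I. F n x *\<^sub>R Z n) - x) + p (\<Sum>n\<in>{..<N} - I. F n x *\<^sub>R Z n)"
          unfolding e by (rule seminorm_add[OF p])
        then have "p ((\<Sum>n<N. F n x *\<^sub>R Z n) - x) < \<epsilon>" using pI tail \<epsilon>'(2) by linarith
        then show ?thesis by (simp add: seminorm_nonneg[OF p])
      qed
      then show "\<exists>N0. \<forall>N\<ge>N0. norm (p ((\<Sum>n<N. F n x *\<^sub>R Z n) - x) - 0) < \<epsilon>" by blast
    qed
  qed
qed

theorem theorem3p1:
  assumes "DF_space TYPE('a::locally_convex_space)"
    and "\<And>s :: nat \<Rightarrow> 'a. convergent s \<Longrightarrow> converges_locally s"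
    and "\<And>u :: nat \<Rightarrow> 'a. summable u \<Longrightarrow>
           domain_of_sums u = (\<lambda>x. (\<Sum>k. u k) + x) ` Gamma_loc u"
  shows "nuclear_space TYPE('a)"
  unfolding nuclear_space_def
proof
  fix p :: "'a \<Rightarrow> real" assume p: "p \<in> cs"
  have kolmogorov: "\<exists>r\<ge>0. \<forall>m\<ge>1. \<exists>Z. finite Z \<and> card Z \<le> m \<and> (\<forall>y\<in>B. sdist p Z y \<le> r / real m ^ 3)"
    if "B \<in> bdd_discs" for B :: "'a set"
  proof (rule rapid_kolmogorov_numbers[OF assms(1) _ _ that p])
    show "converges_locally s" if "convergent s" for s :: "nat \<Rightarrow> 'a"
      by (rule assms(2)[OF that])
    show "domain_of_sums u = (\<lambda>x. (\<Sum>k. u k) + x) ` Gamma_loc u" if "summable u" for u :: "nat \<Rightarrow> 'a"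
      by (rule assms(3)[OF that])
  qed
  have "\<exists>q\<in>cs. \<exists>W. (\<forall>x. p x \<le> q x) \<and>
    (\<forall>k. finite (W k) \<and> card (W k) \<le> (k + 1)\<^sup>2 * 2 ^ k \<and> W k \<subseteq> W (Suc k)) \<and>
    (\<forall>k x. sdist p (W k) x \<le> q x / 8 ^ k)"
    by (rule dominating_seminorm[OF assms(1) p]) (rule kolmogorov)
  then obtain q where q: "q \<in> cs" and "\<exists>W. (\<forall>x. p x \<le> q x) \<and>
    (\<forall>k. finite (W k) \<and> card (W k) \<le> (k + 1)\<^sup>2 * 2 ^ k \<and> W k \<subseteq> W (Suc k)) \<and>
    (\<forall>k x. sdist p (W k) x \<le> q x / 8 ^ k)" ..
  from this(2) obtain W where all: "(\<forall>x. p x \<le> q x) \<and>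
    (\<forall>k. finite (W k) \<and> card (W k) \<le> (k + 1)\<^sup>2 * 2 ^ k \<and> W k \<subseteq> W (Suc k)) \<and>
    (\<forall>k x. sdist p (W k) x \<le> q x / 8 ^ k)" ..
  have pq: "p x \<le> q x" for x by (rule spec[OF conjunct1[OF all]])
  have rapid: "sdist p (W k) x \<le> q x / 8 ^ k" for k x
    by (rule spec[OF spec[OF conjunct2[OF conjunct2[OF all]]]])
  have "finite (W k) \<and> card (W k) \<le> (k + 1)\<^sup>2 * 2 ^ k \<and> W k \<subseteq> W (Suc k)" for k
    by (rule spec[OF conjunct1[OF conjunct2[OF all]]])
  then have W: "finite (W k)" "card (W k) \<le> (k + 1)\<^sup>2 * 2 ^ k" "W k \<subseteq> W (Suc k)" for k
    by simp_all
  have "nuclear_map (E_sub_p q) (E_sub_p p) (canonical_map p)"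
  proof (rule nuclear_map_of_rapid_approximation[where p = p and q = q and W = W])
    show "is_seminorm p" "is_seminorm q" by (rule csD(1)[OF p], rule csD(1)[OF q])
    show "p x \<le> q x" for x by (rule pq)
    show "finite (W k)" "card (W k) \<le> (k + 1)\<^sup>2 * 2 ^ k" "W k \<subseteq> W (Suc k)" for k
      by (rule W)+
    show "sdist p (W k) x \<le> q x / 8 ^ k" for k x by (rule rapid)
  qed
  show "\<exists>q\<in>cs. (\<forall>x. p x \<le> q x) \<and> nuclear_map (E_sub_p q) (E_sub_p p) (canonical_map p)"
    by (rule bexI[OF _ q], intro conjI allI) fact+
qed

end
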